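(* Let $k\{Y\}=k\{y_1,\ldots,y_l\}$ be a ring of differential polynomials over a differential field $k$ of characteristic zero, with a fixed ranking. Let $\mathbb{A}$ be a characterizing set of a characterizable differential ideal $I=[\mathbb{A}]:H_{\mathbb{A}}^\infty$. Let $L$ be the set of leaders of $\mathbb{A}$ and $N=\Theta Y\setminus\Theta L$. Let $GB$ be the reduced Gröbner basis, with respect to $>_{\rm lex}$, of the ideal $(\mathbb{A}):H_{\mathbb{A}}^\infty$ in $k(N)[L]$. Let $\mathbb{C}\subset k[N][L]$ be obtained from $GB$ by clearing out denominators (multiplying each element of $GB$ by the least common multiple in $k[N]$ of the denominators of its coefficients) and then dividing each resulting element by its leading coefficient from $k$ (so that its initial has leading coefficient $1$). Then $\mathbb{C}$ is a canonical characteristic set of $I$. Moreover, $\mathbb{C}$ characterizes $I$, i.e. $I=[\mathbb{C}]:H_{\mathbb{C}}^\infty$.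
   Context: $\Delta=\{\delta_1,\ldots,\delta_n\}$ is a finite set of commuting derivations, $\Theta$ the free commutative monoid of derivative operators $\delta_1^{k_1}\cdots\delta_n^{k_n}$. $k\{Y\}$ is the polynomial ring over $k$ in the differential variables $\Theta Y=\{\theta y_j\}$. $(F)$ is the ideal and $[F]$ the differential ideal generated by $F$. A ranking is a total order on $\Theta Y$ such that $\theta u\geq u$ and ($u\geq v\Rightarrow\theta u\geq\theta v$). The leader $u_f$ of $f\notin k$ is the highest differential variable in $f$; if $d=\deg_{u_f}f$, the initial $I_f$ is the coefficient of $u_f^d$, the separant is $S_f=\partial f/\partial u_f$, and the rank is $u_f^d$. Ranks are compared by $u^{d}>v^{e}$ iff $u>v$, or $u=v$ and $d>e$. $f$ is reduced with respect to $g$ if no proper derivative of $u_g$ appears in $f$ and $\deg_{u_g}f<\deg_{u_g}g$. A set $\mathbb{A}\subset k\{Y\}\setminus k$ is autoreduced if each element is reduced with respect to all the others; such sets are finite and written in order of increasing rank. $\mathbb{A}=A_1,\ldots,A_r$ has lower rank than $\mathbb{B}=B_1,\ldots,B_s$ if there is $j\le r,s$ with $\operatorname{rank}A_i=\operatorname{rank}B_i$ for $i<j$ and $\operatorname{rank}A_j<\operatorname{rank}B_j$, or if $r>s$ and $\operatorname{rank}A_i=\operatorname{rank}B_i$ for $1\le i\le s$. A characteristic set of an ideal is an autoreduced subset of it of lowest rank. $H_{\mathbb{A}}$ is the product of the initials and separants of the elements of $\mathbb{A}$, and $J:H_{\mathbb{A}}^\infty=\{a : H_{\mathbb{A}}^m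 a\in J\text{ for some }m\geq0\}$. A differential ideal $I$ is characterizable if $I=[\mathbb{A}]:H_{\mathbb{A}}^\infty$ for some characteristic set $\mathbb{A}$ of $I$; any such $\mathbb{A}$ is called a characterizing set of $I$ (it characterizes $I$). $>_{\rm lex}$ is the lexicographic order on power products of differential variables induced by the ranking. $k(N)$ is the field of fractions of $k[N]$; elements of an autoreduced set with leaders $L$ lie in $k[N][L]$. A characteristic set $\mathbb{C}=C_1,\ldots,C_p$ of a characterizable ideal $I$, with set of leaders $L$ and non-leaders $N=\Theta Y\setminus\Theta L$, is canonical if (1) $I_{C_i}\in k[N]$ for all $i$; (2) for each $i$, $C_i$ has no factors in $k[N]$ (other than constants of $k$), and the coefficient in $I_{C_i}$ of its leading monomial with respect to $>_{\rm lex}$ equals $1$. *)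

theory Defs
  imports
    "HOL.Hull"
    "HOL-Library.Poly_Mapping"
    "HOL-Library.Product_Lexorder"
    "HOL-Computational_Algebra.Fraction_Field"
begin

text \<open>
  A power product is a finitely supported exponent function, a polynomial a finitely supported
  function from power products to coefficients; \<^const>\<open>Poly_Mapping.keys\<close> gives the monomials
  occurring in it and \<^const>\<open>Poly_Mapping.lookup\<close> their coefficients.
\<close>

type_synonym 'v power_product = "'v \<Rightarrow>\<^sub>0 nat"
type_synonym ('v, 'a) mpoly = "'v power_product \<Rightarrow>\<^sub>0 'a"

definition const :: "'a \<Rightarrow> ('v, 'a::zero) mpoly" where
  "const c = Poly_Mapping.single 0 c"

definition var :: "'v \<Rightarrow> ('v, 'a::zero_neq_one) mpoly" where
  "var v = Poly_Mapping.single (Poly_Mapping.single v 1) 1"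

definition vars :: "('v, 'a::zero) mpoly \<Rightarrow> 'v set" where
  "vars p = (\<Union>m \<in> Poly_Mapping.keys p. Poly_Mapping.keys m)"

definition polys_in :: "'v set \<Rightarrow> ('v, 'a::zero) mpoly set" where
  "polys_in V = {p. vars p \<subseteq> V}"

definition deg_in :: "'v \<Rightarrow> ('v, 'a::zero) mpoly \<Rightarrow> nat" where
  "deg_in v p = Max (insert 0 ((\<lambda>m. Poly_Mapping.lookup m v) ` Poly_Mapping.keys p))"

definition coeff_in :: "'v \<Rightarrow> nat \<Rightarrow> ('v, 'a::comm_monoid_add) mpoly \<Rightarrow> ('v, 'a) mpoly" where
  "coeff_in v d p =
    (\<Sum>m \<in> {m \<in> Poly_Mapping.keys p. Poly_Mapping.lookup m v = d}.
       Poly_Mapping.single (m - Poly_Mapping.single v d) (Poly_Mapping.lookup p m))"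

definition partial_deriv :: "'v \<Rightarrow> ('v, 'a::comm_semiring_1) mpoly \<Rightarrow> ('v, 'a) mpoly" where
  "partial_deriv v p =
    (\<Sum>m \<in> Poly_Mapping.keys p.
       Poly_Mapping.single (m - Poly_Mapping.single v 1)
         (of_nat (Poly_Mapping.lookup m v) * Poly_Mapping.lookup p m))"

text \<open>
  \<open>R\<close> is the carrier of a subring of the ambient type. The ideal of \<open>R\<close> generated by \<open>F\<close> is
  \<open>ideal_of R hull F\<close>.
\<close>

definition ideal_of :: "'a::comm_ring_1 set \<Rightarrow> 'a set \<Rightarrow> bool" where
  "ideal_of R J \<longleftrightarrow> J \<subseteq> R \<and> 0 \<in> J \<and> (\<forall>a\<in>J. \<forall>b\<in>J. a + b \<in> J) \<and> (\<forall>r\<in>R. \<forall>a\<in>J. r * a \<in> J)"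

definition saturation :: "'a::comm_ring_1 set \<Rightarrow> 'a set \<Rightarrow> 'a \<Rightarrow> 'a set" where
  "saturation R J h = {a \<in> R. \<exists>m. h ^ m * a \<in> J}"

definition derivation :: "('a::comm_ring_1 \<Rightarrow> 'a) \<Rightarrow> bool" where
  "derivation d \<longleftrightarrow> (\<forall>a b. d (a + b) = d a + d b) \<and> (\<forall>a b. d (a * b) = d a * b + a * d b)"

definition differential_field :: "('n \<Rightarrow> 'k::field \<Rightarrow> 'k) \<Rightarrow> bool" where
  "differential_field \<delta> \<longleftrightarrow> (\<forall>i. derivation (\<delta> i)) \<and> (\<forall>i j a. \<delta> i (\<delta> j a) = \<delta> j (\<delta> i a))"

text \<open>
  The derivative operator \<open>\<delta>\<^sub>1\<^bsup>k\<^sub>1\<^esup> \<cdots> \<delta>\<^sub>n\<^bsup>k\<^sub>n\<^esup>\<close> is the exponent function \<open>k\<close>, and the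
  differential variable \<open>\<theta> y\<^sub>j\<close> is the pair \<open>(\<theta>, j)\<close>. The type classes \<^class>\<open>linorder\<close> on the
  index types below, and the resulting lexicographic order on pairs, only serve to make the
  polynomial ring an instance of \<^class>\<open>idom\<close>; they are unrelated to the ranking, which is the
  parameter \<open>le\<close>.
\<close>

type_synonym 'n deriv_op = "'n \<Rightarrow>\<^sub>0 nat"
type_synonym ('n, 'l) dvar = "'n deriv_op \<times> 'l"
type_synonym ('n, 'l, 'k) dpoly = "(('n, 'l) dvar, 'k) mpoly"

definition apply_op :: "'n deriv_op \<Rightarrow> ('n, 'l) dvar \<Rightarrow> ('n, 'l) dvar" where
  "apply_op \<theta> u = (\<theta> + fst u, snd u)"

definition derivatives :: "('n, 'l) dvar set \<Rightarrow> ('n, 'l) dvar set" where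
  "derivatives L = {apply_op \<theta> u | \<theta> u. u \<in> L}"

text \<open>
  The derivation on \<open>k{Y}\<close> extending \<open>\<delta> i\<close> on \<open>k\<close> and mapping each differential variable \<open>v\<close>
  to \<open>\<delta>\<^sub>i v\<close>, written out by the chain rule.
\<close>

definition dderiv :: "('n \<Rightarrow> 'k \<Rightarrow> 'k) \<Rightarrow> 'n \<Rightarrow> ('n, 'l, 'k::field) dpoly \<Rightarrow> ('n, 'l, 'k) dpoly" where
  "dderiv \<delta> i p = Poly_Mapping.map (\<delta> i) p +
     (\<Sum>v \<in> vars p. partial_deriv v p * var (apply_op (Poly_Mapping.single i 1) v))"

definition diff_ideal :: "('n \<Rightarrow> 'k \<Rightarrow> 'k) \<Rightarrow> ('n, 'l, 'k::field) dpoly set \<Rightarrow> bool" where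
  "diff_ideal \<delta> J \<longleftrightarrow> ideal_of UNIV J \<and> (\<forall>i. \<forall>p\<in>J. dderiv \<delta> i p \<in> J)"

definition ranking :: "(('n, 'l) dvar \<Rightarrow> ('n, 'l) dvar \<Rightarrow> bool) \<Rightarrow> bool" where
  "ranking le \<longleftrightarrow> linear_order {(u, v). le u v} \<and>
     (\<forall>\<theta> u. le u (apply_op \<theta> u)) \<and>
     (\<forall>\<theta> u v. le v u \<longrightarrow> le (apply_op \<theta> v) (apply_op \<theta> u))"

definition leader :: "('v \<Rightarrow> 'v \<Rightarrow> bool) \<Rightarrow> ('v, 'a::zero) mpoly \<Rightarrow> 'v" where
  "leader le f = (THE u. u \<in> vars f \<and> (\<forall>v \<in> vars f. le v u))"

definition init :: "('v \<Rightarrow> 'v \<Rightarrow> bool) \<Rightarrow> ('v, 'a::comm_monoid_add) mpoly \<Rightarrow> ('v, 'a) mpoly" where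
  "init le f = coeff_in (leader le f) (deg_in (leader le f) f) f"

definition separant :: "('v \<Rightarrow> 'v \<Rightarrow> bool) \<Rightarrow> ('v, 'a::comm_semiring_1) mpoly \<Rightarrow> ('v, 'a) mpoly"
  where "separant le f = partial_deriv (leader le f) f"

definition init_sep_prod ::
    "('v \<Rightarrow> 'v \<Rightarrow> bool) \<Rightarrow> ('v, 'a::comm_semiring_1) mpoly set \<Rightarrow> ('v, 'a) mpoly" where
  "init_sep_prod le A = (\<Prod>f\<in>A. init le f * separant le f)"

definition rank :: "('v \<Rightarrow> 'v \<Rightarrow> bool) \<Rightarrow> ('v, 'a::zero) mpoly \<Rightarrow> 'v \<times> nat" where
  "rank le f = (leader le f, deg_in (leader le f) f)"

definition rank_less :: "('v \<Rightarrow> 'v \<Rightarrow> bool) \<Rightarrow> 'v \<times> nat \<Rightarrow> 'v \<times> nat \<Rightarrow> bool" where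
  "rank_less le r s \<longleftrightarrow>
     (le (fst r) (fst s) \<and> fst r \<noteq> fst s) \<or> (fst r = fst s \<and> snd r < snd s)"

definition reduced_wrt :: "(('n, 'l) dvar \<Rightarrow> ('n, 'l) dvar \<Rightarrow> bool) \<Rightarrow>
    ('n, 'l, 'k::zero) dpoly \<Rightarrow> ('n, 'l, 'k) dpoly \<Rightarrow> bool" where
  "reduced_wrt le f g \<longleftrightarrow>
     (\<forall>\<theta>. \<theta> \<noteq> 0 \<longrightarrow> apply_op \<theta> (leader le g) \<notin> vars f) \<and>
     deg_in (leader le g) f < deg_in (leader le g) g"

definition autoreduced ::
    "(('n, 'l) dvar \<Rightarrow> ('n, 'l) dvar \<Rightarrow> bool) \<Rightarrow> ('n, 'l, 'k::zero) dpoly set \<Rightarrow> bool" where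
  "autoreduced le A \<longleftrightarrow>
     (\<forall>f\<in>A. vars f \<noteq> {}) \<and> (\<forall>f\<in>A. \<forall>g\<in>A. f \<noteq> g \<longrightarrow> reduced_wrt le f g)"

definition ranked_list :: "('v \<Rightarrow> 'v \<Rightarrow> bool) \<Rightarrow> ('v, 'a::zero) mpoly list \<Rightarrow> bool" where
  "ranked_list le fs \<longleftrightarrow> sorted_wrt (\<lambda>f g. rank_less le (rank le f) (rank le g)) fs"

text \<open>
  Autoreduced sets are finite and their elements have pairwise different ranks, so each of them
  is the set of exactly one list \<open>fs\<close> with \<open>ranked_list le fs\<close>.
\<close>

definition lower_rank ::
    "('v \<Rightarrow> 'v \<Rightarrow> bool) \<Rightarrow> ('v, 'a::zero) mpoly set \<Rightarrow> ('v, 'a) mpoly set \<Rightarrow> bool" where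
  "lower_rank le A B \<longleftrightarrow>
     (\<exists>fs gs. set fs = A \<and> set gs = B \<and> ranked_list le fs \<and> ranked_list le gs \<and>
        ((\<exists>j. j < length fs \<and> j < length gs \<and>
            (\<forall>i<j. rank le (fs ! i) = rank le (gs ! i)) \<and>
            rank_less le (rank le (fs ! j)) (rank le (gs ! j))) \<or>
         (length gs < length fs \<and> (\<forall>i<length gs. rank le (fs ! i) = rank le (gs ! i)))))"

definition characteristic_set :: "(('n, 'l) dvar \<Rightarrow> ('n, 'l) dvar \<Rightarrow> bool) \<Rightarrow>
    ('n, 'l, 'k::zero) dpoly set \<Rightarrow> ('n, 'l, 'k) dpoly set \<Rightarrow> bool" where
  "characteristic_set le I A \<longleftrightarrow>
     A \<subseteq> I \<and> autoreduced le A \<and> (\<forall>B. B \<subseteq> I \<and> autoreduced le B \<longrightarrow> \<not> lower_rank le B A)"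

definition characterizes :: "('n \<Rightarrow> 'k \<Rightarrow> 'k) \<Rightarrow> (('n, 'l) dvar \<Rightarrow> ('n, 'l) dvar \<Rightarrow> bool) \<Rightarrow>
    ('n, 'l, 'k::field) dpoly set \<Rightarrow> ('n, 'l, 'k) dpoly set \<Rightarrow> bool" where
  "characterizes \<delta> le A I \<longleftrightarrow>
     diff_ideal \<delta> I \<and> characteristic_set le I A \<and>
     I = saturation UNIV (diff_ideal \<delta> hull A) (init_sep_prod le A)"

definition characterizable :: "('n \<Rightarrow> 'k \<Rightarrow> 'k) \<Rightarrow> (('n, 'l) dvar \<Rightarrow> ('n, 'l) dvar \<Rightarrow> bool) \<Rightarrow>
    ('n, 'l, 'k::field) dpoly set \<Rightarrow> bool" where
  "characterizable \<delta> le I \<longleftrightarrow> (\<exists>A. characterizes \<delta> le A I)"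

definition lex_less :: "('v \<Rightarrow> 'v \<Rightarrow> bool) \<Rightarrow> 'v power_product \<Rightarrow> 'v power_product \<Rightarrow> bool" where
  "lex_less le s t \<longleftrightarrow>
     (\<exists>v. Poly_Mapping.lookup s v < Poly_Mapping.lookup t v \<and>
        (\<forall>w. le v w \<and> w \<noteq> v \<longrightarrow> Poly_Mapping.lookup s w = Poly_Mapping.lookup t w))"

definition lead_monomial :: "('v \<Rightarrow> 'v \<Rightarrow> bool) \<Rightarrow> ('v, 'a::zero) mpoly \<Rightarrow> 'v power_product" where
  "lead_monomial le p =
     (THE t. t \<in> Poly_Mapping.keys p \<and> (\<forall>s \<in> Poly_Mapping.keys p. s \<noteq> t \<longrightarrow> lex_less le s t))"

definition lead_coefficient :: "('v \<Rightarrow> 'v \<Rightarrow> bool) \<Rightarrow> ('v, 'a::zero) mpoly \<Rightarrow> 'a" where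
  "lead_coefficient le p = Poly_Mapping.lookup p (lead_monomial le p)"

definition lead_term :: "('v \<Rightarrow> 'v \<Rightarrow> bool) \<Rightarrow> ('v, 'a::zero) mpoly \<Rightarrow> ('v, 'a) mpoly" where
  "lead_term le p = Poly_Mapping.single (lead_monomial le p) (lead_coefficient le p)"

text \<open>\<open>R\<close> is a polynomial ring over a field, given as a subring of the ambient polynomial type.\<close>

definition reduced_groebner_basis :: "('v \<Rightarrow> 'v \<Rightarrow> bool) \<Rightarrow> ('v, 'a::field) mpoly set \<Rightarrow>
    ('v, 'a) mpoly set \<Rightarrow> ('v, 'a) mpoly set \<Rightarrow> bool" where
  "reduced_groebner_basis le R J G \<longleftrightarrow>
     finite G \<and> G \<subseteq> J \<and>
     ideal_of R hull (lead_term le ` G) = ideal_of R hull (lead_term le ` (J - {0})) \<and>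
     (\<forall>g\<in>G. lead_coefficient le g = 1) \<and>
     (\<forall>g\<in>G. \<forall>m \<in> Poly_Mapping.keys g.
        Poly_Mapping.single m 1 \<notin> ideal_of R hull (lead_term le ` (G - {g})))"

text \<open>
  The field \<open>k(N)\<close> is realised as a subfield of the fraction field of the whole polynomial ring,
  and \<open>k(N)[L]\<close> as a subring of the polynomials over that fraction field.
\<close>

definition rat_funs :: "'v::linorder set \<Rightarrow> ('v, 'k::field) mpoly fract set" where
  "rat_funs N = {Fract a b | a b. a \<in> polys_in N \<and> b \<in> polys_in N \<and> b \<noteq> 0}"

definition polys_over_rat_funs ::
    "'v::linorder set \<Rightarrow> 'v set \<Rightarrow> ('v, ('v, 'k::field) mpoly fract) mpoly set" where
  "polys_over_rat_funs N L =
     {p. p \<in> polys_in L \<and> (\<forall>m. Poly_Mapping.lookup p m \<in> rat_funs N)}"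

definition restrict_pp :: "'v set \<Rightarrow> 'v power_product \<Rightarrow> 'v power_product" where
  "restrict_pp V m =
     (\<Sum>v \<in> Poly_Mapping.keys m \<inter> V. Poly_Mapping.single v (Poly_Mapping.lookup m v))"

text \<open>
  The embedding of \<open>k[N][L]\<close> into \<open>k(N)[L]\<close>: in each monomial the variables from \<open>L\<close> are kept,
  all the others are moved into the coefficient.
\<close>

definition embed :: "'v::linorder set \<Rightarrow> ('v, 'k::field) mpoly \<Rightarrow> ('v, ('v, 'k) mpoly fract) mpoly"
  where
  "embed L p =
     (\<Sum>m \<in> Poly_Mapping.keys p. Poly_Mapping.single (restrict_pp L m)
        (Fract (Poly_Mapping.single (restrict_pp (- L) m) (Poly_Mapping.lookup p m)) 1))"

text \<open>
  All denominators \<open>b\<close> of \<open>c\<close> written in lowest terms; they differ by nonzero constants.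
  Divisibility of elements of \<open>k[N]\<close> means the same in \<open>k[N]\<close> and in the whole polynomial
  ring, since factors of a nonzero element of \<open>k[N]\<close> lie in \<open>k[N]\<close>.
\<close>

definition is_denominator ::
    "'v::linorder set \<Rightarrow> ('v, 'k::field) mpoly fract \<Rightarrow> ('v, 'k) mpoly \<Rightarrow> bool" where
  "is_denominator N c b \<longleftrightarrow>
     b \<in> polys_in N \<and> b \<noteq> 0 \<and>
     (\<exists>a \<in> polys_in N. (\<forall>d. d dvd a \<longrightarrow> d dvd b \<longrightarrow> d dvd 1) \<and> c = Fract a b)"

definition is_lcm_in :: "'v::linorder set \<Rightarrow> ('v, 'k::field) mpoly set \<Rightarrow> ('v, 'k) mpoly \<Rightarrow> bool" where
  "is_lcm_in N S q \<longleftrightarrow>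
     q \<in> polys_in N \<and> (\<forall>b\<in>S. b dvd q) \<and>
     (\<forall>q' \<in> polys_in N. (\<forall>b\<in>S. b dvd q') \<longrightarrow> q dvd q')"

definition denominators :: "'v::linorder set \<Rightarrow> ('v, ('v, 'k::field) mpoly fract) mpoly \<Rightarrow>
    ('v, 'k) mpoly set" where
  "denominators N g =
     {b. \<exists>m \<in> Poly_Mapping.keys g. is_denominator N (Poly_Mapping.lookup g m) b}"

text \<open>
  The least common multiple \<open>q\<close> is determined up to a nonzero constant only; dividing by the
  leading coefficient makes the result unique. With respect to the lexicographic order, the
  leading coefficient of \<open>p\<close> is also that of its initial.
\<close>

definition cleared :: "('v \<Rightarrow> 'v \<Rightarrow> bool) \<Rightarrow> 'v::linorder set \<Rightarrow> 'v set \<Rightarrow>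
    ('v, ('v, 'k::field) mpoly fract) mpoly \<Rightarrow> ('v, 'k) mpoly \<Rightarrow> bool" where
  "cleared le N L g c \<longleftrightarrow>
     (\<exists>q p. is_lcm_in N (denominators N g) q \<and> p \<in> polys_in (N \<union> L) \<and>
        embed L p = const (Fract q 1) * g \<and>
        c = const (inverse (lead_coefficient le p)) * p)"

definition canonical_characteristic_set :: "('n \<Rightarrow> 'k \<Rightarrow> 'k) \<Rightarrow>
    (('n, 'l) dvar \<Rightarrow> ('n, 'l) dvar \<Rightarrow> bool) \<Rightarrow>
    ('n, 'l, 'k::field) dpoly set \<Rightarrow> ('n, 'l, 'k) dpoly set \<Rightarrow> bool" where
  "canonical_characteristic_set \<delta> le I C \<longleftrightarrow>
     characterizable \<delta> le I \<and> characteristic_set le I C \<and>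
     (let N = - derivatives (leader le ` C) in
       \<forall>f\<in>C. init le f \<in> polys_in N \<and>
         (\<forall>q \<in> polys_in N. q dvd f \<longrightarrow> vars q = {}) \<and>
         lead_coefficient le (init le f) = 1)"

end

theory Submission
  imports
    Defs
    "HOL-Computational_Algebra.Polynomial"
    "HOL-Computational_Algebra.Factorial_Ring"
begin

text \<open>
  Let \<open>S\<close> be the set of elements that are not zero divisors modulo \<open>I\<close>. The elements of \<open>I\<close> that
  are reduced with respect to \<open>A\<close> vanish, so differential pseudo-reduction shows that \<open>S\<close> contains
  every nonzero \<open>s\<close> in \<open>k[N]\<close>: if \<open>s x\<close> lies in \<open>I\<close> and \<open>r\<close> is the remainder of \<open>x\<close>, then
  \<open>s r\<close> is reduced and lies in \<open>I\<close>. Hence \<open>(A) : H\<^sup>\<infinity>\<close> in \<open>k(N)[L]\<close> consists of the quotients of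
  elements of \<open>I\<close> by elements of \<open>k[N]\<close>.

  By induction on the leader \<open>u\<close>, linear dependence of the remainders of the powers of an initial
  makes the initial invertible modulo \<open>I\<close> up to a factor in \<open>k[N]\<close>. So \<open>I\<close> contains
  \<open>s u\<^sup>d + t\<close>, where \<open>u\<^sup>d\<close> is the rank of an element of \<open>A\<close>, \<open>t\<close> is reduced, and \<open>s \<noteq> 0\<close> is a
  polynomial in the variables of \<open>N\<close> below \<open>u\<close>. Uniqueness of reduced elements identifies the
  Groebner basis with the polynomials \<open>u\<^sup>d + t / s\<close>. Since \<open>k[N]\<close> is factorial, the least common
  denominators divide \<open>s\<close>, so clearing denominators keeps the leaders and ranks of \<open>A\<close>.
\<close>

text \<open>The ideal \<open>I\<close> need not be prime, so nonzero divisors modulo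
  \<open>I\<close> take the place of elements outside a prime ideal; initials and separants of
  \<open>A\<close> are of this kind because \<open>I\<close> is saturated by their product.
  Minimality of \<open>A\<close> only shows that reduced elements of \<open>I\<close> are constant,
  since constants do not take part in the comparison of ranks. That they vanish needs
  \<open>1 \<notin> I\<close>, which has to be extracted from the saturation formula: otherwise
  every differential indeterminate would be a leader of degree one, and such a system has a solution
  in \<open>k\<close>. The ranking interleaves leaders and nonleaders. A denominator containing a
  nonleader above \<open>u\<close> would enter the cleared polynomial and become its leader. For
  this reason inverses of initials are built along the ranking, which is well founded by Dickson's
  lemma, with the variables that occur bounded by the leader at every stage. The differential
  variables are infinitely many, but a divisibility statement involves only finitely many of them,
  so factoriality is an induction over finite sets of variables.\<close>

hide_const (open) Rat.Fract

abbreviation "lookup \<equiv> Poly_Mapping.lookup"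
abbreviation "keys \<equiv> Poly_Mapping.keys"
abbreviation "single \<equiv> Poly_Mapping.single"

section \<open>Algebra of multivariate polynomials: variables, degrees, partial derivatives\<close>

section \<open>Polynomials as sums of monomials\<close>

lemma sum_single_lookup:
  fixes p :: "'m \<Rightarrow>\<^sub>0 'a::comm_monoid_add"
  shows "(\<Sum>m\<in>keys p. single m (lookup p m)) = p"
proof (rule poly_mapping_eqI)
  fix k
  show "lookup (\<Sum>m\<in>keys p. single m (lookup p m)) k = lookup p k"
    by (cases "k \<in> keys p")
      (auto simp: lookup_sum lookup_single when_def sum.delta in_keys_iff)
qed

lemma mpoly_induct [case_names single add]:
  fixes p :: "'m \<Rightarrow>\<^sub>0 'a::comm_monoid_add"
  assumes "\<And>m a. P (single m a)" "\<And>p q. P p \<Longrightarrow> P q \<Longrightarrow> P (p + q)"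
  shows "P p"
proof -
  have "P (\<Sum>m\<in>S. single m (lookup p m))" if "finite S" for S
    using that
  proof induction
    case empty
    then show ?case using assms(1)[of undefined 0] by simp
  next
    case (insert x F)
    then show ?case using assms by simp
  qed
  from this[of "keys p"] show ?thesis by (simp add: sum_single_lookup)
qed

text \<open>Coefficients in one variable, the univariate view, partial derivatives, evaluation and
  the embedding are all sums over the monomials. With this combinator their additivity and
  multiplicativity reduce to checks on single terms.\<close>

definition msum :: "('m \<Rightarrow> 'a::zero \<Rightarrow> 'b::comm_monoid_add) \<Rightarrow> ('m \<Rightarrow>\<^sub>0 'a) \<Rightarrow> 'b" where
  "msum f p = (\<Sum>m\<in>keys p. f m (lookup p m))"

lemma msum_superset:
  assumes "finite S" "keys p \<subseteq> S" "\<And>m. f m 0 = 0"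
  shows "msum f p = (\<Sum>m\<in>S. f m (lookup p m))"
  unfolding msum_def using assms
  by (intro sum.mono_neutral_left) (auto simp: in_keys_iff)

lemma msum_single: "f m 0 = 0 \<Longrightarrow> msum f (single m a) = f m a"
  by (simp add: msum_def)

lemma msum_zero [simp]: "msum f 0 = 0"
  by (simp add: msum_def)

lemma msum_add:
  fixes p q :: "'m \<Rightarrow>\<^sub>0 'a::comm_monoid_add"
  assumes "\<And>m. f m 0 = 0" "\<And>m a b. f m (a + b) = f m a + f m b"
  shows "msum f (p + q) = msum f p + msum f q"
proof -
  let ?S = "keys p \<union> keys q"
  have "msum f (p + q) = (\<Sum>m\<in>?S. f m (lookup (p + q) m))"
    using assms(1) by (intro msum_superset) (auto simp: keys_add)
  also have "\<dots> = (\<Sum>m\<in>?S. f m (lookup p m)) + (\<Sum>m\<in>?S. f m (lookup q m))"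
    by (simp add: lookup_add assms(2) sum.distrib)
  also have "(\<Sum>m\<in>?S. f m (lookup p m)) = msum f p"
    using assms(1) by (intro msum_superset[symmetric]) auto
  also have "(\<Sum>m\<in>?S. f m (lookup q m)) = msum f q"
    using assms(1) by (intro msum_superset[symmetric]) auto
  finally show ?thesis .
qed

lemma msum_mult:
  fixes p q :: "'m::comm_monoid_add \<Rightarrow>\<^sub>0 'a::comm_semiring_0"
    and f :: "'m \<Rightarrow> 'a \<Rightarrow> 'b::comm_semiring_0"
  assumes "\<And>m. f m 0 = 0" "\<And>m a b. f m (a + b) = f m a + f m b"
    and "\<And>m n a b. f (m + n) (a * b) = f m a * f n b"
  shows "msum f (p * q) = msum f p * msum f q"
proof (induction p rule: mpoly_induct)
  case (single m a)
  show ?case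
  proof (induction q rule: mpoly_induct)
    case (single n b)
    then show ?case using assms by (simp add: mult_single msum_single)
  next
    case (add p q)
    then show ?case using assms by (simp add: distrib_left msum_add)
  qed
next
  case (add p1 p2)
  then show ?case using assms by (simp add: distrib_right msum_add)
qed

section \<open>Variables\<close>

lemma in_vars_iff: "v \<in> vars p \<longleftrightarrow> (\<exists>m\<in>keys p. lookup m v \<noteq> 0)"
  by (auto simp: vars_def in_keys_iff)

lemma finite_vars [simp]: "finite (vars p)"
  by (simp add: vars_def)

lemma vars_zero [simp]: "vars 0 = {}"
  by (simp add: vars_def)

lemma vars_one [simp]: "vars 1 = {}"
  by (simp add: vars_def)

lemma vars_single_subset: "vars (single m a) \<subseteq> keys m"
  by (auto simp: vars_def)

lemma vars_const [simp]: "vars (const c) = {}"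
  by (auto simp: vars_def const_def)

lemma vars_var [simp]: "vars (var v :: ('v, 'a::zero_neq_one) mpoly) = {v}"
  by (auto simp: vars_def var_def)

lemma vars_add: "vars (p + q) \<subseteq> vars p \<union> vars q"
  using keys_add[of p q] by (auto simp: vars_def)

lemma vars_uminus [simp]: "vars (- p) = vars (p :: ('v, 'a::ab_group_add) mpoly)"
  by (simp add: vars_def in_keys_iff set_eq_iff)

lemma vars_diff: "vars (p - q) \<subseteq> vars p \<union> vars (q :: ('v, 'a::ab_group_add) mpoly)"
  using vars_add[of p "- q"] by simp

lemma vars_mult: "vars (p * q) \<subseteq> vars p \<union> vars (q :: ('v, 'a::comm_semiring_0) mpoly)"
proof
  fix v
  assume "v \<in> vars (p * q)"
  then obtain m where m: "m \<in> keys (p * q)" "lookup m v \<noteq> 0"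
    by (auto simp: in_vars_iff)
  with keys_mult[of p q] obtain a b where "m = a + b" "a \<in> keys p" "b \<in> keys q"
    by blast
  with m show "v \<in> vars p \<union> vars q"
    by (auto simp: in_vars_iff lookup_add)
qed

lemma vars_empty_iff:
  fixes p :: "('v, 'a::comm_monoid_add) mpoly"
  shows "vars p = {} \<longleftrightarrow> (\<exists>c. p = const c)"
proof
  assume *: "vars p = {}"
  have "m = 0" if "m \<in> keys p" for m
    using * that by (auto simp: vars_def)
  then have "p = const (lookup p 0)"
    by (intro poly_mapping_eqI) (auto simp: const_def lookup_single when_def in_keys_iff)
  then show "\<exists>c. p = const c" ..
qed auto

lemma polys_in_iff: "p \<in> polys_in V \<longleftrightarrow> vars p \<subseteq> V"
  by (simp add: polys_in_def)

lemma polys_in_mono: "V \<subseteq> W \<Longrightarrow> p \<in> polys_in V \<Longrightarrow> p \<in> polys_in W"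
  by (auto simp: polys_in_iff)

lemma polys_in_zero [simp]: "0 \<in> polys_in V"
  and polys_in_one [simp]: "1 \<in> polys_in V"
  and polys_in_const [simp]: "const c \<in> polys_in V"
  by (auto simp: polys_in_iff)

lemma polys_in_var: "v \<in> V \<Longrightarrow> var v \<in> polys_in V"
  by (auto simp: polys_in_iff)

lemma polys_in_single: "keys m \<subseteq> V \<Longrightarrow> single m a \<in> polys_in V"
  using vars_single_subset[of m a] by (auto simp: polys_in_iff)

lemma polys_in_add: "p \<in> polys_in V \<Longrightarrow> q \<in> polys_in V \<Longrightarrow> p + q \<in> polys_in V"
  using vars_add[of p q] by (auto simp: polys_in_iff)

lemma polys_in_uminus: "p \<in> polys_in V \<Longrightarrow> - p \<in> polys_in V"
  for p :: "('v, 'a::ab_group_add) mpoly"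
  by (auto simp: polys_in_iff)

lemma polys_in_diff: "p \<in> polys_in V \<Longrightarrow> q \<in> polys_in V \<Longrightarrow> p - q \<in> polys_in V"
  for p :: "('v, 'a::ab_group_add) mpoly"
  using vars_diff[of p q] by (auto simp: polys_in_iff)

lemma polys_in_mult: "p \<in> polys_in V \<Longrightarrow> q \<in> polys_in V \<Longrightarrow> p * q \<in> polys_in V"
  for p :: "('v, 'a::comm_semiring_0) mpoly"
  using vars_mult[of p q] by (auto simp: polys_in_iff)

lemma polys_in_power: "p \<in> polys_in V \<Longrightarrow> p ^ n \<in> polys_in V"
  for p :: "('v, 'a::comm_semiring_1) mpoly"
  by (induction n) (auto intro: polys_in_mult)

lemma polys_in_sum: "(\<And>i. i \<in> S \<Longrightarrow> f i \<in> polys_in V) \<Longrightarrow> sum f S \<in> polys_in V"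
  by (induction S rule: infinite_finite_induct) (auto intro: polys_in_add)

lemma polys_in_prod: "(\<And>i. i \<in> S \<Longrightarrow> f i \<in> polys_in V) \<Longrightarrow> prod f S \<in> polys_in V"
  for f :: "'i \<Rightarrow> ('v, 'a::comm_semiring_1) mpoly"
  by (induction S rule: infinite_finite_induct) (auto intro: polys_in_mult)

lemmas polys_in_closed = polys_in_add polys_in_uminus polys_in_diff polys_in_mult polys_in_power
  polys_in_sum polys_in_prod

section \<open>Polynomials as univariate polynomials in one of the variables\<close>

lemma deg_in_le_iff: "deg_in v p \<le> d \<longleftrightarrow> (\<forall>m\<in>keys p. lookup m v \<le> d)"
  by (auto simp: deg_in_def)

lemma lookup_le_deg_in: "m \<in> keys p \<Longrightarrow> lookup m v \<le> deg_in v p"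
  using deg_in_le_iff[of v p "deg_in v p"] by auto

lemma deg_in_eq_0_iff: "deg_in v p = 0 \<longleftrightarrow> v \<notin> vars p"
  using deg_in_le_iff[of v p 0] by (auto simp: in_vars_iff)

lemma deg_in_less_iff: "0 < d \<Longrightarrow> deg_in v p < d \<longleftrightarrow> (\<forall>m\<in>keys p. lookup m v < d)"
  using deg_in_le_iff[of v p "d - 1"] by (auto simp: less_eq_Suc_le)

lemma coeff_in_msum:
  "coeff_in v d p = msum (\<lambda>m a. if lookup m v = d then single (m - single v d) a else 0) p"
  by (simp add: coeff_in_def msum_def sum.inter_filter)

lemma coeff_in_single:
  "coeff_in v d (single m a) = (if lookup m v = d then single (m - single v d) a else 0)"
  by (simp add: coeff_in_msum msum_single)

lemma coeff_in_add: "coeff_in v d (p + q) = coeff_in v d p + coeff_in v d q"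
  unfolding coeff_in_msum by (rule msum_add) (auto simp: single_add)

lemma lookup_coeff_in:
  "lookup (coeff_in v d p) m = (if lookup m v = 0 then lookup p (m + single v d) else 0)"
proof (induction p rule: mpoly_induct)
  case (single n a)
  have "n - single v d + single v d = n" if "lookup n v = d"
    using that by (intro poly_mapping_eqI) (auto simp: lookup_add lookup_minus lookup_single when_def)
  then have "lookup n v = d \<Longrightarrow> n - single v d = m \<longleftrightarrow> lookup m v = 0 \<and> n = m + single v d"
    by (metis add_diff_cancel_right' lookup_minus lookup_single_eq diff_self_eq_0)
  moreover have "n = m + single v d \<Longrightarrow> lookup m v = 0 \<Longrightarrow> lookup n v = d"
    by (simp add: lookup_add)
  ultimately show ?case
    by (auto simp: coeff_in_single lookup_single when_def)
next
  case (add p q)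
  then show ?case by (simp add: coeff_in_add lookup_add)
qed

lemma coeff_in_eq_0_iff: "coeff_in v d p = 0 \<longleftrightarrow> (\<forall>m\<in>keys p. lookup m v \<noteq> d)"
proof
  assume *: "coeff_in v d p = 0"
  show "\<forall>m\<in>keys p. lookup m v \<noteq> d"
  proof
    fix m assume m: "m \<in> keys p"
    show "lookup m v \<noteq> d"
    proof
      assume d: "lookup m v = d"
      then have "m - single v d + single v d = m"
        by (intro poly_mapping_eqI) (auto simp: lookup_add lookup_minus lookup_single when_def)
      then have "lookup (coeff_in v d p) (m - single v d) = lookup p m"
        using d by (simp add: lookup_coeff_in lookup_minus)
      with * m show False by (simp add: in_keys_iff)
    qed
  qed
next
  assume *: "\<forall>m\<in>keys p. lookup m v \<noteq> d"
  show "coeff_in v d p = 0"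
  proof (rule poly_mapping_eqI)
    fix m
    have "lookup p (m + single v d) = 0" if "lookup m v = 0"
      using *[rule_format, of "m + single v d"] that by (auto simp: in_keys_iff lookup_add)
    then show "lookup (coeff_in v d p) m = lookup 0 m"
      by (simp add: lookup_coeff_in)
  qed
qed

lemma keys_coeff_in: "m \<in> keys (coeff_in v d p) \<longleftrightarrow> lookup m v = 0 \<and> m + single v d \<in> keys p"
  by (auto simp: in_keys_iff lookup_coeff_in split: if_splits)

lemma vars_coeff_in: "vars (coeff_in v d p) \<subseteq> vars p - {v}"
proof
  fix w assume "w \<in> vars (coeff_in v d p)"
  then obtain m where "m \<in> keys (coeff_in v d p)" "lookup m w \<noteq> 0"
    by (auto simp: in_vars_iff)
  then have "lookup m v = 0" "m + single v d \<in> keys p" "w \<noteq> v" "lookup (m + single v d) w \<noteq> 0"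
    by (auto simp: keys_coeff_in lookup_add)
  then show "w \<in> vars p - {v}" by (auto simp: in_vars_iff)
qed

lemma polys_in_coeff_in: "p \<in> polys_in V \<Longrightarrow> coeff_in v d p \<in> polys_in V"
  using vars_coeff_in[of v d p] by (auto simp: polys_in_iff)

lemma deg_in_coeff_in_le: "deg_in w (coeff_in v d p) \<le> deg_in w p"
proof (unfold deg_in_le_iff, rule)
  fix m assume "m \<in> keys (coeff_in v d p)"
  then have "lookup (m + single v d) w \<le> deg_in w p"
    by (intro lookup_le_deg_in) (auto simp: keys_coeff_in)
  then show "lookup m w \<le> deg_in w p" by (simp add: lookup_add)
qed

text \<open>The isomorphism onto univariate polynomials in \<open>v\<close> whose coefficients are
  free of \<open>v\<close>. It transfers the facts about degrees and leading coefficients of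
  \<open>poly\<close> to \<open>deg_in\<close> and \<open>coeff_in\<close>.\<close>

definition univ :: "'v \<Rightarrow> ('v, 'a::comm_semiring_1) mpoly \<Rightarrow> ('v, 'a) mpoly poly" where
  "univ v = msum (\<lambda>m a. Polynomial.monom (single (m - single v (lookup m v)) a) (lookup m v))"

lemma univ_single:
  "univ v (single m a) = Polynomial.monom (single (m - single v (lookup m v)) a) (lookup m v)"
  by (simp add: univ_def msum_single)

lemma univ_zero [simp]: "univ v 0 = 0"
  by (simp add: univ_def)

lemma univ_add: "univ v (p + q) = univ v p + univ v q"
  unfolding univ_def by (rule msum_add) (auto simp: single_add add_monom)

lemma univ_mult: "univ v (p * q) = univ v p * univ v q"
  unfolding univ_def
proof (rule msum_mult)
  fix m n :: "'a power_product" and a b :: 'b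
  have "m + n - single v (lookup m v + lookup n v) =
    (m - single v (lookup m v)) + (n - single v (lookup n v))"
    by (intro poly_mapping_eqI) (auto simp: lookup_add lookup_minus lookup_single when_def)
  then show "Polynomial.monom (single (m + n - single v (lookup (m + n) v)) (a * b)) (lookup (m + n) v) =
    Polynomial.monom (single (m - single v (lookup m v)) a) (lookup m v) *
    Polynomial.monom (single (n - single v (lookup n v)) b) (lookup n v)"
    by (simp add: lookup_add mult_single Polynomial.mult_monom)
qed (auto simp: single_add add_monom)

lemma coeff_univ: "Polynomial.coeff (univ v p) d = coeff_in v d p"
  by (induction p rule: mpoly_induct)
    (auto simp: univ_single coeff_in_single univ_add coeff_in_add)

lemma degree_univ: "Polynomial.degree (univ v p) = deg_in v p"
proof (rule antisym)
  show "Polynomial.degree (univ v p) \<le> deg_in v p"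
    by (rule degree_le) (auto simp: coeff_univ coeff_in_eq_0_iff dest: lookup_le_deg_in[of _ _ v])
  show "deg_in v p \<le> Polynomial.degree (univ v p)"
    unfolding deg_in_le_iff
  proof
    fix m assume "m \<in> keys p"
    then have "Polynomial.coeff (univ v p) (lookup m v) \<noteq> 0"
      unfolding coeff_univ coeff_in_eq_0_iff by blast
    then show "lookup m v \<le> Polynomial.degree (univ v p)" by (rule le_degree)
  qed
qed

lemma var_power: "var v ^ n = (single (single v n) 1 :: ('v, 'a::comm_semiring_1) mpoly)"
  by (induction n) (auto simp: var_def mult_single single_add[symmetric])

lemma poly_univ: "Polynomial.poly (univ v p) (var v) = p"
proof (induction p rule: mpoly_induct)
  case (single m a)
  have "m - single v (lookup m v) + single v (lookup m v) = m"
    by (intro poly_mapping_eqI) (auto simp: lookup_add lookup_minus lookup_single when_def)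
  then show ?case by (simp add: univ_single poly_monom var_power mult_single)
qed (simp add: univ_add)

lemma univ_eq_0_iff [simp]: "univ v p = 0 \<longleftrightarrow> p = 0"
  by (metis poly_univ poly_0 univ_zero)

lemma univ_uminus: "univ v (- p) = - univ v (p :: ('v, 'a::comm_ring_1) mpoly)"
  by (metis add.right_inverse add_eq_0_iff univ_add univ_zero)

lemma univ_diff: "univ v (p - q) = univ v p - univ v (q :: ('v, 'a::comm_ring_1) mpoly)"
  using univ_add[of v p "- q"] by (simp add: univ_uminus)

lemma univ_not_in_vars:
  assumes "v \<notin> vars p" shows "univ v p = [:p:]"
proof -
  have "Polynomial.degree (univ v p) = 0" using assms by (simp add: degree_univ deg_in_eq_0_iff)
  then obtain c where "univ v p = [:c:]" by (rule degree_eq_zeroE)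
  with poly_univ[of v p] show ?thesis by simp
qed

lemma univ_var [simp]: "univ v (var v) = [:0, 1:]"
  by (simp add: var_def univ_single monom_altdef)

lemma deg_in_uminus [simp]: "deg_in v (- p) = deg_in v (p :: ('v, 'a::comm_ring_1) mpoly)"
  by (simp add: degree_univ[symmetric] univ_uminus)

lemma deg_in_add_le: "deg_in v (p + q) \<le> max (deg_in v p) (deg_in v q)"
  for p :: "('v, 'a::comm_semiring_1) mpoly"
  unfolding degree_univ[symmetric] univ_add by (rule degree_add_le_max)

lemma deg_in_diff_le: "deg_in v (p - q) \<le> max (deg_in v p) (deg_in v q)"
  for p :: "('v, 'a::comm_ring_1) mpoly"
  unfolding degree_univ[symmetric] univ_diff by (rule degree_diff_le_max)

lemma deg_in_mult_le: "deg_in v (p * q) \<le> deg_in v p + deg_in v q"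
  for p :: "('v, 'a::comm_semiring_1) mpoly"
  unfolding degree_univ[symmetric] univ_mult by (rule degree_mult_le)

lemma deg_in_mult:
  fixes p q :: "('v::linorder, 'a::idom) mpoly"
  assumes "p \<noteq> 0" "q \<noteq> 0"
  shows "deg_in v (p * q) = deg_in v p + deg_in v q"
  using assms unfolding degree_univ[symmetric] univ_mult by (simp add: degree_mult_eq)

text \<open>Degrees in each single variable add up over an integral domain, so no variable can
  cancel. This is why factors of an element of \<open>k[N]\<close> stay in
  \<open>k[N]\<close>.\<close>

lemma vars_mult_eq:
  fixes p q :: "('v::linorder, 'a::idom) mpoly"
  assumes "p \<noteq> 0" "q \<noteq> 0"
  shows "vars (p * q) = vars p \<union> vars q"
proof -
  have "v \<in> vars (p * q) \<longleftrightarrow> v \<in> vars p \<union> vars q" for v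
    using deg_in_mult[OF assms, of v] deg_in_eq_0_iff[of v] by (metis Un_iff add_is_0)
  then show ?thesis by blast
qed

lemma vars_dvd:
  fixes p q :: "('v::linorder, 'a::idom) mpoly"
  assumes "p dvd q" "q \<noteq> 0"
  shows "vars p \<subseteq> vars q"
  using assms by (elim dvdE) (auto simp: vars_mult_eq)

lemma polys_in_dvd:
  fixes p q :: "('v::linorder, 'a::idom) mpoly"
  assumes "p dvd q" "q \<noteq> 0" "q \<in> polys_in V"
  shows "p \<in> polys_in V"
  using vars_dvd[OF assms(1,2)] assms(3) by (auto simp: polys_in_iff)

lemma lead_coeff_univ: "Polynomial.lead_coeff (univ v p) = coeff_in v (deg_in v p) p"
  by (simp add: coeff_univ degree_univ)

lemma coeff_in_deg_in_neq_0: "p \<noteq> 0 \<Longrightarrow> coeff_in v (deg_in v p) p \<noteq> 0"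
  for p :: "('v, 'a::comm_semiring_1) mpoly"
  using lead_coeff_univ[of v p] by (metis leading_coeff_neq_0 univ_eq_0_iff)

section \<open>Partial derivatives\<close>

lemma partial_deriv_msum:
  "partial_deriv v p = msum (\<lambda>m a. single (m - single v 1) (of_nat (lookup m v) * a)) p"
  by (simp add: partial_deriv_def msum_def)

lemma partial_deriv_single:
  "partial_deriv v (single m a) = single (m - single v 1) (of_nat (lookup m v) * a)"
  by (simp add: partial_deriv_msum msum_single)

lemma partial_deriv_add: "partial_deriv v (p + q) = partial_deriv v p + partial_deriv v q"
  unfolding partial_deriv_msum by (rule msum_add) (auto simp: distrib_left single_add)

lemma partial_deriv_mult:
  fixes p q :: "('v, 'a::comm_ring_1) mpoly"
  shows "partial_deriv v (p * q) = partial_deriv v p * q + p * partial_deriv v q"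
proof (induction p rule: mpoly_induct)
  case (single m a)
  show ?case
  proof (induction q rule: mpoly_induct)
    case (single n b)
    have 1: "m + n - single v (Suc 0) = (m - single v (Suc 0)) + n" if "lookup m v \<noteq> 0"
      using that
      by (intro poly_mapping_eqI) (auto simp: lookup_add lookup_minus lookup_single when_def)
    have 2: "m + n - single v (Suc 0) = m + (n - single v (Suc 0))" if "lookup n v \<noteq> 0"
      using that
      by (intro poly_mapping_eqI) (auto simp: lookup_add lookup_minus lookup_single when_def)
    have *: "single (m + n - single v (Suc 0)) (of_nat (lookup m v) * (a * b)) =
        single (m - single v (Suc 0) + n) (of_nat (lookup m v) * (a * b))"
      using 1 by (cases "lookup m v = 0") auto
    have **: "single (m + n - single v (Suc 0)) (of_nat (lookup n v) * (a * b)) =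
        single (m + (n - single v (Suc 0))) (of_nat (lookup n v) * (a * b))"
      using 2 by (cases "lookup n v = 0") auto
    have "partial_deriv v (single m a * single n b) =
      single (m + n - single v (Suc 0)) (of_nat (lookup m v) * (a * b)) +
      single (m + n - single v (Suc 0)) (of_nat (lookup n v) * (a * b))"
      by (simp add: mult_single partial_deriv_single lookup_add distrib_right single_add)
    then show ?case
      unfolding * ** by (simp add: partial_deriv_single mult_single mult.left_commute mult.assoc)
  next
    case (add p q)
    then show ?case by (simp add: distrib_left partial_deriv_add algebra_simps)
  qed
next
  case (add p1 p2)
  then show ?case by (simp add: distrib_right partial_deriv_add algebra_simps)
qed

lemma partial_deriv_eq_0: "v \<notin> vars p \<Longrightarrow> partial_deriv v p = 0"
  by (auto simp: partial_deriv_def in_vars_iff intro!: sum.neutral)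

lemma partial_deriv_var [simp]: "partial_deriv v (var v) = (1 :: ('v, 'a::comm_semiring_1) mpoly)"
  by (simp add: var_def partial_deriv_single)

lemma vars_partial_deriv: "vars (partial_deriv v p) \<subseteq> vars p"
proof -
  have "single (m - single v 1) (of_nat (lookup m v) * lookup p m) \<in> polys_in (vars p)"
    if "m \<in> keys p" for m
    using that
    by (intro polys_in_single) (force simp: in_keys_iff lookup_minus vars_def)
  then show ?thesis
    unfolding partial_deriv_def polys_in_iff[symmetric] by (rule polys_in_sum)
qed

section \<open>Factoriality of polynomial rings and least common multiples\<close>

section \<open>Unique factorization\<close>

lemma const_add: "const (a + b) = const a + const b"
  by (simp add: const_def single_add)

lemma const_mult: "const (a * b) = const a * (const b :: ('v, 'a::semiring_0) mpoly)"
  by (simp add: const_def mult_single)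

lemma const_one [simp]: "const 1 = 1"
  by (simp add: const_def)

lemma const_zero [simp]: "const 0 = 0"
  by (simp add: const_def)

lemma const_eq_0_iff [simp]: "const a = 0 \<longleftrightarrow> a = 0"
  by (metis const_def const_zero lookup_single_eq)

lemma univ_var_power: "univ v (var v ^ n) = Polynomial.monom 1 n"
  by (simp add: var_power univ_single)

text \<open>Two additions to the usual statement are needed later: everything stays in the subring
  of polynomials in \<open>V\<close>, and the degree in a variable not occurring in \<open>f\<close>
  does not grow. The latter holds because in each step \<open>p\<close> is multiplied by a
  coefficient of \<open>f\<close>, and a multiple of \<open>f\<close> by a coefficient of
  \<open>p\<close> and a power of \<open>v\<close> is subtracted.\<close>

lemma pseudo_division:
  fixes p f :: "('v::linorder, 'a::idom) mpoly"
  assumes "0 < deg_in v f" "f \<in> polys_in V" "p \<in> polys_in V"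
  shows "\<exists>k q r. q \<in> polys_in V \<and> r \<in> polys_in V \<and>
    coeff_in v (deg_in v f) f ^ k * p = q * f + r \<and> deg_in v r < deg_in v f \<and>
    (\<forall>w. w \<notin> vars f \<longrightarrow> deg_in w r \<le> deg_in w p)"
  using assms(3)
proof (induction "deg_in v p" arbitrary: p rule: less_induct)
  case less
  let ?c = "coeff_in v (deg_in v f) f"
  show ?case
  proof (cases "deg_in v p < deg_in v f")
    case True
    then show ?thesis using less.prems by (intro exI[of _ 0] exI[of _ p]) auto
  next
    case False
    define e where "e = deg_in v p"
    \<comment> \<open>Chosen so that the terms of degree \<open>e\<close> in \<open>v\<close> of
      \<open>?c * p\<close> and \<open>t * f\<close> agree.\<close>
    define t where "t = coeff_in v e p * var v ^ (e - deg_in v f)"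
    define p1 where "p1 = ?c * p - t * f"
    have e: "deg_in v f \<le> e" using False by (simp add: e_def)
    have v: "v \<in> vars f" using assms(1) deg_in_eq_0_iff[of v f] by simp
    have "v \<in> V" using v assms(2) by (auto simp: polys_in_iff)
    then have V: "t \<in> polys_in V" "p1 \<in> polys_in V"
      using less.prems assms(2) unfolding p1_def t_def
      by (auto intro!: polys_in_closed polys_in_coeff_in polys_in_var)
    have nv: "v \<notin> vars ?c" "v \<notin> vars (coeff_in v e p)"
      using vars_coeff_in by fastforce+
    have u: "univ v p1 = [:?c:] * univ v p -
        [:coeff_in v e p:] * Polynomial.monom 1 (e - deg_in v f) * univ v f"
      by (simp only: p1_def t_def univ_diff univ_mult univ_not_in_vars[OF nv(1)]
        univ_not_in_vars[OF nv(2)] univ_var_power)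
    have coeff: "Polynomial.coeff (univ v p1) i = ?c * coeff_in v i p -
        (if i < e - deg_in v f then 0 else coeff_in v e p * coeff_in v (i - (e - deg_in v f)) f)" for i
      by (simp add: u coeff_monom_mult coeff_univ smult_monom)
    have deg: "deg_in v p1 < e"
    proof -
      have "Polynomial.coeff (univ v p1) i = 0" if "i \<ge> e" for i
      proof (cases "i = e")
        case True
        then show ?thesis using e by (simp add: coeff)
      next
        case False
        then have "coeff_in v i p = 0" "coeff_in v (i - (e - deg_in v f)) f = 0"
          using that e by (auto intro!: coeff_eq_0 simp: degree_univ e_def simp flip: coeff_univ)
        then show ?thesis by (simp add: coeff)
      qed
      moreover have "0 < e" using e assms(1) by simp
      ultimately have "Polynomial.degree (univ v p1) < e"
        by (metis leading_coeff_0_iff degree_0 not_le)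
      then show ?thesis by (simp add: degree_univ)
    qed
    have degw: "deg_in w p1 \<le> deg_in w p" if w: "w \<notin> vars f" for w
    proof -
      have "w \<notin> vars ?c" using w vars_coeff_in[of v _ f] by blast
      then have "deg_in w ?c = 0" "deg_in w f = 0" using w by (simp_all add: deg_in_eq_0_iff)
      moreover have "deg_in w (var v ^ (e - deg_in v f) :: ('v, 'a) mpoly) = 0"
        using w v polys_in_power[OF polys_in_var[of v "{v}"]]
        by (auto simp: deg_in_eq_0_iff polys_in_iff)
      moreover have "deg_in w p1 \<le> max (deg_in w ?c + deg_in w p)
          (deg_in w (coeff_in v e p) + deg_in w (var v ^ (e - deg_in v f) :: ('v, 'a) mpoly) + deg_in w f)"
        unfolding p1_def t_def
        by (meson deg_in_diff_le deg_in_mult_le order_trans max.mono add_right_mono)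
      moreover have "deg_in w (coeff_in v e p) \<le> deg_in w p"
        by (rule deg_in_coeff_in_le)
      ultimately show ?thesis by simp
    qed
    from less.hyps[of p1] deg V obtain k q r where *:
      "q \<in> polys_in V" "r \<in> polys_in V" "?c ^ k * p1 = q * f + r" "deg_in v r < deg_in v f"
      "\<forall>w. w \<notin> vars f \<longrightarrow> deg_in w r \<le> deg_in w p1"
      unfolding e_def by blast
    show ?thesis
    proof (intro exI conjI)
      show "?c ^ Suc k * p = (q + ?c ^ k * t) * f + r"
        using *(3) by (simp add: p1_def algebra_simps)
      show "q + ?c ^ k * t \<in> polys_in V"
        using * V assms(2) by (intro polys_in_closed polys_in_coeff_in)
      show "\<forall>w. w \<notin> vars f \<longrightarrow> deg_in w r \<le> deg_in w p"
        using *(5) degw order_trans by blast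
    qed (use * in auto)
  qed
qed

lemma mpoly_unit_iff:
  fixes p :: "('v::linorder, 'a::field) mpoly"
  shows "p dvd 1 \<longleftrightarrow> p \<noteq> 0 \<and> vars p = {}"
proof
  assume "p dvd 1"
  then show "p \<noteq> 0 \<and> vars p = {}" using vars_dvd[of p 1] by auto
next
  assume *: "p \<noteq> 0 \<and> vars p = {}"
  then obtain c where c: "p = const c" by (auto simp: vars_empty_iff)
  with * have "p * const (inverse c) = 1" by (simp flip: const_mult)
  then show "p dvd 1" by (metis dvdI)
qed

text \<open>The sum of the degrees in the single variables instead of the total degree: it inherits
  additivity from \<open>deg_in\<close>, and over a field it vanishes exactly at units and
  \<open>0\<close>, so it measures the progress of splitting off factors.\<close>

definition mdeg :: "('v, 'a::zero) mpoly \<Rightarrow> nat" where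
  "mdeg p = (\<Sum>v\<in>vars p. deg_in v p)"

lemma mdeg_superset: "finite S \<Longrightarrow> vars p \<subseteq> S \<Longrightarrow> mdeg p = (\<Sum>v\<in>S. deg_in v p)"
  unfolding mdeg_def by (intro sum.mono_neutral_left) (auto simp: deg_in_eq_0_iff)

lemma mdeg_mult:
  fixes p q :: "('v::linorder, 'a::idom) mpoly"
  assumes "p \<noteq> 0" "q \<noteq> 0"
  shows "mdeg (p * q) = mdeg p + mdeg q"
proof -
  have "mdeg (p * q) = (\<Sum>v\<in>vars p \<union> vars q. deg_in v p + deg_in v q)"
    using assms by (subst mdeg_superset[of "vars p \<union> vars q"]) (auto simp: vars_mult_eq deg_in_mult)
  also have "\<dots> = mdeg p + mdeg q"
    by (simp add: sum.distrib mdeg_superset[of "vars p \<union> vars q"])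
  finally show ?thesis .
qed

lemma mdeg_eq_0_iff: "mdeg p = 0 \<longleftrightarrow> vars p = {}"
  by (auto simp: mdeg_def deg_in_eq_0_iff)

lemma mdeg_less_mult:
  fixes p q :: "('v::linorder, 'a::field) mpoly"
  assumes "p * q \<noteq> 0" "\<not> p dvd 1"
  shows "mdeg q < mdeg (p * q)"
  using assms mdeg_eq_0_iff[of p] by (simp add: mdeg_mult mpoly_unit_iff)

lemma exists_irreducible_factor:
  fixes p :: "('v::linorder, 'a::field) mpoly"
  assumes "p \<noteq> 0" "\<not> p dvd 1"
  shows "\<exists>\<pi>. irreducible \<pi> \<and> \<pi> dvd p"
  using assms
proof (induction "mdeg p" arbitrary: p rule: less_induct)
  case less
  show ?case
  proof (cases "irreducible p")
    case False
    with less.prems obtain a b where ab: "p = a * b" "\<not> a dvd 1" "\<not> b dvd 1"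
      by (auto simp: irreducible_def)
    then have "mdeg b < mdeg p" using less.prems mdeg_less_mult[of a b] by simp
    then obtain \<pi> where "irreducible \<pi>" "\<pi> dvd b" using less.hyps[of b] ab less.prems by auto
    then show ?thesis using ab by auto
  qed auto
qed

text \<open>Relative to a set of variables, because primeness of irreducible polynomials is proved
  by adding one variable at a time.\<close>

definition prime_on :: "'v set \<Rightarrow> ('v, 'a::comm_ring_1) mpoly \<Rightarrow> bool" where
  "prime_on V p \<longleftrightarrow> (\<forall>a\<in>polys_in V. \<forall>b\<in>polys_in V. p dvd a * b \<longrightarrow> p dvd a \<or> p dvd b)"

lemma dvd_iff_dvd_coeff_in:
  fixes \<pi> f :: "('v::linorder, 'a::idom) mpoly"
  assumes "x \<notin> vars \<pi>"
  shows "\<pi> dvd f \<longleftrightarrow> (\<forall>i. \<pi> dvd coeff_in x i f)"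
proof -
  have "\<pi> dvd f \<longleftrightarrow> [:\<pi>:] dvd univ x f"
  proof
    assume "\<pi> dvd f"
    then obtain g where "f = \<pi> * g" ..
    then have "univ x f = [:\<pi>:] * univ x g" by (simp only: univ_mult univ_not_in_vars[OF assms])
    then show "[:\<pi>:] dvd univ x f" ..
  next
    assume "[:\<pi>:] dvd univ x f"
    then obtain g where "univ x f = [:\<pi>:] * g" ..
    then have "f = \<pi> * Polynomial.poly g (var x)"
      by (metis poly_univ poly_mult mult_zero_right poly_pCons poly_0 add.right_neutral)
    then show "\<pi> dvd f" ..
  qed
  then show ?thesis by (simp add: const_poly_dvd_iff coeff_univ)
qed

text \<open>The argument of Gauss: if \<open>i\<close> and \<open>j\<close> are the least indices of
  coefficients not divisible by \<open>\<pi>\<close>, then the coefficient of degree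
  \<open>i + j\<close> of the product is congruent to the product of these two modulo
  \<open>\<pi>\<close>.\<close>

lemma prime_on_insert:
  fixes \<pi> :: "('v::linorder, 'a::idom) mpoly"
  assumes "\<pi> \<in> polys_in V" "x \<notin> V" "prime_on V \<pi>"
  shows "prime_on (insert x V) \<pi>"
  unfolding prime_on_def
proof (intro ballI impI, rule ccontr)
  fix f g
  assume f: "f \<in> polys_in (insert x V)" and g: "g \<in> polys_in (insert x V)"
    and fg: "\<pi> dvd f * g" and nd: "\<not> (\<pi> dvd f \<or> \<pi> dvd g)"
  have x: "x \<notin> vars \<pi>" using assms by (auto simp: polys_in_iff)
  have V: "coeff_in x i h \<in> polys_in V" if "h \<in> polys_in (insert x V)" for h :: "('v, 'a) mpoly" and i
    using that vars_coeff_in[of x i h] by (auto simp: polys_in_iff)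
  define i where "i = (LEAST i. \<not> \<pi> dvd coeff_in x i f)"
  define j where "j = (LEAST j. \<not> \<pi> dvd coeff_in x j g)"
  have ex: "\<exists>i. \<not> \<pi> dvd coeff_in x i f" "\<exists>i. \<not> \<pi> dvd coeff_in x i g"
    using nd dvd_iff_dvd_coeff_in[OF x] by blast+
  have i: "\<not> \<pi> dvd coeff_in x i f" and j: "\<not> \<pi> dvd coeff_in x j g"
    unfolding i_def j_def using LeastI_ex[OF ex(1)] LeastI_ex[OF ex(2)] by blast+
  have i': "\<pi> dvd coeff_in x k f" if "k < i" for k
    using not_less_Least[OF that[unfolded i_def]] by blast
  have j': "\<pi> dvd coeff_in x k g" if "k < j" for k
    using not_less_Least[OF that[unfolded j_def]] by blast
  have "\<pi> dvd coeff_in x (i + j) (f * g)"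
    using fg dvd_iff_dvd_coeff_in[OF x] by blast
  also have "coeff_in x (i + j) (f * g) = (\<Sum>k\<le>i + j. coeff_in x k f * coeff_in x (i + j - k) g)"
    by (simp add: coeff_univ[symmetric] univ_mult coeff_mult)
  also have "\<dots> = coeff_in x i f * coeff_in x j g +
      (\<Sum>k\<in>{..i + j} - {i}. coeff_in x k f * coeff_in x (i + j - k) g)"
    by (subst sum.remove[of _ i]) auto
  finally have "\<pi> dvd coeff_in x i f * coeff_in x j g"
  proof (subst (asm) dvd_add_left_iff)
    show "\<pi> dvd (\<Sum>k\<in>{..i + j} - {i}. coeff_in x k f * coeff_in x (i + j - k) g)"
    proof (rule dvd_sum)
      fix k assume "k \<in> {..i + j} - {i}"
      then have "k < i \<or> i + j - k < j" by auto
      then show "\<pi> dvd coeff_in x k f * coeff_in x (i + j - k) g" using i' j' by auto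
    qed
  qed
  with assms(3) i j V[OF f] V[OF g] show False
    unfolding prime_on_def by blast
qed

text \<open>The irreducible factors of \<open>s\<close> are prime, so they can be assigned one after
  the other to \<open>q\<close> or to \<open>p\<close>. The lemma serves to cancel \<open>s\<close>
  from an equation between products.\<close>

lemma dvd_mult_split:
  fixes s :: "('v::linorder, 'a::field) mpoly"
  assumes "\<And>\<pi> :: ('v, 'a) mpoly. \<pi> \<in> polys_in V \<Longrightarrow> irreducible \<pi> \<Longrightarrow> prime_on W \<pi>"
    and "s \<in> polys_in V" "s \<noteq> 0" "q \<in> polys_in W" "p \<in> polys_in W" "s * c = q * p"
  shows "\<exists>s1 s2. s = s1 * s2 \<and> s1 dvd q \<and> s2 dvd p"
  using assms(2-)
proof (induction "mdeg s" arbitrary: s p q rule: less_induct)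
  case less
  show ?case
  proof (cases "s dvd 1")
    case True
    then show ?thesis by (intro exI[of _ s] exI[of _ 1]) (auto intro: dvd_trans)
  next
    case False
    then obtain \<pi> s' where \<pi>: "irreducible \<pi>" "s = \<pi> * s'"
      using exists_irreducible_factor less.prems by (metis dvdE)
    have V: "\<pi> \<in> polys_in V" "s' \<in> polys_in V" "s' \<noteq> 0" "\<pi> \<noteq> 0"
      using less.prems \<pi> polys_in_dvd[OF _ less.prems(2,1)] by auto
    have lt: "mdeg s' < mdeg s"
      using \<pi> less.prems mdeg_less_mult[of \<pi> s'] by (auto simp: irreducible_def)
    have "\<pi> dvd q * p" using less.prems \<pi> by (metis dvd_triv_left mult.assoc)
    then have "\<pi> dvd q \<or> \<pi> dvd p"
      using assms(1)[OF V(1) \<pi>(1)] less.prems unfolding prime_on_def by blast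
    then show ?thesis
    proof
      assume "\<pi> dvd q"
      then obtain q' where q': "q = \<pi> * q'" ..
      have "q' \<in> polys_in W"
        using less.prems V by (cases "q' = 0") (auto simp: q' intro: polys_in_dvd[of _ q])
      moreover have "s' * c = q' * p" using less.prems \<pi> q' V by auto
      ultimately obtain s1 s2 where "s' = s1 * s2" "s1 dvd q'" "s2 dvd p"
        using less.hyps[OF lt V(2,3)] less.prems by blast
      then show ?thesis
        using \<pi> q' by (intro exI[of _ "\<pi> * s1"] exI[of _ s2]) (auto simp: mult.assoc)
    next
      assume "\<pi> dvd p"
      then obtain p' where p': "p = \<pi> * p'" ..
      have "p' \<in> polys_in W"
        using less.prems V by (cases "p' = 0") (auto simp: p' intro: polys_in_dvd[of _ p])
      moreover have "s' * c = q * p'" using less.prems \<pi> p' V by (auto simp: mult.left_commute)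
      ultimately obtain s1 s2 where "s' = s1 * s2" "s1 dvd q" "s2 dvd p'"
        using less.hyps[OF lt V(2,3)] less.prems by blast
      then show ?thesis
        using \<pi> p' by (intro exI[of _ s1] exI[of _ "\<pi> * s2"]) (auto simp: mult.left_commute)
    qed
  qed
qed

text \<open>
  Induction on the variables. If \<open>x\<close> occurs in \<open>p\<close>, consider a \<open>c\<close> of least degree in \<open>x\<close> such
  that \<open>p\<close> divides \<open>c b\<close> but not \<open>c\<close>. Pseudo-division of \<open>c\<close> by \<open>p\<close> shows that the degree of \<open>c\<close>
  is less than that of \<open>p\<close>, and pseudo-division of \<open>p\<close> by \<open>c\<close> that \<open>c\<close> is free of \<open>x\<close>. The primes
  in \<open>c\<close> then divide the cofactor, so \<open>p\<close> divides \<open>b\<close>.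
\<close>

lemma irreducible_imp_prime_on:
  fixes p :: "('v::linorder, 'a::field) mpoly"
  assumes "finite V" "p \<in> polys_in V" "irreducible p"
  shows "prime_on V p"
  using assms
proof (induction arbitrary: p)
  case empty
  then show ?case using mpoly_unit_iff[of p] by (auto simp: irreducible_def polys_in_iff)
next
  case (insert x V)
  let ?W = "insert x V"
  have primes: "prime_on ?W \<pi>" if "\<pi> \<in> polys_in V" "irreducible \<pi>" for \<pi> :: "('v, 'a) mpoly"
    using that insert by (intro prime_on_insert insert.IH) auto
  show ?case
  proof (cases "x \<in> vars p")
    case False
    then show ?thesis using insert.prems by (intro primes) (auto simp: polys_in_iff)
  next
    case True
    have p0: "p \<noteq> 0" using insert.prems by (auto simp: irreducible_def)
    have V: "coeff_in x i h \<in> polys_in V" if "h \<in> polys_in ?W" for h :: "('v, 'a) mpoly" and i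
      using that vars_coeff_in[of x i h] by (auto simp: polys_in_iff)
    \<comment> \<open>Otherwise the cofactor of \<open>s\<close> would be a unit, and
      \<open>x\<close> would not occur in \<open>p\<close>.\<close>
    have unit: "s dvd 1" if "s \<in> polys_in V" "s dvd p" for s
    proof -
      obtain t where t: "p = s * t" using \<open>s dvd p\<close> ..
      have "\<not> t dvd 1"
      proof
        assume "t dvd 1"
        then have "vars p = vars s" using p0 t by (simp add: vars_mult_eq mpoly_unit_iff)
        then show False using that True insert.hyps by (auto simp: polys_in_iff)
      qed
      with t insert.prems show ?thesis by (auto simp: irreducible_def)
    qed
    \<comment> \<open>The share of \<open>s\<close> that divides \<open>p\<close> is free of
      \<open>x\<close>, hence a unit, so all of \<open>s\<close> can be cancelled against
      \<open>q\<close>.\<close>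
    have cancel: "p dvd c" if c: "s \<in> polys_in V" "s \<noteq> 0" "q \<in> polys_in ?W" "s * c = q * p" for s q c
    proof -
      obtain s1 s2 where s: "s = s1 * s2" "s1 dvd q" "s2 dvd p"
        using dvd_mult_split[OF primes c(1-3) insert.prems(1) c(4)] by blast
      have "s2 \<in> polys_in V" using polys_in_dvd[of s2 s] s c by auto
      then have "s2 dvd 1" using unit s by blast
      then obtain u where u: "1 = s2 * u" ..
      obtain t where "q = s1 * t" using s(2) ..
      then have "q = s1 * t * (s2 * u)" using u by simp
      then have "q = s * (u * t)" using s(1) by (simp add: mult_ac)
      then have "s * c = s * (p * (u * t))" using c(4) by (simp only: mult_ac)
      then have "c = p * (u * t)" using mult_left_cancel[OF c(2)] by blast
      then show ?thesis ..
    qed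
    show ?thesis
      unfolding prime_on_def
    proof (intro ballI impI, rule ccontr)
      fix a b assume a: "a \<in> polys_in ?W" and b: "b \<in> polys_in ?W"
        and ab: "p dvd a * b" and *: "\<not> (p dvd a \<or> p dvd b)"
      define P where "P c \<longleftrightarrow> c \<in> polys_in ?W \<and> \<not> p dvd c \<and> p dvd c * b" for c
      have "P a" using a ab * by (simp add: P_def)
      then obtain c where c: "P c" and min: "\<And>y. P y \<Longrightarrow> deg_in x c \<le> deg_in x y"
        using ex_has_least_nat[of P a "deg_in x"] by blast
      have cW: "c \<in> polys_in ?W" and pc: "\<not> p dvd c" and pcb: "p dvd c * b"
        using c by (auto simp: P_def)
      have c0: "c \<noteq> 0" using pc by auto
      have degp: "0 < deg_in x p" using True deg_in_eq_0_iff[of x p] by simp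
      have lt: "deg_in x c < deg_in x p"
      proof -
        let ?l = "coeff_in x (deg_in x p) p"
        obtain k q r where qr: "q \<in> polys_in ?W" "r \<in> polys_in ?W" "?l ^ k * c = q * p + r"
          "deg_in x r < deg_in x p"
          using pseudo_division[OF degp insert.prems(1) cW] by blast
        have "p dvd r * b"
        proof -
          have "r * b = ?l ^ k * (c * b) - p * (q * b)"
            using qr(3) by (simp add: algebra_simps)
          then show ?thesis using pcb by (metis dvd_diff dvd_mult dvd_triv_left)
        qed
        moreover have "\<not> p dvd r"
        proof
          assume "p dvd r"
          then obtain t where t: "r = p * t" ..
          have tW: "t \<in> polys_in ?W"
            using qr p0 by (cases "t = 0") (auto simp: t intro: polys_in_dvd[of _ r])
          have "?l ^ k * c = (q + t) * p" using qr t by (simp add: algebra_simps)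
          then have "p dvd c"
            using V[OF insert.prems(1)] coeff_in_deg_in_neq_0[OF p0] qr tW
            by (intro cancel[of "?l ^ k" "q + t"]) (auto intro: polys_in_power polys_in_add)
          then show False using pc by simp
        qed
        ultimately have "P r" using qr by (simp add: P_def)
        then show ?thesis using min qr by (meson le_less_trans)
      qed
      show False
      proof (cases "deg_in x c = 0")
        case True
        then have "c \<in> polys_in V" using cW by (auto simp: deg_in_eq_0_iff polys_in_iff)
        moreover obtain t where t: "c * b = t * p" using pcb by (metis dvdE mult.commute)
        moreover have "t \<in> polys_in ?W"
        proof (cases "c * b = 0")
          case True then show ?thesis using t p0 by auto
        next
          case False
          then show ?thesis using t polys_in_mult[OF cW b] polys_in_dvd[of t "c * b"] by auto
        qed
        ultimately have "p dvd b" using c0 by (intro cancel[of c t])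
        then show False using * by simp
      next
        case False
        let ?l = "coeff_in x (deg_in x c) c"
        obtain k q r where qr: "q \<in> polys_in ?W" "r \<in> polys_in ?W" "?l ^ k * p = q * c + r"
          "deg_in x r < deg_in x c"
          using pseudo_division[OF _ cW insert.prems(1)] False by blast
        have "p dvd r * b"
        proof -
          have "r * b = p * (?l ^ k * b) - q * (c * b)"
            using qr(3) by (simp add: algebra_simps)
          then show ?thesis using pcb by (metis dvd_diff dvd_mult dvd_triv_left)
        qed
        then have "p dvd r" using min[of r] qr by (auto simp: P_def)
        then have "r = 0"
          using qr(4) lt deg_in_mult[OF p0, of _ x] by (elim dvdE) (metis add_lessD1 less_trans less_irrefl mult_zero_right)
        then have eq: "?l ^ k * p = q * c" using qr by simp
        have l: "?l ^ k \<in> polys_in V" "?l ^ k \<noteq> 0"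
          using V[OF cW] coeff_in_deg_in_neq_0[OF c0] by (auto intro: polys_in_power)
        obtain s1 s2 where s: "?l ^ k = s1 * s2" "s1 dvd q" "s2 dvd c"
          using dvd_mult_split[OF primes l qr(1) cW eq] by blast
        then obtain q' c' where qc: "q = s1 * q'" "c = s2 * c'" by (auto elim!: dvdE)
        have "s2 \<in> polys_in V" using polys_in_dvd[of s2 "?l ^ k"] s l by auto
        then have "deg_in x s2 = 0" using insert.hyps by (auto simp: deg_in_eq_0_iff polys_in_iff)
        then have c': "deg_in x c' = deg_in x c" using qc c0 by (simp add: deg_in_mult)
        have "(s1 * s2) * p = (s1 * s2) * (q' * c')" using eq s qc by (simp add: algebra_simps)
        then have p: "p = q' * c'" using s l by simp
        then consider "q' dvd 1" | "c' dvd 1" using irreducibleD[OF insert.prems(2)] by blast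
        then show False
        proof cases
          case 1
          then have "deg_in x q' = 0" by (simp add: mpoly_unit_iff deg_in_eq_0_iff)
          then show False using p p0 lt c' by (simp add: deg_in_mult)
        next
          case 2
          then have "deg_in x c' = 0" by (simp add: mpoly_unit_iff deg_in_eq_0_iff)
          then show False using c' False by simp
        qed
      qed
    qed
  qed
qed

text \<open>Only finitely many variables occur in \<open>p\<close>, \<open>a\<close> and
  \<open>b\<close>, so the finite case applies whatever the number of variables of the ring.\<close>

lemma irreducible_dvd_mult:
  fixes p :: "('v::linorder, 'a::field) mpoly"
  assumes "irreducible p" "p dvd a * b"
  shows "p dvd a \<or> p dvd b"
proof -
  let ?V = "vars p \<union> vars a \<union> vars b"
  have "prime_on ?V p"
    using assms by (intro irreducible_imp_prime_on) (auto simp: polys_in_iff)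
  moreover have "a \<in> polys_in ?V" "b \<in> polys_in ?V" by (auto simp: polys_in_iff)
  ultimately show ?thesis using assms(2) unfolding prime_on_def by blast
qed

definition rel_prime :: "'a::comm_semiring_1 \<Rightarrow> 'a \<Rightarrow> bool" where
  "rel_prime a b \<longleftrightarrow> (\<forall>d. d dvd a \<longrightarrow> d dvd b \<longrightarrow> d dvd 1)"

lemma rel_prime_dvd_mult:
  fixes a b c :: "('v::linorder, 'a::field) mpoly"
  assumes "rel_prime a b" "b \<noteq> 0" "b dvd a * c"
  shows "b dvd c"
  using assms
proof (induction "mdeg b" arbitrary: b c rule: less_induct)
  case less
  show ?case
  proof (cases "b dvd 1")
    case True
    then show ?thesis by (rule dvd_trans) simp
  next
    case False
    then obtain \<pi> b' where \<pi>: "irreducible \<pi>" "b = \<pi> * b'"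
      using exists_irreducible_factor less.prems by (metis dvdE)
    have "\<not> \<pi> dvd a" using less.prems(1) \<pi> by (auto simp: rel_prime_def irreducible_def)
    moreover have "\<pi> dvd a * c" using less.prems(3) \<pi> by (auto elim: dvd_mult_left)
    ultimately obtain c' where c': "c = \<pi> * c'" using irreducible_dvd_mult[OF \<pi>(1)] by (meson dvdE)
    have "b' dvd a * c'" using less.prems \<pi> c' by (auto simp: mult.left_commute)
    moreover have "mdeg b' < mdeg b" using \<pi> less.prems mdeg_less_mult[of \<pi> b'] by (auto simp: irreducible_def)
    moreover have "rel_prime a b'" using less.prems(1) \<pi> by (auto simp: rel_prime_def)
    ultimately have "b' dvd c'" using less.hyps[of b' c'] less.prems \<pi> by auto
    then show ?thesis by (simp add: \<pi> c')
  qed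
qed

text \<open>Common factors that are not units are split off until none is left; the degree of
  \<open>b\<close> drops each time. This provides lowest terms.\<close>

lemma exists_rel_prime_quotients:
  fixes a b :: "('v::linorder, 'a::field) mpoly"
  assumes "b \<noteq> 0"
  shows "\<exists>d a' b'. a = d * a' \<and> b = d * b' \<and> rel_prime a' b'"
  using assms
proof (induction "mdeg b" arbitrary: a b rule: less_induct)
  case less
  show ?case
  proof (cases "rel_prime a b")
    case True
    then show ?thesis by (intro exI[of _ 1] exI[of _ a] exI[of _ b]) auto
  next
    case False
    then obtain e a1 b1 where e: "\<not> e dvd 1" "a = e * a1" "b = e * b1"
      by (auto simp: rel_prime_def elim!: dvdE)
    then have "mdeg b1 < mdeg b" using less.prems mdeg_less_mult[of e b1] by auto
    then obtain d a' b' where "a1 = d * a'" "b1 = d * b'" "rel_prime a' b'"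
      using less.hyps[of b1 a1] less.prems e by auto
    then show ?thesis using e by (intro exI[of _ "e * d"] exI[of _ a'] exI[of _ b']) (auto simp: mult.assoc)
  qed
qed

lemma exists_lcm_in:
  fixes S :: "('v::linorder, 'a::field) mpoly set"
  assumes "finite S" "S \<subseteq> polys_in N - {0}"
  shows "\<exists>q. q \<noteq> 0 \<and> is_lcm_in N S q"
  using assms
proof induction
  case empty
  then show ?case by (intro exI[of _ 1]) (auto simp: is_lcm_in_def)
next
  case (insert b S)
  then obtain q where q: "q \<noteq> 0" "is_lcm_in N S q" by auto
  have b: "b \<noteq> 0" "b \<in> polys_in N" using insert.prems by auto
  \<comment> \<open>\<open>d\<close> acts as a greatest common divisor of \<open>q\<close> and
    \<open>b\<close>, so \<open>q * b'\<close> is their least common multiple.\<close>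
  obtain d q' b' where d: "q = d * q'" "b = d * b'" "rel_prime q' b'"
    using exists_rel_prime_quotients[OF b(1), of q] by blast
  show ?case
  proof (intro exI[of _ "q * b'"] conjI)
    show "q * b' \<noteq> 0" using q b d by auto
    show "is_lcm_in N (insert b S) (q * b')"
      unfolding is_lcm_in_def
    proof (intro conjI ballI impI)
      have "b' \<in> polys_in N" using polys_in_dvd[of b' b] b d by auto
      then show "q * b' \<in> polys_in N" using q by (auto simp: is_lcm_in_def intro: polys_in_mult)
    next
      fix x assume "x \<in> insert b S"
      then show "x dvd q * b'" using q d(2) unfolding is_lcm_in_def d(1)
        by (metis insertE dvd_mult2 mult.assoc mult.commute dvd_triv_left)
    next
      fix y assume y: "y \<in> polys_in N" "\<forall>b\<in>insert b S. b dvd y"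
      then have "q dvd y" using q by (auto simp: is_lcm_in_def)
      then obtain t where t: "y = q * t" ..
      have "b dvd y" using y by auto
      then have "b' dvd q' * t" using t d b by (auto simp: mult.assoc)
      then have "b' dvd t" using rel_prime_dvd_mult[of q' b' t] d b by auto
      then show "q * b' dvd y" by (simp add: t)
    qed
  qed
qed

section \<open>Ideals, rankings, differential reduction and characteristic sets\<close>

section \<open>Ideals\<close>

lemma ideal_of_zero: "ideal_of R J \<Longrightarrow> 0 \<in> J"
  and ideal_of_add: "ideal_of R J \<Longrightarrow> a \<in> J \<Longrightarrow> b \<in> J \<Longrightarrow> a + b \<in> J"
  and ideal_of_mult: "ideal_of R J \<Longrightarrow> r \<in> R \<Longrightarrow> a \<in> J \<Longrightarrow> r * a \<in> J"
  and ideal_of_subset: "ideal_of R J \<Longrightarrow> J \<subseteq> R"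
  by (auto simp: ideal_of_def)

lemma ideal_of_uminus: "ideal_of (polys_in V) J \<Longrightarrow> a \<in> J \<Longrightarrow> - a \<in> J"
  using ideal_of_mult[of "polys_in V" J "-1" a] polys_in_uminus[of 1 V] by auto

lemma ideal_of_diff: "ideal_of (polys_in V) J \<Longrightarrow> a \<in> J \<Longrightarrow> b \<in> J \<Longrightarrow> a - b \<in> J"
  using ideal_of_add[of _ J a "- b"] ideal_of_uminus[of V J b] by auto

lemma polys_in_UNIV: "polys_in UNIV = UNIV"
  by (auto simp: polys_in_def)

lemma ideal_of_UNIV_restrict:
  assumes "ideal_of UNIV J" shows "ideal_of (polys_in V) (polys_in V \<inter> J)"
  using assms by (auto simp: ideal_of_def intro: polys_in_closed)

lemma ideal_of_Inter: "\<lbrakk>\<And>J. J \<in> X \<Longrightarrow> ideal_of R J; X \<noteq> {}\<rbrakk> \<Longrightarrow> ideal_of R (\<Inter> X)"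
  by (fastforce simp: ideal_of_def)

lemma diff_ideal_hull: "diff_ideal \<delta> (diff_ideal \<delta> hull F)"
proof -
  have "diff_ideal \<delta> UNIV" by (simp add: diff_ideal_def ideal_of_def)
  then have "ideal_of UNIV (\<Inter>{t. diff_ideal \<delta> t \<and> F \<subseteq> t})"
    by (intro ideal_of_Inter) (auto simp: diff_ideal_def)
  then show ?thesis by (auto simp: diff_ideal_def hull_def)
qed

section \<open>Leaders and pseudo-reduction\<close>

locale variable_order =
  fixes le :: "'v \<Rightarrow> 'v \<Rightarrow> bool"
  assumes linear_order_le: "linear_order {(u, v). le u v}"
begin

definition lt :: "'v \<Rightarrow> 'v \<Rightarrow> bool" where
  "lt u v \<longleftrightarrow> le u v \<and> u \<noteq> v"

lemma le_refl [simp]: "le u u"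
  using linear_order_le by (auto simp: order_on_defs refl_on_def)

lemma le_trans: "le u v \<Longrightarrow> le v w \<Longrightarrow> le u w"
  using linear_order_le by (auto simp: order_on_defs trans_def)

lemma le_antisym: "le u v \<Longrightarrow> le v u \<Longrightarrow> u = v"
  using linear_order_le by (auto simp: order_on_defs antisym_def)

lemma le_total: "le u v \<or> le v u"
  using linear_order_le by (cases "u = v") (auto simp: order_on_defs total_on_def)

lemma lt_le: "lt u v \<Longrightarrow> le u v"
  and lt_irrefl [simp]: "\<not> lt u u"
  by (auto simp: lt_def)

lemma not_le_iff_lt: "\<not> le u v \<longleftrightarrow> lt v u"
  using le_total[of u v] le_antisym by (auto simp: lt_def)

lemma not_lt_iff_le: "\<not> lt u v \<longleftrightarrow> le v u"
  using not_le_iff_lt by blast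

lemma lt_le_trans: "lt u v \<Longrightarrow> le v w \<Longrightarrow> lt u w"
  and le_lt_trans: "le u v \<Longrightarrow> lt v w \<Longrightarrow> lt u w"
  using le_trans le_antisym by (auto simp: lt_def)

lemma lt_trans: "lt u v \<Longrightarrow> lt v w \<Longrightarrow> lt u w"
  using lt_le_trans lt_le by blast

lemma exists_greatest:
  assumes "finite X" "X \<noteq> {}"
  shows "\<exists>u\<in>X. \<forall>v\<in>X. le v u"
  using assms
proof (induction rule: finite_ne_induct)
  case (insert x X)
  then show ?case by (metis insert_iff le_refl le_total le_trans)
qed auto

lemma leader_eqI: "u \<in> vars f \<Longrightarrow> (\<And>v. v \<in> vars f \<Longrightarrow> le v u) \<Longrightarrow> leader le f = u"
  unfolding leader_def by (rule the_equality) (auto intro: le_antisym)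

lemma leader_in_vars: "vars f \<noteq> {} \<Longrightarrow> leader le f \<in> vars f"
  and vars_le_leader: "v \<in> vars f \<Longrightarrow> le v (leader le f)"
proof -
  have *: "leader le f \<in> vars f \<and> (\<forall>v\<in>vars f. le v (leader le f))" if "vars f \<noteq> {}"
    using exists_greatest[of "vars f"] leader_eqI[of _ f] that by force
  show "vars f \<noteq> {} \<Longrightarrow> leader le f \<in> vars f" using * by blast
  show "v \<in> vars f \<Longrightarrow> le v (leader le f)" using * by blast
qed

lemma deg_in_leader: "vars f \<noteq> {} \<Longrightarrow> 0 < deg_in (leader le f) f"
  using leader_in_vars[of f] deg_in_eq_0_iff[of "leader le f" f] by simp

lemma vars_init: "vars (init le f) \<subseteq> vars f - {leader le f}"
  unfolding init_def by (rule vars_coeff_in)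

lemma vars_init_lt: "v \<in> vars (init le f) \<Longrightarrow> lt v (leader le f)"
  using vars_init[of f] vars_le_leader[of v f] by (auto simp: lt_def)

end

locale variable_order' = variable_order le for le :: "'v::linorder \<Rightarrow> 'v \<Rightarrow> bool"
begin

text \<open>Division starts with the highest leader; the remaining elements of \<open>B\<close> do
  not contain it, so they cannot spoil the degree reached there. The multiplicative set
  \<open>S\<close> and the ideal \<open>T\<close> are left open because the lemma is applied with
  divisors of powers of a product of initials and separants, with regular elements and with nonzero
  elements of \<open>k[N]\<close>, and with ideals that record extra information about their
  elements.\<close>

lemma pseudo_reduction:
  fixes B :: "('v, 'a::idom) mpoly set"
  assumes "finite B" "inj_on (leader le) B" "\<And>f. f \<in> B \<Longrightarrow> vars f \<noteq> {}"
    and T: "ideal_of (polys_in V) T" and "B \<subseteq> T"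
    and S: "S \<subseteq> polys_in V" "1 \<in> S" "\<And>a b. a \<in> S \<Longrightarrow> b \<in> S \<Longrightarrow> a * b \<in> S"
    and "\<And>f. f \<in> B \<Longrightarrow> init le f \<in> S"
    and "p \<in> polys_in V"
  shows "\<exists>s\<in>S. \<exists>r\<in>polys_in V. s * p - r \<in> T \<and>
    (\<forall>f\<in>B. deg_in (leader le f) r < deg_in (leader le f) f) \<and>
    (\<forall>w. (\<forall>f\<in>B. w \<notin> vars f) \<longrightarrow> deg_in w r \<le> deg_in w p)"
  using assms(1,2,3,5,9,10)
proof (induction "card B" arbitrary: B p rule: less_induct)
  case less
  show ?case
  proof (cases "B = {}")
    case True
    then show ?thesis using less.prems S ideal_of_zero[OF T]
      by (intro bexI[of _ 1] bexI[of _ p]) auto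
  next
    case False
    then obtain f where f: "f \<in> B" "\<And>g. g \<in> B \<Longrightarrow> le (leader le g) (leader le f)"
      using exists_greatest[of "leader le ` B"] less.prems(1) by auto
    let ?u = "leader le f"
    define B' where "B' = B - {f}"
    \<comment> \<open>All variables of \<open>g\<close> are bounded by its own leader, which is
      below \<open>?u\<close> since leaders are distinct.\<close>
    have u: "?u \<notin> vars g" if "g \<in> B'" for g
    proof
      assume "?u \<in> vars g"
      then have "?u = leader le g"
        using that f vars_le_leader[of ?u g] by (intro le_antisym) (auto simp: B'_def)
      then show False using that less.prems(2) f(1) by (auto simp: B'_def inj_on_def)
    qed
    have fV: "f \<in> polys_in V" using less.prems f ideal_of_subset[OF T] by auto
    obtain k q r where qr: "q \<in> polys_in V" "r \<in> polys_in V"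
      "init le f ^ k * p = q * f + r" "deg_in ?u r < deg_in ?u f"
      "\<forall>w. w \<notin> vars f \<longrightarrow> deg_in w r \<le> deg_in w p"
      using pseudo_division[OF deg_in_leader[OF less.prems(3)[OF f(1)]] fV less.prems(6)]
      unfolding init_def by blast
    have "card B' < card B" using less.prems f unfolding B'_def by (intro card_Diff1_less)
    moreover have "finite B'" "inj_on (leader le) B'" "B' \<subseteq> T"
      using less.prems by (auto simp: B'_def intro: inj_on_subset)
    ultimately obtain s r' where sr: "s \<in> S" "r' \<in> polys_in V" "s * r - r' \<in> T"
      "\<forall>f\<in>B'. deg_in (leader le f) r' < deg_in (leader le f) f"
      "\<forall>w. (\<forall>f\<in>B'. w \<notin> vars f) \<longrightarrow> deg_in w r' \<le> deg_in w r"
      using less.hyps[of B' r] less.prems qr(2) by (auto simp: B'_def)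
    have pow: "init le f ^ k \<in> S" using S less.prems(5)[OF f(1)] by (induction k) auto
    show ?thesis
    proof (intro bexI conjI)
      show "s * init le f ^ k \<in> S" using S sr pow by auto
      have "s * (init le f ^ k * p) - r' = s * (q * f + r) - r'" using qr(3) by simp
      then have "s * init le f ^ k * p - r' = (s * q) * f + (s * r - r')"
        by (simp add: algebra_simps)
      then show "s * init le f ^ k * p - r' \<in> T"
        unfolding \<open>s * init le f ^ k * p - r' = _\<close> using sr qr S less.prems f
        by (auto intro!: ideal_of_add[OF T] ideal_of_mult[OF T] polys_in_mult)
      show "\<forall>f\<in>B. deg_in (leader le f) r' < deg_in (leader le f) f"
      proof
        fix g assume g: "g \<in> B"
        show "deg_in (leader le g) r' < deg_in (leader le g) g"
        proof (cases "g = f")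
          case True
          have "deg_in ?u r' \<le> deg_in ?u r" using sr(5) u by blast
          then show ?thesis using True qr(4) by simp
        next
          case False
          then show ?thesis using g sr(4) by (simp add: B'_def)
        qed
      qed
      show "\<forall>w. (\<forall>f\<in>B. w \<notin> vars f) \<longrightarrow> deg_in w r' \<le> deg_in w p"
      proof (intro allI impI)
        fix w assume w: "\<forall>f\<in>B. w \<notin> vars f"
        then have "deg_in w r' \<le> deg_in w r" "deg_in w r \<le> deg_in w p"
          using sr(5) qr(5) f(1) by (auto simp: B'_def)
        then show "deg_in w r' \<le> deg_in w p" by simp
      qed
    qed (use sr in auto)
  qed
qed

end

section \<open>Rankings\<close>

lemma exists_mono_subseq_nat:
  fixes s :: "nat \<Rightarrow> nat"
  shows "\<exists>g :: nat \<Rightarrow> nat. strict_mono g \<and> mono (\<lambda>i. s (g i))"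
proof -
  obtain f where f: "strict_mono f" "monoseq (\<lambda>n. s (f n))"
    using seq_monosub[of s] by blast
  then consider "\<forall>m n. m \<le> n \<longrightarrow> s (f m) \<le> s (f n)" | "\<forall>m n. m \<le> n \<longrightarrow> s (f n) \<le> s (f m)"
    by (auto simp: monoseq_def)
  then show ?thesis
  proof cases
    case 1
    then show ?thesis using f by (auto simp: mono_def)
  next
    case 2
    \<comment> \<open>A nonincreasing sequence of natural numbers is constant from an index on where
      it attains its minimum, so its tail is also nondecreasing.\<close>
    obtain N where N: "\<And>y. s (f N) \<le> s (f y)"
      using ex_has_least_nat[of "\<lambda>_. True" 0 "\<lambda>n. s (f n)"] by auto
    have "s (f (n + N)) = s (f N)" for n using 2 N by (simp add: le_antisym)
    moreover have "strict_mono (\<lambda>n. f (n + N))" using f by (auto simp: strict_mono_def)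
    ultimately show ?thesis by (intro exI[of _ "\<lambda>n. f (n + N)"]) (auto simp: mono_def)
  qed
qed

lemma exists_mono_subseq:
  fixes s :: "nat \<Rightarrow> 'n \<Rightarrow>\<^sub>0 nat"
  assumes "finite X"
  shows "\<exists>g :: nat \<Rightarrow> nat. strict_mono g \<and> (\<forall>x\<in>X. mono (\<lambda>i. lookup (s (g i)) x))"
  using assms
proof induction
  case empty
  have "strict_mono (id :: nat \<Rightarrow> nat)" by (simp add: strict_mono_def)
  then show ?case by blast
next
  case (insert x X)
  then obtain g :: "nat \<Rightarrow> nat" where g: "strict_mono g" "\<forall>x\<in>X. mono (\<lambda>i. lookup (s (g i)) x)" by auto
  obtain h :: "nat \<Rightarrow> nat" where h: "strict_mono h" "mono (\<lambda>i. lookup (s (g (h i))) x)"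
    using exists_mono_subseq_nat[of "\<lambda>i. lookup (s (g i)) x"] by auto
  have "strict_mono (g \<circ> h)" using g(1) h(1) by (rule strict_mono_o)
  moreover have "mono (\<lambda>i. lookup (s (g (h i))) y)" if "y \<in> X" for y
    using g(2) that strict_mono_mono[OF h(1)] by (auto simp: mono_def)
  ultimately show ?case using h by (intro exI[of _ "\<lambda>i. g (h i)"]) (auto simp: o_def)
qed

text \<open>One indeterminate occurs infinitely often; along a further subsequence every exponent is
  nondecreasing, so the difference of two exponent functions is a derivative operator.\<close>

lemma dickson:
  fixes s :: "nat \<Rightarrow> ('n::finite, 'l::finite) dvar"
  shows "\<exists>i j \<theta>. i < j \<and> s j = apply_op \<theta> (s i)"
proof -
  obtain k where k: "infinite {i. snd (s i) = snd (s k)}"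
    using pigeonhole_infinite[of UNIV "\<lambda>i. snd (s i)"] by auto
  obtain r :: "nat \<Rightarrow> nat" where r: "strict_mono r" "\<And>n. snd (s (r n)) = snd (s k)"
    using infinite_enumerate[OF k] by blast
  obtain g :: "nat \<Rightarrow> nat" where g: "strict_mono g" "\<And>x. mono (\<lambda>i. lookup (fst (s (r (g i)))) x)"
    using exists_mono_subseq[of UNIV "\<lambda>i. fst (s (r i))"] by auto
  let ?a = "s (r (g 0))" and ?b = "s (r (g 1))"
  have "lookup (fst ?a) x \<le> lookup (fst ?b) x" for x
    using g(2)[of x] by (auto simp: mono_def)
  then have "fst ?b - fst ?a + fst ?a = fst ?b"
    by (intro poly_mapping_eqI) (simp add: lookup_add lookup_minus)
  then have "?b = apply_op (fst ?b - fst ?a) ?a"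
    using r(2) by (auto simp: apply_op_def prod_eq_iff)
  moreover have "r (g 0) < r (g 1)" using r(1) g(1) by (auto simp: strict_mono_def)
  ultimately show ?thesis by blast
qed

lemma apply_op_zero [simp]: "apply_op 0 u = u"
  by (simp add: apply_op_def)

lemma apply_op_apply_op: "apply_op \<theta> (apply_op \<eta> u) = apply_op (\<theta> + \<eta>) u"
  by (simp add: apply_op_def add.assoc)

lemma apply_op_inject: "apply_op \<theta> u = apply_op \<theta> v \<longleftrightarrow> u = v"
  by (auto simp: apply_op_def prod_eq_iff)

lemma apply_op_eq_self_iff: "apply_op \<theta> u = u \<longleftrightarrow> \<theta> = 0"
  by (auto simp: apply_op_def prod_eq_iff)

lemma single_neq_zero: "c \<noteq> 0 \<Longrightarrow> single k c \<noteq> 0"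
  by (metis lookup_single_eq lookup_zero)

locale differential_ranking =
  fixes le :: "('n::{finite,linorder}, 'l::{finite,linorder}) dvar \<Rightarrow> ('n, 'l) dvar \<Rightarrow> bool"
  assumes ranking_le: "ranking le"
begin

sublocale variable_order' le
  using ranking_le by unfold_locales (auto simp: ranking_def)

lemma le_apply_op: "le u (apply_op \<theta> u)"
  using ranking_le unfolding ranking_def by blast

lemma lt_apply_op: "\<theta> \<noteq> 0 \<Longrightarrow> lt u (apply_op \<theta> u)"
  using le_apply_op apply_op_eq_self_iff[of \<theta> u] by (auto simp: lt_def)

lemma apply_op_mono: "le u v \<Longrightarrow> le (apply_op \<theta> u) (apply_op \<theta> v)"
  using ranking_le unfolding ranking_def by blast

lemma apply_op_strict_mono: "lt u v \<Longrightarrow> lt (apply_op \<theta> u) (apply_op \<theta> v)"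
  using apply_op_mono by (auto simp: lt_def apply_op_inject)

text \<open>In a strictly decreasing sequence some later term would be a derivative of an earlier
  one by Dickson's lemma, and a ranking never places derivatives lower.\<close>

lemma wf_lt: "wf {(u, v). lt u v}"
  unfolding wf_iff_no_infinite_down_chain
proof
  assume "\<exists>s. \<forall>i. (s (Suc i), s i) \<in> {(u, v). lt u v}"
  then obtain s where s: "\<And>i. lt (s (Suc i)) (s i)" by auto
  have less: "lt (s j) (s i)" if "i < j" for i j
    using that by (induction rule: strict_inc_induct) (use s lt_trans in blast)+
  obtain i j \<theta> where "i < j" "s j = apply_op \<theta> (s i)" using dickson[of s] by blast
  then show False using less le_apply_op[of "s i" \<theta>] not_lt_iff_le by metis
qed

lemma autoreduced_inj_on_leader:
  assumes "autoreduced le A" shows "inj_on (leader le) A"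
proof (rule inj_onI, rule ccontr)
  fix f g assume "f \<in> A" "g \<in> A" "leader le f = leader le g" "f \<noteq> g"
  then have "reduced_wrt le f g" "reduced_wrt le g f" "leader le f = leader le g"
    using assms by (auto simp: autoreduced_def)
  then show False by (simp add: reduced_wrt_def)
qed

text \<open>By Dickson's lemma an infinite set would have two leaders, one a proper derivative of
  the other, and a leader occurs in its own polynomial.\<close>

lemma finite_autoreduced:
  assumes A: "autoreduced le A" shows "finite A"
proof (rule ccontr)
  assume "infinite A"
  then obtain f :: "nat \<Rightarrow> _" where f: "inj f" "range f \<subseteq> A"
    using infinite_countable_subset by blast
  obtain i j \<theta> where ij: "i < j" "leader le (f j) = apply_op \<theta> (leader le (f i))"
    using dickson[of "\<lambda>i. leader le (f i)"] by blast
  have fij: "f j \<in> A" "f i \<in> A" "f j \<noteq> f i" using f ij by (auto dest: injD)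
  then have "leader le (f j) \<noteq> leader le (f i)"
    using autoreduced_inj_on_leader[OF A] by (auto dest: inj_onD)
  then have "\<theta> \<noteq> 0" using ij by auto
  moreover have "leader le (f j) \<in> vars (f j)"
    using A fij by (intro leader_in_vars) (auto simp: autoreduced_def)
  ultimately show False
    using A fij ij by (auto simp: autoreduced_def reduced_wrt_def)
qed

text \<open>Derivation is strictly monotone on the variables, so in the chain rule only the summand
  of \<open>v\<close> can reach the derivative of \<open>v\<close>; \<open>v\<close> itself need not
  occur in \<open>g\<close>.\<close>

lemma dderiv_leading:
  fixes g :: "('n, 'l, 'k::field) dpoly"
  assumes "\<And>w. w \<in> vars g \<Longrightarrow> le w v"
  shows "\<exists>t. dderiv \<delta> i g = partial_deriv v g * var (apply_op (single i 1) v) + t \<and>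
    (\<forall>w\<in>vars t. lt w (apply_op (single i 1) v))"
proof -
  let ?d = "apply_op (single i 1)"
  let ?B = "polys_in {w. lt w (?d v)}"
  define t where "t = Poly_Mapping.map (\<delta> i) g + (\<Sum>w\<in>vars g - {v}. partial_deriv w g * var (?d w))"
  have lt: "lt w (?d v)" if "w \<in> vars g" for w
    using assms[OF that] lt_apply_op[OF single_neq_zero, of 1 v i] le_lt_trans by auto
  have "keys (Poly_Mapping.map (\<delta> i) g) \<subseteq> keys g"
    by (auto simp: in_keys_iff Poly_Mapping.map.rep_eq)
  then have "vars (Poly_Mapping.map (\<delta> i) g) \<subseteq> vars g" by (auto simp: vars_def)
  then have "Poly_Mapping.map (\<delta> i) g \<in> ?B" using lt by (auto simp: polys_in_iff)
  moreover have "partial_deriv w g * var (?d w) \<in> ?B" if "w \<in> vars g - {v}" for w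
  proof (rule polys_in_mult)
    show "partial_deriv w g \<in> ?B" using lt vars_partial_deriv[of w g] by (auto simp: polys_in_iff)
    have "lt w v" using assms[of w] that by (simp add: lt_def)
    then show "var (?d w) \<in> ?B" by (intro polys_in_var) (simp add: apply_op_strict_mono)
  qed
  ultimately have "t \<in> ?B" unfolding t_def by (intro polys_in_add polys_in_sum)
  moreover have "dderiv \<delta> i g = partial_deriv v g * var (?d v) + t"
    by (cases "v \<in> vars g")
      (simp_all add: dderiv_def t_def sum.remove[of "vars g" v] partial_deriv_eq_0 algebra_simps)
  ultimately show ?thesis by (auto simp: polys_in_iff)
qed

text \<open>The element \<open>g\<close> is the \<open>\<theta>\<close>-derivative of
  \<open>f\<close>, obtained by applying derivations in some order. The clause on the partial
  derivative carries the induction: it holds for \<open>f\<close> itself by definition of the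
  separant, and after one derivation it says that \<open>g\<close> is linear in its leader with the
  separant as coefficient.\<close>

lemma exists_derivative:
  fixes f :: "('n, 'l, 'k::field) dpoly"
  assumes T: "diff_ideal \<delta> T" and f: "f \<in> T" and "vars f \<noteq> {}"
  shows "\<exists>g\<in>T. (\<forall>w\<in>vars g. le w (apply_op \<theta> (leader le f))) \<and>
    partial_deriv (apply_op \<theta> (leader le f)) g = separant le f \<and>
    (\<theta> \<noteq> 0 \<longrightarrow> (\<exists>t. g = separant le f * var (apply_op \<theta> (leader le f)) + t \<and>
       (\<forall>w\<in>vars t. lt w (apply_op \<theta> (leader le f)))))"
proof (induction "\<Sum>i\<in>UNIV. lookup \<theta> i" arbitrary: \<theta> rule: less_induct)
  case less
  let ?u = "leader le f" and ?S = "separant le f"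
  show ?case
  proof (cases "\<theta> = 0")
    case True
    then show ?thesis using f by (intro bexI[of _ f]) (auto simp: vars_le_leader separant_def)
  next
    case False
    then obtain i where i: "lookup \<theta> i \<noteq> 0" by (metis poly_mapping_eqI lookup_zero)
    define \<eta> where "\<eta> = \<theta> - single i 1"
    have \<theta>: "\<theta> = single i 1 + \<eta>"
      using i by (intro poly_mapping_eqI)
        (auto simp: \<eta>_def lookup_add lookup_minus lookup_single when_def)
    have "(\<Sum>i\<in>UNIV. lookup \<eta> i) < (\<Sum>i\<in>UNIV. lookup \<theta> i)"
      unfolding \<theta> by (simp add: lookup_add sum.distrib lookup_single when_def)
    from less[OF this] obtain g where g: "g \<in> T" "\<forall>w\<in>vars g. le w (apply_op \<eta> ?u)"
      "partial_deriv (apply_op \<eta> ?u) g = ?S" by blast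
    let ?v = "apply_op \<theta> ?u"
    have v: "?v = apply_op (single i 1) (apply_op \<eta> ?u)" by (simp add: \<theta> apply_op_apply_op)
    obtain t where t: "dderiv \<delta> i g = ?S * var ?v + t" "\<forall>w\<in>vars t. lt w ?v"
      using dderiv_leading[of g "apply_op \<eta> ?u" \<delta> i] g unfolding v by auto
    have S: "lt w ?v" if "w \<in> vars ?S" for w :: "('n, 'l) dvar"
    proof -
      have "w \<in> vars f" using that vars_partial_deriv[of ?u f] by (auto simp: separant_def)
      then show ?thesis using vars_le_leader lt_apply_op[OF False] le_lt_trans by blast
    qed
    show ?thesis
    proof (intro bexI conjI impI exI)
      show "dderiv \<delta> i g \<in> T" using T g by (auto simp: diff_ideal_def)
      show "dderiv \<delta> i g = ?S * var ?v + t" by fact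
      show "\<forall>w\<in>vars t. lt w ?v" by fact
      show "\<forall>w\<in>vars (dderiv \<delta> i g). le w ?v"
      proof
        fix w assume "w \<in> vars (dderiv \<delta> i g)"
        then have "w \<in> vars ?S \<union> {?v} \<union> vars t"
          unfolding t using vars_add[of "?S * var ?v" t] vars_mult[of ?S "var ?v"] by auto
        then consider "w \<in> vars ?S" | "w = ?v" | "w \<in> vars t" by blast
        then show "le w ?v" using S[of w] t(2) lt_le[of w ?v] by cases auto
      qed
      have "?v \<notin> vars ?S" "?v \<notin> vars t" using S[of ?v] t(2) by force+
      then show "partial_deriv ?v (dderiv \<delta> i g) = ?S"
        by (simp add: t partial_deriv_add partial_deriv_mult partial_deriv_eq_0)
    qed
  qed
qed

definition proper_derivatives :: "('n, 'l) dvar set \<Rightarrow> ('n, 'l) dvar set" where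
  "proper_derivatives L = {apply_op \<theta> u | \<theta> u. \<theta> \<noteq> 0 \<and> u \<in> L}"

text \<open>Induction on the highest proper derivative of a leader that occurs in \<open>p\<close>.
  It is eliminated by pseudo-division by a derivative of an element of \<open>A\<close>, whose
  initial is a separant.\<close>

lemma partial_reduction:
  fixes A S T :: "('n, 'l, 'k::field) dpoly set" and p :: "('n, 'l, 'k) dpoly"
  assumes T: "diff_ideal \<delta> T" and A: "A \<subseteq> T" "\<And>f. f \<in> A \<Longrightarrow> vars f \<noteq> {}"
    and S: "1 \<in> S" "\<And>a b. a \<in> S \<Longrightarrow> b \<in> S \<Longrightarrow> a * b \<in> S" "\<And>f. f \<in> A \<Longrightarrow> separant le f \<in> S"
  shows "\<exists>s\<in>S. \<exists>r. s * p - r \<in> T \<and> vars r \<inter> proper_derivatives (leader le ` A) = {}"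
proof -
  let ?D = "proper_derivatives (leader le ` A)"
  define Q :: "('n, 'l, 'k) dpoly \<Rightarrow> bool" where "Q p \<longleftrightarrow> (\<exists>s\<in>S. \<exists>r. s * p - r \<in> T \<and> vars r \<inter> ?D = {})" for p
  have I: "ideal_of (polys_in UNIV) T" using T by (simp add: diff_ideal_def polys_in_UNIV)
  have Q0: "Q p" if "vars p \<inter> ?D = {}" for p :: "('n, 'l, 'k) dpoly"
    using that S ideal_of_zero[OF I] unfolding Q_def by (intro bexI[of _ 1] exI[of _ p]) auto
  have "\<forall>p. vars p \<inter> ?D \<subseteq> {w. le w v} \<longrightarrow> Q p" for v
    using wf_lt
  proof (induction v rule: wf_induct_rule)
    case (less v)
    have below: "Q p" if p: "vars p \<inter> ?D \<subseteq> {w. lt w v}" for p :: "('n, 'l, 'k) dpoly"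
    proof (cases "vars p \<inter> ?D = {}")
      case False
      then obtain u where u: "u \<in> vars p \<inter> ?D" "\<forall>w\<in>vars p \<inter> ?D. le w u"
        using exists_greatest[of "vars p \<inter> ?D"] by auto
      then show ?thesis using less[of u] p by auto
    qed (rule Q0)
    show ?case
    proof (intro allI impI)
      fix p :: "('n, 'l, 'k) dpoly"
      assume p: "vars p \<inter> ?D \<subseteq> {w. le w v}"
      show "Q p"
      proof (cases "v \<in> vars p \<inter> ?D")
        case False
        then have "vars p \<inter> ?D \<subseteq> {w. lt w v}" using p by (auto simp: lt_def)
        then show ?thesis by (rule below)
      next
        case True
        then obtain \<theta> f where f: "f \<in> A" "\<theta> \<noteq> 0" "v = apply_op \<theta> (leader le f)"
          by (auto simp: proper_derivatives_def)
        let ?S = "separant le f"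
        obtain g t where g: "g \<in> T" "g = ?S * var v + t" "\<forall>w\<in>vars t. lt w v" "\<forall>w\<in>vars g. le w v"
          using exists_derivative[OF T, of f \<theta>] A f by auto
        have nS: "v \<notin> vars ?S"
        proof
          assume "v \<in> vars ?S"
          then have "le v (leader le f)"
            using vars_partial_deriv[of "leader le f" f] vars_le_leader[of v f] by (auto simp: separant_def)
          then show False using lt_apply_op[OF f(2), of "leader le f"] f(3) not_lt_iff_le by blast
        qed
        show ?thesis
        proof (cases "?S = 0")
          \<comment> \<open>A vanishing separant puts \<open>0\<close> into \<open>S\<close>, which
            makes the claim trivial.\<close>
          case True
          then have "0 \<in> S" using S(3)[OF f(1)] by simp
          then show ?thesis unfolding Q_def using ideal_of_zero[OF I]
            by (intro bexI[of _ 0] exI[of _ 0]) auto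
        next
          case False
          have "v \<notin> vars t" using g by auto
          \<comment> \<open>Being linear in \<open>v\<close>, the divisor \<open>g\<close> leaves a
            remainder without \<open>v\<close>.\<close>
          then have ug: "univ v g = [:t, ?S:]"
            using nS unfolding g(2) by (simp add: univ_add univ_mult univ_not_in_vars)
          then have deg: "deg_in v g = 1" and c: "coeff_in v (deg_in v g) g = ?S"
            using False by (simp_all add: degree_univ[symmetric] coeff_univ[symmetric])
          let ?V = "vars p \<union> vars g"
          obtain k q r where r: "r \<in> polys_in ?V" "?S ^ k * p = q * g + r" "deg_in v r < 1"
            using pseudo_division[of v g ?V p] deg unfolding c by (auto simp: polys_in_iff)
          have "v \<notin> vars r" using r(3) deg_in_eq_0_iff[of v r] by simp
          then have "vars r \<inter> ?D \<subseteq> {w. lt w v}"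
            using r(1) g(4) p by (fastforce simp: polys_in_iff lt_def)
          then obtain s r' where r': "s \<in> S" "s * r - r' \<in> T" "vars r' \<inter> ?D = {}"
            using below unfolding Q_def by blast
          have "?S ^ k \<in> S" using S f by (induction k) auto
          moreover have "s * (?S ^ k * p) - r' = s * (q * g + r) - r'" using r(2) by simp
          then have eq: "s * ?S ^ k * p - r' = (s * q) * g + (s * r - r')"
            by (simp add: algebra_simps)
          have "s * ?S ^ k * p - r' \<in> T"
            unfolding eq using r' g(1)
            by (auto intro!: ideal_of_add[OF I] ideal_of_mult[OF I] simp: polys_in_UNIV)
          ultimately show ?thesis
            unfolding Q_def using r' S by blast
        qed
      qed
    qed
  qed
  moreover have "vars p \<inter> ?D = {} \<or> (\<exists>v. vars p \<inter> ?D \<subseteq> {w. le w v})"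
    using exists_greatest[of "vars p"] by (cases "vars p = {}") auto
  ultimately have "Q p" using Q0 by blast
  then show ?thesis by (simp add: Q_def)
qed

lemma autoreduced_partially_reduced:
  assumes "autoreduced le A" "f \<in> A"
  shows "f \<in> polys_in (- proper_derivatives (leader le ` A))"
  unfolding polys_in_iff
proof
  fix v assume v: "v \<in> vars f"
  show "v \<in> - proper_derivatives (leader le ` A)"
  proof
    assume "v \<in> proper_derivatives (leader le ` A)"
    then obtain \<theta> g where g: "g \<in> A" "\<theta> \<noteq> 0" "v = apply_op \<theta> (leader le g)"
      by (auto simp: proper_derivatives_def)
    show False
    proof (cases "f = g")
      case True
      then show False using vars_le_leader[OF v] g lt_apply_op[OF g(2)] not_lt_iff_le by blast
    next
      case False
      then show False using assms g v by (auto simp: autoreduced_def reduced_wrt_def)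
    qed
  qed
qed

text \<open>Partial reduction is followed by algebraic reduction by \<open>A\<close>. The second
  stage takes place in the subring without proper derivatives of leaders, which contains
  \<open>A\<close>, so these cannot return.\<close>

lemma differential_reduction:
  fixes A S T :: "('n, 'l, 'k::field) dpoly set" and p :: "('n, 'l, 'k) dpoly"
  assumes T: "diff_ideal \<delta> T" and A: "A \<subseteq> T" "autoreduced le A"
    and S: "1 \<in> S" "\<And>a b. a \<in> S \<Longrightarrow> b \<in> S \<Longrightarrow> a * b \<in> S"
      "\<And>f. f \<in> A \<Longrightarrow> separant le f \<in> S" "\<And>f. f \<in> A \<Longrightarrow> init le f \<in> S"
  shows "\<exists>s\<in>S. \<exists>r. s * p - r \<in> T \<and> (\<forall>f\<in>A. reduced_wrt le r f)"
proof -
  let ?D = "proper_derivatives (leader le ` A)"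
  have vars: "vars f \<noteq> {}" if "f \<in> A" for f using A that by (auto simp: autoreduced_def)
  have I: "ideal_of UNIV T" using T by (simp add: diff_ideal_def)
  have AD: "A \<subseteq> polys_in (- ?D)" using autoreduced_partially_reduced[OF A(2)] by blast
  obtain s r where sr: "s \<in> S" "s * p - r \<in> T" "vars r \<inter> ?D = {}"
    using partial_reduction[OF T A(1) vars S(1-3)] by blast
  have rD: "r \<in> polys_in (- ?D)" using sr by (auto simp: polys_in_iff)
  have ID: "init le f \<in> S \<inter> polys_in (- ?D)" if "f \<in> A" for f
    using that S(4) AD by (auto simp: init_def intro: polys_in_coeff_in)
  have mult: "a * b \<in> S \<inter> polys_in (- ?D)"
    if "a \<in> S \<inter> polys_in (- ?D)" "b \<in> S \<inter> polys_in (- ?D)" for a b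
    using that S(2) by (auto intro: polys_in_mult)
  obtain s' r' where sr': "s' \<in> S \<inter> polys_in (- ?D)" "r' \<in> polys_in (- ?D)"
    "s' * r - r' \<in> polys_in (- ?D) \<inter> T" "\<forall>f\<in>A. deg_in (leader le f) r' < deg_in (leader le f) f"
    using pseudo_reduction[OF finite_autoreduced[OF A(2)] autoreduced_inj_on_leader[OF A(2)] vars
      ideal_of_UNIV_restrict[OF I] _ _ _ mult ID rD] A(1) AD S(1) by auto
  show ?thesis
  proof (intro bexI exI conjI ballI)
    show "s' * s \<in> S" using S sr sr' by auto
    have "s' * s * p - r' = s' * (s * p - r) + (s' * r - r')" by (simp add: algebra_simps)
    then show "s' * s * p - r' \<in> T"
      unfolding \<open>s' * s * p - r' = _\<close> using sr sr' by (auto intro!: ideal_of_add[OF I] ideal_of_mult[OF I])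
    show "reduced_wrt le r' f" if "f \<in> A" for f
      using sr' that unfolding reduced_wrt_def polys_in_iff proper_derivatives_def by blast
  qed
qed

end

section \<open>Ranks and characteristic sets\<close>

lemma exists_sorted_wrt:
  assumes "finite X" "transp R" "\<And>x y. x \<in> X \<Longrightarrow> y \<in> X \<Longrightarrow> x \<noteq> y \<Longrightarrow> R x y \<or> R y x"
  shows "\<exists>xs. set xs = X \<and> sorted_wrt R xs"
  using assms(1,3)
proof induction
  case (insert x X)
  then obtain xs where xs: "set xs = X" "sorted_wrt R xs" by auto
  let ?ys = "filter (\<lambda>y. R y x) xs @ x # filter (\<lambda>y. \<not> R y x) xs"
  have "sorted_wrt R ?ys"
    using xs insert assms(2) by (auto simp: sorted_wrt_append sorted_wrt_filter dest: transpD)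
  moreover have "set ?ys = insert x X" using xs by auto
  ultimately show ?case by blast
qed auto

context variable_order
begin

lemma rank_less_trans: "rank_less le r s \<Longrightarrow> rank_less le s t \<Longrightarrow> rank_less le r t"
  unfolding rank_less_def using lt_trans[of "fst r" "fst s" "fst t"] by (auto simp: lt_def)

lemma rank_less_total: "r \<noteq> s \<Longrightarrow> rank_less le r s \<or> rank_less le s r"
  using le_total[of "fst r" "fst s"] by (cases r; cases s) (auto simp: rank_less_def)

lemma transp_rank_less: "transp (\<lambda>f g. rank_less le (rank le f) (rank le g))"
  by (rule transpI) (rule rank_less_trans)

end

context differential_ranking
begin

lemma exists_ranked_list:
  assumes "autoreduced le A"
  shows "\<exists>fs. set fs = A \<and> ranked_list le fs"
  unfolding ranked_list_def
proof (rule exists_sorted_wrt)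
  fix f g assume "f \<in> A" "g \<in> A" "f \<noteq> g"
  then have "leader le f \<noteq> leader le g"
    using autoreduced_inj_on_leader[OF assms] by (auto dest: inj_onD)
  then have "rank le f \<noteq> rank le g" by (simp add: rank_def)
  then show "rank_less le (rank le f) (rank le g) \<or> rank_less le (rank le g) (rank le f)"
    by (rule rank_less_total)
qed (use finite_autoreduced[OF assms] transp_rank_less in auto)

text \<open>Inserting a nonconstant reduced element of the ideal, and dropping the elements of higher
  rank, would produce an autoreduced set of lower rank.\<close>

lemma characteristic_set_reduced_const:
  fixes A I :: "('n, 'l, 'k::field) dpoly set"
  assumes A: "characteristic_set le I A" and p: "p \<in> I" and red: "\<And>f. f \<in> A \<Longrightarrow> reduced_wrt le p f"
  shows "vars p = {}"
proof (rule ccontr)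
  assume vp: "vars p \<noteq> {}"
  have AI: "A \<subseteq> I" and auto: "autoreduced le A"
    and min: "\<And>B. B \<subseteq> I \<Longrightarrow> autoreduced le B \<Longrightarrow> \<not> lower_rank le B A"
    using A by (auto simp: characteristic_set_def)
  define R where "R f g \<longleftrightarrow> rank_less le (rank le f) (rank le g)" for f g :: "('n, 'l, 'k) dpoly"
  obtain fs where fs: "set fs = A" "ranked_list le fs" using exists_ranked_list[OF auto] by auto
  let ?t = "takeWhile (\<lambda>f. R f p) fs"
  let ?gs = "?t @ [p]"
  have t: "f \<in> A" "R f p" if "f \<in> set ?t" for f
    using that fs by (auto dest: set_takeWhileD)
  have red': "reduced_wrt le f p" if "f \<in> set ?t" for f
    unfolding reduced_wrt_def
  proof (intro conjI allI impI notI)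
    have le: "le (leader le f) (leader le p)"
      using t(2)[OF that] by (auto simp: R_def rank_less_def rank_def)
    {
      fix \<theta> :: "'n deriv_op" assume "\<theta> \<noteq> 0" "apply_op \<theta> (leader le p) \<in> vars f"
      then have "le (apply_op \<theta> (leader le p)) (leader le p)"
        using vars_le_leader le le_trans by blast
      then show False using lt_apply_op[OF \<open>\<theta> \<noteq> 0\<close>] not_lt_iff_le by blast
    }
    show "deg_in (leader le p) f < deg_in (leader le p) p"
    proof (cases "leader le f = leader le p")
      case True
      then show ?thesis using t(2)[OF that] by (simp add: R_def rank_less_def rank_def)
    next
      case False
      then have "leader le p \<notin> vars f" using le vars_le_leader[of "leader le p" f] le_antisym by blast
      then show ?thesis using deg_in_leader[OF vp] deg_in_eq_0_iff[of "leader le p" f] by simp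
    qed
  qed
  have "autoreduced le (set ?gs)"
    using auto t(1) red red' vp by (auto simp: autoreduced_def)
  moreover have "set ?gs \<subseteq> I" using t(1) AI p by auto
  moreover have "lower_rank le (set ?gs) A"
    unfolding lower_rank_def
  proof (intro exI conjI)
    show "ranked_list le ?gs"
    proof -
      have "sorted_wrt R fs" using fs(2) by (simp add: ranked_list_def R_def[abs_def])
      then have "sorted_wrt R ?t" using takeWhile_eq_take sorted_wrt_take by metis
      then have "sorted_wrt R ?gs" using t(2) by (simp add: sorted_wrt_append)
      then show ?thesis by (simp add: ranked_list_def R_def[abs_def])
    qed
    have eq: "?gs ! i = fs ! i" if "i < length ?t" for i
      using that by (simp add: nth_append takeWhile_nth)
    show "(\<exists>j<length ?gs. j < length fs \<and> (\<forall>i<j. rank le (?gs ! i) = rank le (fs ! i)) \<and>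
         rank_less le (rank le (?gs ! j)) (rank le (fs ! j))) \<or>
      length fs < length ?gs \<and> (\<forall>i<length fs. rank le (?gs ! i) = rank le (fs ! i))"
    \<comment> \<open>Either \<open>p\<close> replaces the first element not ranked below it, from
      which it differs in rank by being reduced, or it extends the whole list; both count as
      lower.\<close>
    proof (cases "length ?t < length fs")
      case True
      let ?f = "fs ! length ?t"
      have "?f \<in> A" using True fs(1) by auto
      then have "rank le p \<noteq> rank le ?f" using red[of ?f] by (auto simp: reduced_wrt_def rank_def)
      moreover have "\<not> R ?f p" using True nth_length_takeWhile by blast
      ultimately have "rank_less le (rank le (?gs ! length ?t)) (rank le ?f)"
        using rank_less_total[of "rank le p" "rank le ?f"] by (simp add: R_def)
      then have "length ?t < length ?gs \<and> length ?t < length fs \<and>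
          (\<forall>i<length ?t. rank le (?gs ! i) = rank le (fs ! i)) \<and>
          rank_less le (rank le (?gs ! length ?t)) (rank le ?f)"
        using True eq by auto
      then show ?thesis by blast
    next
      case False
      then have "length ?t = length fs" by (intro order.antisym length_takeWhile_le) simp
      then show ?thesis using eq by auto
    qed
  qed (use fs in auto)
  ultimately show False using min by blast
qed

end

section \<open>A characterizable ideal is proper\<close>

section \<open>Evaluation at a solution\<close>

definition eval_pp :: "('v \<Rightarrow> 'a::comm_semiring_1) \<Rightarrow> 'v power_product \<Rightarrow> 'a" where
  "eval_pp x m = (\<Prod>v\<in>keys m. x v ^ lookup m v)"

definition eval_at :: "('v \<Rightarrow> 'a::comm_semiring_1) \<Rightarrow> ('v, 'a) mpoly \<Rightarrow> 'a" where
  "eval_at x = msum (\<lambda>m a. a * eval_pp x m)"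

lemma eval_pp_superset:
  "finite S \<Longrightarrow> keys m \<subseteq> S \<Longrightarrow> eval_pp x m = (\<Prod>v\<in>S. x v ^ lookup m v)"
  unfolding eval_pp_def by (rule prod.mono_neutral_left) (auto simp: in_keys_iff)

lemma eval_pp_add: "eval_pp x (m + n) = eval_pp x m * eval_pp x n"
proof -
  let ?S = "keys m \<union> keys n"
  have "eval_pp x (m + n) = (\<Prod>v\<in>?S. x v ^ lookup (m + n) v)"
    by (rule eval_pp_superset) (auto simp: keys_add)
  also have "\<dots> = (\<Prod>v\<in>?S. x v ^ lookup m v) * (\<Prod>v\<in>?S. x v ^ lookup n v)"
    by (simp add: lookup_add power_add prod.distrib)
  also have "\<dots> = eval_pp x m * eval_pp x n"
    by (simp add: eval_pp_superset[of ?S])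
  finally show ?thesis .
qed

lemma eval_at_add: "eval_at x (p + q) = eval_at x p + eval_at x q"
  unfolding eval_at_def by (rule msum_add) (auto simp: distrib_right)

lemma eval_at_mult: "eval_at x (p * q) = eval_at x p * eval_at x q"
  unfolding eval_at_def by (rule msum_mult) (auto simp: distrib_right eval_pp_add mult_ac)

lemma eval_at_single: "eval_at x (single m a) = a * eval_pp x m"
  by (simp add: eval_at_def msum_single)

lemma eval_at_const [simp]: "eval_at x (const c) = c"
  by (simp add: const_def eval_at_single eval_pp_def)

lemma eval_at_var [simp]: "eval_at x (var v) = x v"
  by (simp add: var_def eval_at_single eval_pp_def)

lemma eval_at_zero [simp]: "eval_at x 0 = 0"
  by (simp add: eval_at_def)

lemma eval_at_sum: "eval_at x (sum f S) = (\<Sum>i\<in>S. eval_at x (f i))"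
  by (induction S rule: infinite_finite_induct) (auto simp: eval_at_add)

lemma derivation_add: "derivation d \<Longrightarrow> d (a + b) = d a + d b"
  and derivation_mult: "derivation d \<Longrightarrow> d (a * b) = d a * b + a * d b"
  by (auto simp: derivation_def)

lemma derivation_zero: "derivation d \<Longrightarrow> d 0 = 0"
  using derivation_add[of d 0 0] by simp

lemma derivation_one: "derivation d \<Longrightarrow> d 1 = 0"
  using derivation_mult[of d 1 1] by simp

lemma derivation_power: "derivation d \<Longrightarrow> d (a ^ n) = of_nat n * a ^ (n - 1) * d a"
proof (induction n)
  case (Suc n)
  then show ?case
    by (cases n) (simp_all add: derivation_mult derivation_one algebra_simps)
qed (simp add: derivation_one)

lemma derivation_prod:
  assumes "derivation d" "finite S"
  shows "d (\<Prod>v\<in>S. g v) = (\<Sum>v\<in>S. d (g v) * (\<Prod>w\<in>S - {v}. g w))"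
  using assms(2)
proof induction
  case (insert x S)
  have "(\<Prod>w\<in>insert x S - {v}. g w) = g x * (\<Prod>w\<in>S - {v}. g w)" if "v \<in> S" for v
  proof -
    have "insert x S - {v} = insert x (S - {v})" using insert that by auto
    then show ?thesis using insert by simp
  qed
  then have "(\<Sum>v\<in>S. d (g v) * (\<Prod>w\<in>insert x S - {v}. g w)) =
      g x * (\<Sum>v\<in>S. d (g v) * (\<Prod>w\<in>S - {v}. g w))"
    by (simp add: sum_distrib_left mult_ac)
  moreover have "insert x S - {x} = S" using insert by auto
  ultimately show ?case using insert assms(1) by (simp add: derivation_mult)
qed (simp add: derivation_one[OF assms(1)])

lemma derivation_eval_pp:
  assumes "derivation d"
  shows "d (eval_pp x m) =
    (\<Sum>v\<in>keys m. of_nat (lookup m v) * eval_pp x (m - single v 1) * d (x v))"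
proof -
  have "eval_pp x (m - single v 1) = x v ^ (lookup m v - 1) * (\<Prod>w\<in>keys m - {v}. x w ^ lookup m w)"
    if v: "v \<in> keys m" for v
  proof -
    have "eval_pp x (m - single v 1) = (\<Prod>w\<in>keys m. x w ^ lookup (m - single v 1) w)"
      by (rule eval_pp_superset) (auto simp: in_keys_iff lookup_minus)
    also have "\<dots> = x v ^ (lookup m v - 1) * (\<Prod>w\<in>keys m - {v}. x w ^ lookup (m - single v 1) w)"
      using v by (simp add: prod.remove[of _ v] lookup_minus)
    also have "(\<Prod>w\<in>keys m - {v}. x w ^ lookup (m - single v 1) w) = (\<Prod>w\<in>keys m - {v}. x w ^ lookup m w)"
      by (rule prod.cong) (auto simp: lookup_minus lookup_single when_def)
    finally show ?thesis .
  qed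
  then show ?thesis
    unfolding eval_pp_def[of x m]
    by (subst derivation_prod[OF assms]) (auto intro!: sum.cong simp: derivation_power[OF assms] mult_ac)
qed

lemma dderiv_superset:
  assumes "finite V" "vars p \<subseteq> V"
  shows "dderiv \<delta> i p = Poly_Mapping.map (\<delta> i) p +
    (\<Sum>v\<in>V. partial_deriv v p * var (apply_op (single i 1) v))"
proof -
  have "(\<Sum>v\<in>vars p. partial_deriv v p * var (apply_op (single i 1) v)) =
      (\<Sum>v\<in>V. partial_deriv v p * var (apply_op (single i 1) v))"
    using assms by (intro sum.mono_neutral_left) (auto simp: partial_deriv_eq_0)
  then show ?thesis by (simp add: dderiv_def)
qed

lemma dderiv_add:
  fixes p q :: "('a, 'b, 'c::field) dpoly"
  assumes "derivation (\<delta> i)"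
  shows "dderiv \<delta> i (p + q) = dderiv \<delta> i p + dderiv \<delta> i q"
proof -
  let ?V = "vars p \<union> vars q"
  have "Poly_Mapping.map (\<delta> i) (p + q) = Poly_Mapping.map (\<delta> i) p + Poly_Mapping.map (\<delta> i) q"
  proof (rule poly_mapping_eqI)
    have "lookup (Poly_Mapping.map (\<delta> i) f) m = \<delta> i (lookup f m)" for f :: "('a, 'b, 'c) dpoly" and m
      using derivation_zero[OF assms] by (simp add: Poly_Mapping.map.rep_eq when_def)
    then show "lookup (Poly_Mapping.map (\<delta> i) (p + q)) m =
        lookup (Poly_Mapping.map (\<delta> i) p + Poly_Mapping.map (\<delta> i) q) m" for m
      by (simp add: lookup_add derivation_add[OF assms])
  qed
  then show ?thesis
    using vars_add[of p q]
    by (simp add: dderiv_superset[of ?V] partial_deriv_add distrib_right sum.distrib)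
qed

text \<open>A point whose coordinates are compatible with the derivations gives a differential
  homomorphism to \<open>k\<close>, so the polynomials vanishing there form a differential
  ideal.\<close>

lemma eval_at_dderiv:
  fixes x :: "('n, 'l) dvar \<Rightarrow> 'k::field"
  assumes d: "derivation (\<delta> i)" and x: "\<And>v. x (apply_op (single i 1) v) = \<delta> i (x v)"
  shows "eval_at x (dderiv \<delta> i p) = \<delta> i (eval_at x p)"
proof (induction p rule: mpoly_induct)
  case (single m a)
  have "dderiv \<delta> i (single m a) = single m (\<delta> i a) +
      (\<Sum>v\<in>keys m. partial_deriv v (single m a) * var (apply_op (single i 1) v))"
    using d vars_single_subset[of m a]
    by (subst dderiv_superset[of "keys m"]) (auto simp: map_single derivation_zero)
  then have "eval_at x (dderiv \<delta> i (single m a)) = \<delta> i a * eval_pp x m +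
      a * \<delta> i (eval_pp x m)"
    by (simp add: eval_at_add eval_at_sum eval_at_mult partial_deriv_single eval_at_single x[simplified]
        derivation_eval_pp[OF d] sum_distrib_left mult_ac)
  then show ?case by (simp add: eval_at_single derivation_mult[OF d])
next
  case (add p q)
  then show ?case by (simp add: dderiv_add[of \<delta> i, OF d] eval_at_add derivation_add[OF d])
qed

text \<open>The action on \<open>k\<close> of the operator with exponents \<open>\<theta>\<close>.
  The list fixes the order of application, which is immaterial when the \<open>\<delta> i\<close>
  commute.\<close>

definition iterate_op :: "('n \<Rightarrow> 'k \<Rightarrow> 'k) \<Rightarrow> 'n list \<Rightarrow> 'n deriv_op \<Rightarrow> 'k \<Rightarrow> 'k" where
  "iterate_op \<delta> is \<theta> c = foldr (\<lambda>i a. (\<delta> i ^^ lookup \<theta> i) a) is c"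

lemma iterate_op_add:
  assumes comm: "\<And>i j a. \<delta> i (\<delta> j a) = \<delta> j (\<delta> i a)" and "distinct is" "i \<in> set is"
  shows "iterate_op \<delta> is (single i 1 + \<theta>) c = \<delta> i (iterate_op \<delta> is \<theta> c)"
  using assms(2,3)
proof (induction "is")
  case (Cons j js)
  have comm_pow: "(\<delta> j ^^ n) (\<delta> i a) = \<delta> i ((\<delta> j ^^ n) a)" for n a
    by (induction n) (auto simp: comm)
  show ?case
  proof (cases "i = j")
    case True
    have "iterate_op \<delta> js (single i 1 + \<theta>) c = iterate_op \<delta> js \<theta> c"
      unfolding iterate_op_def using Cons.prems True
      by (intro foldr_cong) (auto simp: lookup_add lookup_single when_def)
    then show ?thesis using True by (simp add: iterate_op_def lookup_add)
  next
    case False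
    then show ?thesis
      using Cons comm_pow by (simp add: iterate_op_def lookup_add lookup_single when_def)
  qed
qed simp

context differential_ranking
begin

text \<open>Every system \<open>a\<^sub>j y\<^sub>j + b\<^sub>j = 0\<close> with constants \<open>a\<^sub>j \<noteq> 0\<close> has a solution in \<open>k\<close>,
  at which all elements of the differential ideal that it generates vanish.\<close>

lemma one_notin_characterized:
  fixes A I :: "('n, 'l, 'k::field) dpoly set"
  assumes k: "differential_field \<delta>" and A: "characterizes \<delta> le A I"
  shows "1 \<notin> I"
proof
  assume "1 \<in> I"
  have I: "ideal_of UNIV I" and char: "characteristic_set le I A" and auto: "autoreduced le A"
    and sat: "I = saturation UNIV (diff_ideal \<delta> hull A) (init_sep_prod le A)"
    using A by (auto simp: characterizes_def diff_ideal_def characteristic_set_def)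
  have UNIV: "p \<in> I" for p using ideal_of_mult[OF I, of p 1] \<open>1 \<in> I\<close> by simp
  \<comment> \<open>As a nonconstant element of \<open>I\<close>, the indeterminate
    \<open>var (0, j)\<close> is not reduced with respect to some \<open>f\<close> in
    \<open>A\<close>. It has degree one and is no proper derivative, which leaves only this
    possibility for the rank of \<open>f\<close>.\<close>
  have ex: "\<exists>f\<in>A. leader le f = (0, j) \<and> deg_in (0, j) f = 1" for j
  proof -
    let ?y = "var (0, j) :: ('n, 'l, 'k) dpoly"
    obtain f where f: "f \<in> A" "\<not> reduced_wrt le ?y f"
      using characteristic_set_reduced_const[OF char UNIV, of ?y] by auto
    have vf: "vars f \<noteq> {}" using auto f by (auto simp: autoreduced_def)
    have "apply_op \<theta> (leader le f) \<noteq> (0, j)" if "\<theta> \<noteq> 0" for \<theta>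
    proof
      assume "apply_op \<theta> (leader le f) = (0, j)"
      then have "\<theta> + fst (leader le f) = 0" by (simp add: apply_op_def)
      then have "lookup \<theta> i + lookup (fst (leader le f)) i = 0" for i
        by (metis lookup_add lookup_zero)
      then have "\<theta> = 0" by (intro poly_mapping_eqI) simp
      then show False using that by simp
    qed
    then have "deg_in (leader le f) f \<le> deg_in (leader le f) ?y"
      using f by (auto simp: reduced_wrt_def)
    moreover have "deg_in v ?y = (if v = (0, j) then 1 else 0)" for v
      by (auto simp: deg_in_def var_def lookup_single when_def)
    ultimately show ?thesis using deg_in_leader[OF vf] f(1) by (auto split: if_splits)
  qed
  define g where "g j = (SOME f. f \<in> A \<and> leader le f = (0, j) \<and> deg_in (0, j) f = 1)" for j
  have g: "g j \<in> A" "leader le (g j) = (0, j)" "deg_in (0, j) (g j) = 1" for j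
    using someI_ex[OF ex[of j, unfolded Bex_def]] unfolding g_def by auto
  \<comment> \<open>All indeterminates are leaders, so a variable with a nontrivial operator is a
    proper derivative of a leader and cannot occur in an autoreduced set.\<close>
  have base: "fst v = 0" if "f \<in> A" "v \<in> vars f" for f v
  proof (rule ccontr)
    assume "fst v \<noteq> 0"
    moreover have "v = apply_op (fst v) (0, snd v)" by (simp add: apply_op_def)
    ultimately have "v \<in> proper_derivatives (leader le ` A)"
      using g[of "snd v"] unfolding proper_derivatives_def by (metis (mono_tags, lifting) imageI mem_Collect_eq)
    then show False using autoreduced_partially_reduced[OF auto that(1)] that(2) by (auto simp: polys_in_iff)
  qed
  have Ag: "A \<subseteq> range g"
  proof
    fix f assume f: "f \<in> A"
    then have "leader le f \<in> vars f" using auto by (intro leader_in_vars) (auto simp: autoreduced_def)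
    then have "leader le f = (0, snd (leader le f))" using base[OF f] by (simp add: prod_eq_iff)
    then have "leader le f = leader le (g (snd (leader le f)))" using g by simp
    then have "f = g (snd (leader le f))"
      using inj_onD[OF autoreduced_inj_on_leader[OF auto] _ f g(1)] by blast
    then show "f \<in> range g" by blast
  qed
  have vg: "vars (g j) \<subseteq> {(0, j)}" for j
  proof
    fix v assume v: "v \<in> vars (g j)"
    then have v0: "v = (0, snd v)" using base[OF g(1)] by (simp add: prod_eq_iff)
    show "v \<in> {(0, j)}"
    proof (rule ccontr)
      assume "v \<notin> {(0, j)}"
      then have "g j \<noteq> g (snd v)" using g(2)[of j] g(2)[of "snd v"] v0 by auto
      then have "reduced_wrt le (g j) (g (snd v))" using auto g by (auto simp: autoreduced_def)
      then have "deg_in v (g j) = 0" using g[of "snd v"] v0 by (simp add: reduced_wrt_def)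
      then show False using v by (simp add: deg_in_eq_0_iff)
    qed
  qed
  have "\<exists>a b. a \<noteq> 0 \<and> g j = const b + const a * var (0, j) \<and> init le (g j) = const a \<and>
      separant le (g j) = const a" for j
  proof -
    let ?v = "(0, j) :: ('n, 'l) dvar"
    have "vars (coeff_in ?v d (g j)) = {}" for d using vars_coeff_in[of ?v d] vg[of j] by blast
    then have "\<forall>d. \<exists>c. coeff_in ?v d (g j) = const c"
      by (simp flip: vars_empty_iff)
    from choice[OF this] obtain c where c: "\<And>d. coeff_in ?v d (g j) = const (c d)" by blast
    have "univ ?v (g j) = [:const (c 0), const (c 1):]"
    proof (rule poly_eqI)
      fix n
      consider "n = 0" | "n = 1" | k where "n = Suc (Suc k)"
        by (metis One_nat_def not0_implies_Suc)
      then show "Polynomial.coeff (univ ?v (g j)) n = Polynomial.coeff [:const (c 0), const (c 1):] n"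
      proof cases
        case 3
        then have "Polynomial.coeff (univ ?v (g j)) n = 0"
          using g(3)[of j] by (intro coeff_eq_0) (simp add: degree_univ)
        then show ?thesis using 3 by simp
      qed (simp_all add: coeff_univ c)
    qed
    then have gj: "g j = const (c 0) + const (c 1) * var ?v"
      using poly_univ[of ?v "g j"] by (simp add: mult.commute)
    have "g j \<noteq> 0" using g(3)[of j] deg_in_eq_0_iff[of ?v "g j"] by auto
    then have "const (c 1) \<noteq> (0 :: ('n, 'l, 'k) dpoly)"
      using coeff_in_deg_in_neq_0[of "g j" ?v] g(3) c by metis
    moreover have "init le (g j) = const (c 1)" using g c by (simp add: init_def)
    moreover have "separant le (g j) = const (c 1)"
      unfolding separant_def g(2) by (subst gj) (simp add: partial_deriv_add partial_deriv_mult partial_deriv_eq_0)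
    ultimately show ?thesis using gj by auto
  qed
  then obtain a b where ab: "\<And>j. a j \<noteq> 0" "\<And>j. g j = const (b j) + const (a j) * var (0, j)"
    "\<And>j. init le (g j) = const (a j)" "\<And>j. separant le (g j) = const (a j)"
    by metis
  have "\<exists>c. c \<noteq> 0 \<and> init_sep_prod le A = const c"
  proof -
    have "\<exists>c. c \<noteq> 0 \<and> (\<Prod>f\<in>B. init le f * separant le f) = const c" if "finite B" "B \<subseteq> A" for B
      using that
    proof induction
      case empty
      show ?case by (intro exI[of _ 1]) simp
    next
      case (insert f B)
      then obtain c where "c \<noteq> 0" "(\<Prod>f\<in>B. init le f * separant le f) = const c" by auto
      moreover obtain j where "f = g j" using Ag insert by auto
      ultimately show ?case
        using insert ab by (intro exI[of _ "a j * a j * c"]) (auto simp: const_mult)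
    qed
    then show ?thesis using finite_autoreduced[OF auto] by (auto simp: init_sep_prod_def)
  qed
  then obtain c where c: "c \<noteq> 0" "init_sep_prod le A = const c" by auto
  \<comment> \<open>The common zero \<open>- b j / a j\<close> of the equations, together with all
    its derivatives in \<open>k\<close>.\<close>
  define x where "x v = iterate_op \<delta> (sorted_list_of_set UNIV) (fst v) (- b (snd v) / a (snd v))" for v
  have deriv: "derivation (\<delta> i)" and comm: "\<delta> i (\<delta> j t) = \<delta> j (\<delta> i t)" for i j t
    using k by (auto simp: differential_field_def)
  have x: "x (apply_op (single i 1) v) = \<delta> i (x v)" for i v
    unfolding x_def apply_op_def using iterate_op_add[of \<delta>, OF comm] by simp
  define Z where "Z = {p. eval_at x p = 0}"
  have "diff_ideal \<delta> Z"
    by (auto simp: diff_ideal_def ideal_of_def Z_def eval_at_add eval_at_mult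
        eval_at_dderiv[of \<delta> _ x, OF deriv x] derivation_zero[OF deriv])
  moreover have "g j \<in> Z" for j
  proof -
    have "foldr (\<lambda>i a. a) is t = t" for "is" :: "'n list" and t :: 'k by (induction "is") auto
    then have "x (0, j) = - b j / a j" by (simp add: x_def iterate_op_def)
    then show ?thesis using ab by (simp add: Z_def eval_at_add eval_at_mult)
  qed
  ultimately have "diff_ideal \<delta> hull A \<subseteq> Z" using Ag by (intro hull_minimal) auto
  moreover obtain m where "init_sep_prod le A ^ m * 1 \<in> diff_ideal \<delta> hull A"
    using \<open>1 \<in> I\<close> sat by (auto simp: saturation_def)
  \<comment> \<open>The product of initials and separants is the nonzero constant \<open>c\<close>,
    which cannot vanish at a point.\<close>
  ultimately have "eval_at x (const c ^ m) = 0" using c by (auto simp: Z_def)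
  moreover have "eval_at x (const c ^ m) = c ^ m"
    by (induction m) (use eval_at_const[of x 1] in \<open>auto simp: eval_at_mult\<close>)
  ultimately show False using c by simp
qed

end

section \<open>Regular elements and inversion of initials modulo the ideal\<close>

section \<open>Regular elements modulo a characterizable ideal\<close>

locale characterized_ideal = differential_ranking le
  for le :: "('n::{finite,linorder}, 'l::{finite,linorder}) dvar \<Rightarrow> ('n, 'l) dvar \<Rightarrow> bool" +
  fixes \<delta> :: "'n \<Rightarrow> 'k::field \<Rightarrow> 'k" and A I :: "('n, 'l, 'k) dpoly set"
  assumes differential_field: "differential_field \<delta>" and characterizes: "characterizes \<delta> le A I"
begin

abbreviation "leaders \<equiv> leader le ` A"

abbreviation "nonleaders \<equiv> - derivatives leaders"

abbreviation "pr_vars \<equiv> nonleaders \<union> leaders"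

lemma diff_ideal_I: "diff_ideal \<delta> I"
  and characteristic_set_A: "characteristic_set le I A"
  and I_eq: "I = saturation UNIV (diff_ideal \<delta> hull A) (init_sep_prod le A)"
  using characterizes unfolding characterizes_def by blast+

lemma ideal_I: "ideal_of UNIV I"
  using diff_ideal_I by (simp add: diff_ideal_def)

lemma A_subset_I: "A \<subseteq> I"
  and autoreduced_A: "autoreduced le A"
  using characteristic_set_A by (auto simp: characteristic_set_def)

lemma finite_A: "finite A"
  by (rule finite_autoreduced[OF autoreduced_A])

lemma A_vars: "f \<in> A \<Longrightarrow> vars f \<noteq> {}"
  using autoreduced_A by (auto simp: autoreduced_def)

lemma ideal_I': "ideal_of (polys_in UNIV) I"
  using ideal_I by (simp add: polys_in_UNIV)

lemmas I_add = ideal_of_add[OF ideal_I]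
  and I_diff = ideal_of_diff[OF ideal_I']
  and I_zero = ideal_of_zero[OF ideal_I]

lemma I_mult: "p \<in> I \<Longrightarrow> r * p \<in> I"
  using ideal_of_mult[OF ideal_I] by simp

lemma one_notin_I: "1 \<notin> I"
  using one_notin_characterized[OF differential_field characterizes] .

text \<open>Minimality of \<open>A\<close> makes \<open>p\<close> constant; a nonzero constant is a
  unit and would make \<open>I\<close> the whole ring.\<close>

lemma reduced_eq_zero:
  assumes "p \<in> I" "\<And>f. f \<in> A \<Longrightarrow> reduced_wrt le p f"
  shows "p = 0"
proof (rule ccontr)
  assume "p \<noteq> 0"
  have "vars p = {}" by (rule characteristic_set_reduced_const[OF characteristic_set_A assms])
  then obtain c where c: "p = const c" unfolding vars_empty_iff ..
  with \<open>p \<noteq> 0\<close> have "c \<noteq> 0" by auto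
  then have "const (inverse c) * p = 1" unfolding c by (simp flip: const_mult)
  then show False using I_mult[OF assms(1), of "const (inverse c)"] one_notin_I by simp
qed

text \<open>Nonzero divisors modulo \<open>I\<close>. They are closed under products and under
  passing to divisors, which is all that the reductions require of their multipliers.\<close>

definition regular :: "('n, 'l, 'k) dpoly \<Rightarrow> bool" where
  "regular s \<longleftrightarrow> (\<forall>x. s * x \<in> I \<longrightarrow> x \<in> I)"

lemma regularD: "regular s \<Longrightarrow> s * x \<in> I \<Longrightarrow> x \<in> I"
  by (auto simp: regular_def)

lemma regular_one: "regular 1"
  by (simp add: regular_def)

lemma regular_mult: "regular s \<Longrightarrow> regular t \<Longrightarrow> regular (s * t)"
  unfolding regular_def mult.assoc by blast

lemma regular_power: "regular s \<Longrightarrow> regular (s ^ n)"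
  by (induction n) (auto intro: regular_one regular_mult)

lemma regular_prod: "(\<And>i. i \<in> S \<Longrightarrow> regular (f i)) \<Longrightarrow> regular (prod f S)"
  by (induction S rule: infinite_finite_induct) (auto intro: regular_one regular_mult)

lemma regular_dvd:
  assumes "s dvd t" "regular t" shows "regular s"
  unfolding regular_def
proof (intro allI impI)
  fix x assume "s * x \<in> I"
  obtain c where c: "t = s * c" using assms(1) ..
  have eq: "t * x = c * (s * x)" unfolding c by (simp only: mult_ac)
  have "t * x \<in> I" unfolding eq by (rule I_mult[OF \<open>s * x \<in> I\<close>])
  then show "x \<in> I" using assms(2) by (rule regularD[rotated])
qed

lemma in_I_iff: "x \<in> I \<longleftrightarrow> (\<exists>m. init_sep_prod le A ^ m * x \<in> diff_ideal \<delta> hull A)"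
  by (subst I_eq) (simp add: saturation_def)

lemma regular_init_sep_prod: "regular (init_sep_prod le A)"
  unfolding regular_def
proof (intro allI impI)
  fix x assume "init_sep_prod le A * x \<in> I"
  then obtain m where "init_sep_prod le A ^ m * (init_sep_prod le A * x) \<in> diff_ideal \<delta> hull A"
    unfolding in_I_iff ..
  then have "init_sep_prod le A ^ Suc m * x \<in> diff_ideal \<delta> hull A"
    by (simp only: power_Suc mult_ac)
  then show "x \<in> I" unfolding in_I_iff ..
qed

lemma dvd_init_sep_prod:
  assumes "finite B" "f \<in> B"
  shows "init le f dvd init_sep_prod le B" "separant le f dvd init_sep_prod le B"
proof -
  have "init le f * separant le f dvd init_sep_prod le B"
    unfolding init_sep_prod_def by (rule dvd_prodI[OF assms])
  then show "init le f dvd init_sep_prod le B" "separant le f dvd init_sep_prod le B"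
    by (rule dvd_mult_left, rule dvd_mult_right)
qed

lemma regular_init: "f \<in> A \<Longrightarrow> regular (init le f)"
  by (rule regular_dvd[OF dvd_init_sep_prod(1)[OF finite_A] regular_init_sep_prod])

lemma regular_separant: "f \<in> A \<Longrightarrow> regular (separant le f)"
  by (rule regular_dvd[OF dvd_init_sep_prod(2)[OF finite_A] regular_init_sep_prod])

lemma proper_derivatives_subset: "proper_derivatives L \<subseteq> derivatives L"
  by (auto simp: proper_derivatives_def derivatives_def)

lemma leaders_subset: "L \<subseteq> derivatives L"
proof
  fix u assume "u \<in> L"
  then show "u \<in> derivatives L"
    unfolding derivatives_def by (metis (mono_tags, lifting) apply_op_zero mem_Collect_eq)
qed

lemma derivatives_eq: "derivatives L = L \<union> proper_derivatives L"
proof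
  show "derivatives L \<subseteq> L \<union> proper_derivatives L"
  proof
    fix v assume "v \<in> derivatives L"
    then obtain \<theta> u where v: "v = apply_op \<theta> u" "u \<in> L" by (auto simp: derivatives_def)
    then show "v \<in> L \<union> proper_derivatives L"
      unfolding proper_derivatives_def by (cases "\<theta> = 0") (simp, blast)
  qed
qed (use proper_derivatives_subset leaders_subset in auto)

lemma leaders_not_proper: "leaders \<inter> proper_derivatives leaders = {}"
proof -
  have "u \<notin> proper_derivatives leaders" if "f \<in> A" "u = leader le f" for f u
    using autoreduced_partially_reduced[OF autoreduced_A that(1)] leader_in_vars[OF A_vars[OF that(1)]] that(2)
    by (auto simp: polys_in_iff)
  then show ?thesis by auto
qed

lemma nonleaders_leaders: "pr_vars = - proper_derivatives leaders"
  using leaders_not_proper unfolding derivatives_eq by blast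

lemma nonleaders_disjoint: "nonleaders \<inter> leaders = {}"
  using leaders_subset[of leaders] by blast

lemma reduced_wrt_A_iff:
  "(\<forall>f\<in>A. reduced_wrt le p f) \<longleftrightarrow>
    p \<in> polys_in pr_vars \<and> (\<forall>f\<in>A. deg_in (leader le f) p < deg_in (leader le f) f)"
  unfolding nonleaders_leaders reduced_wrt_def polys_in_iff proper_derivatives_def by blast

lemma A_in: "f \<in> A \<Longrightarrow> f \<in> polys_in pr_vars"
  unfolding nonleaders_leaders by (rule autoreduced_partially_reduced[OF autoreduced_A])

text \<open>The point is that multiplication by \<open>s\<close> preserves being reduced: no leader
  and no derivative of one occurs in \<open>s\<close>.\<close>

lemma regular_nonleaders:
  assumes "s \<in> polys_in nonleaders" "s \<noteq> 0"
  shows "regular s"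
  unfolding regular_def
proof (intro allI impI)
  fix x assume sx: "s * x \<in> I"
  obtain t r where t: "regular t" "t * x - r \<in> I" "\<forall>f\<in>A. reduced_wrt le r f"
    using differential_reduction[OF diff_ideal_I A_subset_I autoreduced_A, of "Collect regular" x]
      regular_one regular_mult regular_init regular_separant by auto
  have r: "r \<in> polys_in pr_vars" "\<forall>f\<in>A. deg_in (leader le f) r < deg_in (leader le f) f"
    using t(3) unfolding reduced_wrt_A_iff by blast+
  have eq: "s * r = t * (s * x) - s * (t * x - r)" by (simp add: algebra_simps)
  have "s * r \<in> I" unfolding eq using I_diff[OF I_mult[OF sx] I_mult[OF t(2)]] .
  moreover have "\<forall>f\<in>A. reduced_wrt le (s * r) f"
    unfolding reduced_wrt_A_iff
  proof (intro conjI ballI)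
    show "s * r \<in> polys_in pr_vars"
      using polys_in_mono[OF _ assms(1)] r(1) by (intro polys_in_mult) auto
    fix f assume f: "f \<in> A"
    then have "leader le f \<notin> vars s"
      using assms(1) nonleaders_disjoint unfolding polys_in_iff by blast
    then have "deg_in (leader le f) (s * r) \<le> deg_in (leader le f) r"
      using deg_in_mult_le[of "leader le f" s r] deg_in_eq_0_iff[of "leader le f" s] by simp
    then show "deg_in (leader le f) (s * r) < deg_in (leader le f) f" using r f by (meson le_less_trans)
  qed
  ultimately have "s * r = 0" by (intro reduced_eq_zero) auto
  then have "t * x \<in> I" using assms t by simp
  then show "x \<in> I" using t by (simp add: regularD)
qed

end

section \<open>Coefficients with respect to a set of variables\<close>

lemma lookup_restrict_pp: "lookup (restrict_pp V m) v = (if v \<in> V then lookup m v else 0)"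
proof -
  have "lookup (restrict_pp V m) v = (\<Sum>w\<in>keys m \<inter> V. if w = v then lookup m w else 0)"
    by (simp add: restrict_pp_def lookup_sum lookup_single when_def)
  also have "\<dots> = (if v \<in> keys m \<inter> V then lookup m v else 0)"
    by (simp add: sum.delta)
  finally show ?thesis by (auto simp: in_keys_iff)
qed

lemma keys_restrict_pp: "keys (restrict_pp V m) = keys m \<inter> V"
  by (auto simp: in_keys_iff lookup_restrict_pp split: if_splits)

lemma restrict_pp_decomp: "restrict_pp (- V) m + restrict_pp V m = m"
  by (rule poly_mapping_eqI) (simp add: lookup_add lookup_restrict_pp)

lemma restrict_pp_add: "restrict_pp V (m + n) = restrict_pp V m + restrict_pp V n"
  by (rule poly_mapping_eqI) (simp add: lookup_add lookup_restrict_pp)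

text \<open>The coefficient of the power product \<open>\<mu>\<close> when \<open>p\<close> is read
  as a polynomial in the variables \<open>X\<close> over the polynomials in the other
  variables.\<close>

definition pp_coeff :: "'v set \<Rightarrow> 'v power_product \<Rightarrow> ('v, 'a::comm_monoid_add) mpoly \<Rightarrow> ('v, 'a) mpoly" where
  "pp_coeff X \<mu> = msum (\<lambda>m a. if restrict_pp X m = \<mu> then single (restrict_pp (- X) m) a else 0)"

lemma pp_coeff_add: "pp_coeff X \<mu> (p + q) = pp_coeff X \<mu> p + pp_coeff X \<mu> q"
  unfolding pp_coeff_def by (rule msum_add) (auto simp: single_add)

lemma pp_coeff_single:
  "pp_coeff X \<mu> (single m a) = (if restrict_pp X m = \<mu> then single (restrict_pp (- X) m) a else 0)"
  by (simp add: pp_coeff_def msum_single)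

lemma vars_pp_coeff: "vars (pp_coeff X \<mu> p) \<subseteq> vars p - X"
proof -
  have "pp_coeff X \<mu> p \<in> polys_in (vars p - X)"
    unfolding pp_coeff_def msum_def
    by (rule polys_in_sum) (auto intro!: polys_in_single simp: keys_restrict_pp vars_def)
  then show ?thesis by (simp add: polys_in_iff)
qed

lemma pp_coeff_eq_0: "\<mu> \<notin> restrict_pp X ` keys p \<Longrightarrow> pp_coeff X \<mu> p = 0"
  unfolding pp_coeff_def msum_def by (rule sum.neutral) auto

lemma sum_pp_coeff:
  fixes p :: "('v, 'a::comm_semiring_1) mpoly"
  assumes "finite M" "restrict_pp X ` keys p \<subseteq> M"
  shows "(\<Sum>\<mu>\<in>M. pp_coeff X \<mu> p * single \<mu> 1) = p"
proof -
  have "(\<Sum>\<mu>\<in>M. pp_coeff X \<mu> p * single \<mu> 1) = (\<Sum>\<mu>\<in>M. \<Sum>m\<in>keys p.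
      if restrict_pp X m = \<mu> then single (restrict_pp (- X) m) (lookup p m) * single \<mu> 1 else 0)"
    by (auto simp: pp_coeff_def msum_def sum_distrib_right intro!: sum.cong)
  also have "\<dots> = (\<Sum>m\<in>keys p. \<Sum>\<mu>\<in>M.
      if restrict_pp X m = \<mu> then single (restrict_pp (- X) m) (lookup p m) * single \<mu> 1 else 0)"
    by (rule sum.swap)
  also have "\<dots> = (\<Sum>m\<in>keys p. single m (lookup p m))"
    using assms by (intro sum.cong refl) (auto simp: sum.delta' mult_single restrict_pp_decomp)
  finally show ?thesis by (simp add: sum_single_lookup)
qed

section \<open>Linear dependence over a subring of an integral domain\<close>

text \<open>Gaussian elimination with more rows \<open>J\<close> than columns \<open>M\<close>. Rows
  are combined by cross multiplication with the pivot instead of division, so the coefficients of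
  the relation stay in the subring \<open>D\<close>.\<close>

lemma exists_linear_dependence:
  fixes c :: "'i \<Rightarrow> 'm \<Rightarrow> 'a::idom"
  assumes "finite M" "finite J" "card M < card J"
    and D: "0 \<in> D" "1 \<in> D" "\<And>a b. a \<in> D \<Longrightarrow> b \<in> D \<Longrightarrow> a + b \<in> D"
      "\<And>a. a \<in> D \<Longrightarrow> - a \<in> D" "\<And>a b. a \<in> D \<Longrightarrow> b \<in> D \<Longrightarrow> a * b \<in> D"
    and "\<And>i \<mu>. i \<in> J \<Longrightarrow> \<mu> \<in> M \<Longrightarrow> c i \<mu> \<in> D"
  shows "\<exists>e. (\<forall>i\<in>J. e i \<in> D) \<and> (\<exists>i\<in>J. e i \<noteq> 0) \<and> (\<forall>\<mu>\<in>M. (\<Sum>i\<in>J. e i * c i \<mu>) = 0)"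
  using assms(1-3,9)
proof (induction arbitrary: J c)
  case empty
  then have "J \<noteq> {}" by auto
  then show ?case using D by (intro exI[of _ "\<lambda>_. 1"]) auto
next
  case (insert x M)
  show ?case
  proof (cases "\<forall>i\<in>J. c i x = 0")
    case True
    have "card M < card J" using insert by simp
    then obtain e where "\<forall>i\<in>J. e i \<in> D" "\<exists>i\<in>J. e i \<noteq> 0" "\<forall>\<mu>\<in>M. (\<Sum>i\<in>J. e i * c i \<mu>) = 0"
      using insert.IH[of J c] insert.prems by auto
    then show ?thesis using True by (intro exI[of _ e]) auto
  next
    case False
    then obtain j where j: "j \<in> J" "c j x \<noteq> 0" by auto
    define J' where "J' = J - {j}"
    define c' where "c' i \<mu> = c j x * c i \<mu> + - (c i x * c j \<mu>)" for i \<mu>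
    have "card M < card J'" "finite J'" using insert j by (auto simp: J'_def)
    moreover have "c' i \<mu> \<in> D" if "i \<in> J'" "\<mu> \<in> M" for i \<mu>
    proof -
      have "c i \<mu> \<in> D" "c i x \<in> D" "c j \<mu> \<in> D" "c j x \<in> D"
        using that j insert.prems(3) by (auto simp: J'_def)
      then show ?thesis unfolding c'_def by (intro D)
    qed
    ultimately obtain e' where e': "\<forall>i\<in>J'. e' i \<in> D" "\<exists>i\<in>J'. e' i \<noteq> 0"
      "\<forall>\<mu>\<in>M. (\<Sum>i\<in>J'. e' i * c' i \<mu>) = 0"
      using insert.IH[of J' c'] by auto
    \<comment> \<open>Expanding the relation between the reduced rows gives these coefficients; the
      one at the pivot row \<open>j\<close> collects all the multiples of that row.\<close>
    define e where "e i = (if i = j then - (\<Sum>i\<in>J'. e' i * c i x) else c j x * e' i)" for i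
    have sum: "(\<Sum>i\<in>J'. f i) \<in> D" if "\<And>i. i \<in> J' \<Longrightarrow> f i \<in> D" for f
      using that by (induction J' rule: infinite_finite_induct) (auto intro: D)
    show ?thesis
    proof (intro exI conjI ballI)
      show "e i \<in> D" if "i \<in> J" for i
      proof (cases "i = j")
        case True
        have "e' i * c i x \<in> D" if "i \<in> J'" for i
          using that e'(1) insert.prems(3) by (intro D) (auto simp: J'_def)
        then have "(\<Sum>i\<in>J'. e' i * c i x) \<in> D" by (rule sum)
        then show ?thesis using True D(4) by (simp add: e_def)
      next
        case False
        then show ?thesis using that j e'(1) insert.prems(3) by (auto simp: J'_def e_def intro: D)
      qed
      obtain i where "i \<in> J'" "e' i \<noteq> 0" using e'(2) by auto
      then show "\<exists>i\<in>J. e i \<noteq> 0" using j by (intro bexI[of _ i]) (auto simp: J'_def e_def)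
      fix \<mu> assume \<mu>: "\<mu> \<in> insert x M"
      have "(\<Sum>i\<in>J. e i * c i \<mu>) = e j * c j \<mu> + (\<Sum>i\<in>J'. e i * c i \<mu>)"
        unfolding J'_def using insert.prems j by (intro sum.remove) auto
      also have "(\<Sum>i\<in>J'. e i * c i \<mu>) = (\<Sum>i\<in>J'. c j x * e' i * c i \<mu>)"
        by (rule sum.cong) (auto simp: e_def J'_def)
      also have "e j * c j \<mu> = - (\<Sum>i\<in>J'. e' i * c i x * c j \<mu>)"
        by (simp add: e_def sum_distrib_right)
      also have "\<dots> + (\<Sum>i\<in>J'. c j x * e' i * c i \<mu>) = (\<Sum>i\<in>J'. e' i * c' i \<mu>)"
      proof -
        have "e' i * c' i \<mu> = c j x * e' i * c i \<mu> - e' i * c i x * c j \<mu>" for i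
          by (simp add: c'_def algebra_simps)
        then show ?thesis by (simp add: sum_subtractf)
      qed
      also have "\<dots> = 0"
      proof (cases "\<mu> = x")
        case True
        then show ?thesis by (simp add: c'_def)
      next
        case False
        then show ?thesis using \<mu> e'(3) by auto
      qed
      finally show "(\<Sum>i\<in>J. e i * c i \<mu>) = 0" .
    qed
  qed
qed

lemma finite_bounded_pp:
  assumes "finite X"
  shows "finite {m :: 'v power_product. keys m \<subseteq> X \<and> (\<forall>v\<in>X. lookup m v < d v)}"
  using assms
proof induction
  case empty
  have "{m :: 'v power_product. keys m \<subseteq> {} \<and> (\<forall>v\<in>{}. lookup m v < d v)} = {0}"
    by (simp only: subset_empty keys_eq_empty ball_empty simp_thms singleton_conv)
  then show ?case by (simp only: finite.intros)
next
  case (insert x X)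
  let ?M = "\<lambda>X. {m :: 'v power_product. keys m \<subseteq> X \<and> (\<forall>v\<in>X. lookup m v < d v)}"
  have "?M (insert x X) \<subseteq> (\<lambda>(m, k). m + single x k) ` (?M X \<times> {..<d x})"
  proof
    fix m assume m: "m \<in> ?M (insert x X)"
    have eq: "restrict_pp X m + single x (lookup m x) = m"
    proof (rule poly_mapping_eqI)
      fix v
      have "lookup m v = 0" if "v \<notin> insert x X"
      proof -
        have "v \<notin> keys m" using m that by auto
        then show ?thesis by (simp add: not_in_keys_iff_lookup_eq_zero)
      qed
      then show "lookup (restrict_pp X m + single x (lookup m x)) v = lookup m v"
        using insert.hyps(2) by (auto simp: lookup_add lookup_restrict_pp lookup_single when_def)
    qed
    have mem: "(restrict_pp X m, lookup m x) \<in> ?M X \<times> {..<d x}"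
      using m by (auto simp: keys_restrict_pp lookup_restrict_pp)
    show "m \<in> (\<lambda>(m, k). m + single x k) ` (?M X \<times> {..<d x})"
      by (rule image_eqI[OF _ mem]) (simp only: prod.case eq)
  qed
  moreover have "finite ((\<lambda>(m, k). m + single x k) ` (?M X \<times> {..<d x}))"
    using insert.IH by simp
  ultimately show ?case by (rule finite_subset)
qed

lemma coeff_in_above:
  assumes "deg_in v p < i" shows "coeff_in v i p = 0"
  unfolding coeff_in_eq_0_iff
proof
  fix m assume "m \<in> keys p"
  then have "lookup m v \<le> deg_in v p" by (rule lookup_le_deg_in)
  then show "lookup m v \<noteq> i" using assms by simp
qed

section \<open>Elements of the ideal with initials free of leaders\<close>

lemma (in variable_order') monic_like:
  fixes s t :: "('v, 'a::idom) mpoly"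
  assumes "s \<noteq> 0" "s \<in> polys_in {v. lt v u}" "t \<in> polys_in {v. le v u}" "0 < d" "deg_in u t < d"
  shows "leader le (s * var u ^ d + t) = u" "deg_in u (s * var u ^ d + t) = d"
    "init le (s * var u ^ d + t) = s"
proof -
  let ?p = "s * var u ^ d + t"
  have "u \<notin> vars s" using assms(2) by (auto simp: polys_in_iff)
  then have univ: "univ u ?p = [:s:] * Polynomial.monom 1 d + univ u t"
    by (simp add: univ_add univ_mult univ_not_in_vars univ_var_power)
  have c: "coeff_in u i ?p = (if i = d then s else coeff_in u i t)" if "i \<ge> d" for i
  proof -
    have "coeff_in u d t = 0" using assms(5) by (rule coeff_in_above)
    then show ?thesis using univ by (simp add: coeff_univ[symmetric] smult_monom)
  qed
  show deg: "deg_in u ?p = d"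
  proof (rule order.antisym)
    have "coeff_in u d ?p \<noteq> 0" using c[of d] assms(1) by simp
    then show "d \<le> deg_in u ?p" by (metis coeff_univ degree_univ le_degree)
    have "Polynomial.degree (univ u ?p) \<le> d"
      unfolding univ using assms(5) by (intro degree_add_le) (auto simp: smult_monom degree_monom_le degree_univ)
    then show "deg_in u ?p \<le> d" by (simp add: degree_univ)
  qed
  then have "u \<in> vars ?p" using assms(4) deg_in_eq_0_iff[of u ?p] by simp
  moreover have "?p \<in> polys_in {v. le v u}"
    using assms(2,3) by (intro polys_in_add polys_in_mult polys_in_power polys_in_var)
      (auto simp: polys_in_iff lt_def)
  ultimately show leader: "leader le ?p = u"
    by (intro leader_eqI) (auto simp: polys_in_iff)
  show "init le ?p = s" unfolding init_def leader deg using c[of d] by simp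
qed

context characterized_ideal
begin

definition elt :: "('n, 'l) dvar \<Rightarrow> ('n, 'l, 'k) dpoly" where
  "elt = inv_into A (leader le)"

lemma elt_in_A: "u \<in> leaders \<Longrightarrow> elt u \<in> A"
  and leader_elt: "u \<in> leaders \<Longrightarrow> leader le (elt u) = u"
  by (simp_all add: elt_def inv_into_into f_inv_into_f)

lemma elt_leader: "f \<in> A \<Longrightarrow> elt (leader le f) = f"
  unfolding elt_def by (rule inv_into_f_f[OF autoreduced_inj_on_leader[OF autoreduced_A]])

definition ldeg :: "('n, 'l) dvar \<Rightarrow> nat" where
  "ldeg u = deg_in u (elt u)"

lemma ldeg_leader: "f \<in> A \<Longrightarrow> ldeg (leader le f) = deg_in (leader le f) f"
  by (simp add: ldeg_def elt_leader)

lemma ldeg_pos: "u \<in> leaders \<Longrightarrow> 0 < ldeg u"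
  using deg_in_leader[OF A_vars[OF elt_in_A]] by (simp add: ldeg_def leader_elt)

text \<open>Stated through the leaders and their degrees only, so that it applies to the canonical
  set as well, which shares both.\<close>

definition reduced :: "('n, 'l, 'k) dpoly \<Rightarrow> bool" where
  "reduced p \<longleftrightarrow> p \<in> polys_in pr_vars \<and> (\<forall>u\<in>leaders. deg_in u p < ldeg u)"

lemma reduced_iff: "reduced p \<longleftrightarrow> (\<forall>f\<in>A. reduced_wrt le p f)"
  unfolding reduced_wrt_A_iff reduced_def using ldeg_leader by auto

lemma reduced_in_I: "reduced p \<Longrightarrow> p \<in> I \<Longrightarrow> p = 0"
  unfolding reduced_iff using reduced_eq_zero by blast

text \<open>The three bounded sets of variables ensure that what is constructed for the leader
  \<open>u\<close> cannot contain a variable ranked above \<open>u\<close>.\<close>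

definition below :: "('n, 'l) dvar \<Rightarrow> ('n, 'l) dvar set" where
  "below u = {v \<in> pr_vars. lt v u}"

definition weakly_below :: "('n, 'l) dvar \<Rightarrow> ('n, 'l) dvar set" where
  "weakly_below u = {v \<in> pr_vars. le v u}"

definition nbelow :: "('n, 'l) dvar \<Rightarrow> ('n, 'l) dvar set" where
  "nbelow u = {v \<in> nonleaders. lt v u}"

text \<open>Dividing \<open>s * var u ^ ldeg u + t\<close> by \<open>s\<close> gives a monic
  polynomial over \<open>k(N)\<close> with reduced tail. Restricting \<open>s\<close> to
  \<open>nbelow u\<close> makes \<open>s\<close> the initial and \<open>u\<close> the
  leader.\<close>

definition monic_over :: "('n, 'l) dvar \<Rightarrow> ('n, 'l, 'k) dpoly \<Rightarrow> ('n, 'l, 'k) dpoly \<Rightarrow> bool" where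
  "monic_over u s t \<longleftrightarrow> s \<in> polys_in (nbelow u) - {0} \<and> t \<in> polys_in (weakly_below u) \<and> reduced t \<and>
     s * var u ^ ldeg u + t \<in> I"

lemma monic_over_shape:
  fixes s t :: "('n, 'l, 'k) dpoly"
  assumes "u \<in> leaders" "s \<in> polys_in (nbelow u) - {0}" "t \<in> polys_in (weakly_below u)" "deg_in u t < ldeg u"
  shows "leader le (s * var u ^ ldeg u + t) = u" "deg_in u (s * var u ^ ldeg u + t) = ldeg u"
    "init le (s * var u ^ ldeg u + t) = s" "s * var u ^ ldeg u + t \<in> polys_in (weakly_below u)"
proof -
  have s: "s \<noteq> 0" "s \<in> polys_in {v. lt v u}" and t: "t \<in> polys_in {v. le v u}"
    using assms by (auto simp: nbelow_def weakly_below_def polys_in_iff)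
  show "leader le (s * var u ^ ldeg u + t) = u" "deg_in u (s * var u ^ ldeg u + t) = ldeg u"
    "init le (s * var u ^ ldeg u + t) = s"
    using monic_like[OF s t ldeg_pos[OF assms(1)] assms(4)] by auto
  have "nbelow u \<subseteq> weakly_below u" "u \<in> weakly_below u"
    using assms(1) by (auto simp: nbelow_def weakly_below_def lt_def)
  then show "s * var u ^ ldeg u + t \<in> polys_in (weakly_below u)"
    using assms(2,3) polys_in_mono[of "nbelow u" "weakly_below u" s]
    by (intro polys_in_add polys_in_mult polys_in_power polys_in_var) auto
qed

text \<open>Reduction by polynomials whose initials are free of leaders: the multiplier
  \<open>a\<close> is then a nonzero element of \<open>k[N]\<close> in variables below
  \<open>u\<close>, whereas reduction by \<open>A\<close> would multiply by arbitrary
  initials.\<close>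

lemma monic_reduction:
  fixes p :: "('n, 'l, 'k) dpoly" and s t :: "('n, 'l) dvar \<Rightarrow> ('n, 'l, 'k) dpoly"
  assumes W: "W \<subseteq> leaders" and V: "V \<subseteq> pr_vars" "nbelow u \<subseteq> V"
    and WV: "\<And>w. w \<in> W \<Longrightarrow> weakly_below w \<subseteq> V \<and> s w \<in> polys_in (nbelow w) - {0} \<and> nbelow w \<subseteq> nbelow u \<and>
      t w \<in> polys_in (weakly_below w) \<and> deg_in w (t w) < ldeg w \<and> s w * var w ^ ldeg w + t w \<in> I"
    and p: "p \<in> polys_in V"
  shows "\<exists>a\<in>polys_in (nbelow u) - {0}. \<exists>r\<in>polys_in V. a * p - r \<in> I \<and> (\<forall>w\<in>W. deg_in w r < ldeg w)"
proof -
  define P where "P w = s w * var w ^ ldeg w + t w" for w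
  have P: "leader le (P w) = w" "deg_in w (P w) = ldeg w" "init le (P w) = s w"
    "P w \<in> polys_in (weakly_below w)" if "w \<in> W" for w
  proof -
    have "w \<in> leaders" "s w \<in> polys_in (nbelow w) - {0}" "t w \<in> polys_in (weakly_below w)"
      "deg_in w (t w) < ldeg w"
      using WV[OF that] W that by blast+
    from monic_over_shape[OF this] show "leader le (P w) = w" "deg_in w (P w) = ldeg w"
      "init le (P w) = s w" "P w \<in> polys_in (weakly_below w)"
      unfolding P_def .
  qed
  let ?S = "polys_in (nbelow u) - {0 :: ('n, 'l, 'k) dpoly}"
  have "\<exists>a\<in>?S. \<exists>r\<in>polys_in V. a * p - r \<in> polys_in V \<inter> I \<and>
      (\<forall>f\<in>P ` W. deg_in (leader le f) r < deg_in (leader le f) f) \<and>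
      (\<forall>w. (\<forall>f\<in>P ` W. w \<notin> vars f) \<longrightarrow> deg_in w r \<le> deg_in w p)"
  proof (rule pseudo_reduction)
    show "finite (P ` W)" using W finite_A finite_subset by blast
    show "inj_on (leader le) (P ` W)" using P(1) by (auto simp: inj_on_def)
    show "vars f \<noteq> {}" if "f \<in> P ` W" for f
    proof -
      obtain w where w: "w \<in> W" "f = P w" using \<open>f \<in> P ` W\<close> by blast
      then have "0 < deg_in w f" using P(2)[OF w(1)] ldeg_pos[of w] W by auto
      then show ?thesis using deg_in_eq_0_iff[of w f] by auto
    qed
    show "ideal_of (polys_in V) (polys_in V \<inter> I)" by (rule ideal_of_UNIV_restrict[OF ideal_I])
    have "P w \<in> polys_in V \<inter> I" if "w \<in> W" for w
      using P(4)[OF that] WV[OF that] polys_in_mono unfolding P_def by blast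
    then show "P ` W \<subseteq> polys_in V \<inter> I" by blast
    show "?S \<subseteq> polys_in V" using polys_in_mono[OF V(2)] by blast
    show "1 \<in> ?S" by simp
    show "a * b \<in> ?S" if "a \<in> ?S" "b \<in> ?S" for a b using that by (auto intro: polys_in_mult)
    have "s w \<in> ?S" if "w \<in> W" for w using WV[OF that] polys_in_mono[of "nbelow w" "nbelow u"] by blast
    then show "init le f \<in> ?S" if "f \<in> P ` W" for f using that P(3) by auto
  qed (rule p)
  then obtain a r where ar: "a \<in> ?S" "r \<in> polys_in V" "a * p - r \<in> I"
    "\<forall>f\<in>P ` W. deg_in (leader le f) r < deg_in (leader le f) f"
    by blast
  have "deg_in w r < ldeg w" if "w \<in> W" for w
    using bspec[OF ar(4) imageI[OF that]] P[OF that] by simp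
  then show ?thesis using ar(1-3) by blast
qed

text \<open>By the induction hypothesis, each power of the initial has, up to a factor in
  \<open>k[N]\<close>, a remainder in the span of the finite set \<open>M\<close> of monomials that
  are reduced at the lower leaders. One power more than \<open>card M\<close> forces a relation. Its
  lowest power of the initial is cancelled by regularity, and the term without the initial that
  remains is the required \<open>s\<close>.\<close>

lemma exists_inverse_of_init:
  assumes f: "f \<in> A" and IH: "\<And>w. w \<in> leaders \<Longrightarrow> lt w (leader le f) \<Longrightarrow> \<exists>s t. monic_over w s t"
  shows "\<exists>s\<in>polys_in (nbelow (leader le f)) - {0}. \<exists>q\<in>polys_in (below (leader le f)).
    s + q * init le f \<in> I"
proof -
  let ?u = "leader le f" and ?h = "init le f"
  let ?N = "polys_in (nbelow ?u) :: ('n, 'l, 'k) dpoly set"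
  define W where "W = {w \<in> leaders. lt w ?u}"
  have "\<forall>w\<in>W. \<exists>s t. monic_over w s t" using IH by (auto simp: W_def)
  then obtain s t where st: "\<And>w. w \<in> W \<Longrightarrow> monic_over w (s w) (t w)" by metis
  have hV: "?h \<in> polys_in (below ?u)"
    using A_in[OF f] vars_init[of f] vars_init_lt[of _ f] unfolding polys_in_iff below_def by blast
  have NV: "nbelow ?u \<subseteq> below ?u" by (auto simp: nbelow_def below_def)
  have red: "\<exists>a\<in>?N - {0}. \<exists>r\<in>polys_in (below ?u). a * p - r \<in> I \<and> (\<forall>w\<in>W. deg_in w r < ldeg w)"
    if "p \<in> polys_in (below ?u)" for p
  proof (rule monic_reduction[OF _ _ NV _ that])
    fix w assume w: "w \<in> W"
    then have "lt w ?u" "w \<in> leaders" by (auto simp: W_def)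
    then show "weakly_below w \<subseteq> below ?u \<and> s w \<in> polys_in (nbelow w) - {0} \<and> nbelow w \<subseteq> nbelow ?u \<and>
      t w \<in> polys_in (weakly_below w) \<and> deg_in w (t w) < ldeg w \<and> s w * var w ^ ldeg w + t w \<in> I"
      using st[OF w] le_lt_trans lt_trans unfolding monic_over_def reduced_def weakly_below_def below_def nbelow_def
      by blast
  qed (auto simp: W_def below_def)
  have "\<forall>i. \<exists>a r. a \<in> ?N - {0} \<and> r \<in> polys_in (below ?u) \<and> a * ?h ^ i - r \<in> I \<and>
      (\<forall>w\<in>W. deg_in w r < ldeg w)"
    using red[OF polys_in_power[OF hV]] by blast
  then obtain a r where ar: "\<And>i. a i \<in> ?N - {0}" "\<And>i. r i \<in> polys_in (below ?u)"
    "\<And>i. a i * ?h ^ i - r i \<in> I" "\<And>i w. w \<in> W \<Longrightarrow> deg_in w (r i) < ldeg w"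
    by metis
  define M where "M = {m :: ('n, 'l) dvar power_product. keys m \<subseteq> W \<and> (\<forall>w\<in>W. lookup m w < ldeg w)}"
  have W: "finite W" using finite_A by (simp add: W_def)
  have M: "finite M" unfolding M_def by (rule finite_bounded_pp[OF W])
  have restr: "restrict_pp W ` keys (r i) \<subseteq> M" for i
  proof -
    have "lookup m w < ldeg w" if "m \<in> keys (r i)" "w \<in> W" for m w
      using lookup_le_deg_in[OF that(1), of w] ar(4)[OF that(2), of i] by linarith
    then show ?thesis by (auto simp: M_def keys_restrict_pp lookup_restrict_pp)
  qed
  have cN: "pp_coeff W \<mu> (r i) \<in> ?N" for i \<mu>
  proof -
    have "below ?u - W \<subseteq> nbelow ?u" by (auto simp: below_def W_def nbelow_def)
    then show ?thesis using vars_pp_coeff[of W \<mu> "r i"] ar(2)[of i] unfolding polys_in_iff by blast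
  qed
  \<comment> \<open>The range \<open>{..card M}\<close> has \<open>card M + 1\<close> elements, one
    more than there are monomials.\<close>
  obtain e where e: "\<forall>i\<in>{..card M}. e i \<in> ?N" "\<exists>i\<in>{..card M}. e i \<noteq> 0"
    "\<forall>\<mu>\<in>M. (\<Sum>i\<in>{..card M}. e i * pp_coeff W \<mu> (r i)) = 0"
    using exists_linear_dependence[of M "{..card M}" ?N "\<lambda>i \<mu>. pp_coeff W \<mu> (r i)"] M cN
    by (auto intro: polys_in_closed)
  have "(\<Sum>i\<le>card M. e i * r i) = (\<Sum>i\<le>card M. e i * (\<Sum>\<mu>\<in>M. pp_coeff W \<mu> (r i) * single \<mu> 1))"
    using sum_pp_coeff[OF M restr] by simp
  also have "\<dots> = (\<Sum>i\<le>card M. \<Sum>\<mu>\<in>M. e i * pp_coeff W \<mu> (r i) * single \<mu> 1)"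
    by (simp add: sum_distrib_left mult.assoc)
  also have "\<dots> = (\<Sum>\<mu>\<in>M. \<Sum>i\<le>card M. e i * pp_coeff W \<mu> (r i) * single \<mu> 1)"
    by (rule sum.swap)
  also have "\<dots> = (\<Sum>\<mu>\<in>M. (\<Sum>i\<le>card M. e i * pp_coeff W \<mu> (r i)) * single \<mu> 1)"
    by (simp only: sum_distrib_right)
  also have "\<dots> = 0" using e(3) by simp
  finally have er: "(\<Sum>i\<le>card M. e i * r i) = 0" .
  have sumI: "sum g J \<in> I" if "\<And>i. i \<in> J \<Longrightarrow> g i \<in> I" for g and J :: "nat set"
    using that by (induction J rule: infinite_finite_induct) (auto intro: I_zero I_add)
  have "(\<Sum>i\<le>card M. e i * (a i * ?h ^ i - r i)) \<in> I"
    by (intro sumI I_mult ar(3))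
  moreover have "(\<Sum>i\<le>card M. e i * (a i * ?h ^ i - r i)) = (\<Sum>i\<le>card M. e i * a i * ?h ^ i)"
    using er by (simp add: right_diff_distrib sum_subtractf mult.assoc)
  ultimately have ea: "(\<Sum>i\<le>card M. e i * a i * ?h ^ i) \<in> I" by simp
  \<comment> \<open>The lowest power of \<open>?h\<close> with a nonzero coefficient in the
    relation.\<close>
  define j where "j = (LEAST i. i \<le> card M \<and> e i \<noteq> 0)"
  have j: "j \<le> card M" "e j \<noteq> 0"
    using e(2) LeastI_ex[of "\<lambda>i. i \<le> card M \<and> e i \<noteq> 0"] unfolding j_def by auto
  have e0: "e i = 0" if "i < j" for i
    using not_less_Least[OF that[unfolded j_def]] that j by auto
  define q where "q = (\<Sum>i\<in>{Suc j..card M}. e i * a i * ?h ^ (i - Suc j))"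
  have "(\<Sum>i\<le>card M. e i * a i * ?h ^ i) = (\<Sum>i\<in>{j..card M}. e i * a i * ?h ^ i)"
    using e0 by (intro sum.mono_neutral_right) auto
  also have "\<dots> = (\<Sum>i\<in>{j..card M}. ?h ^ j * (e i * a i * ?h ^ (i - j)))"
    by (intro sum.cong refl) (simp add: mult_ac flip: power_add)
  also have "\<dots> = ?h ^ j * (\<Sum>i\<in>{j..card M}. e i * a i * ?h ^ (i - j))"
    by (simp only: sum_distrib_left)
  finally have "?h ^ j * (\<Sum>i\<in>{j..card M}. e i * a i * ?h ^ (i - j)) \<in> I" using ea by simp
  then have "(\<Sum>i\<in>{j..card M}. e i * a i * ?h ^ (i - j)) \<in> I"
    using regularD[OF regular_power[OF regular_init[OF f]]] by blast
  moreover have "(\<Sum>i\<in>{j..card M}. e i * a i * ?h ^ (i - j)) = e j * a j + q * ?h"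
  proof -
    have "e i * a i * ?h ^ (i - j) = e i * a i * ?h ^ (i - Suc j) * ?h" if "i \<in> {Suc j..card M}" for i
    proof -
      have "i - j = Suc (i - Suc j)" using that by auto
      then show ?thesis by (simp add: mult_ac)
    qed
    then have "(\<Sum>i\<in>{Suc j..card M}. e i * a i * ?h ^ (i - j)) = q * ?h"
      unfolding q_def sum_distrib_right by (rule sum.cong[OF refl])
    then show ?thesis using j by (simp add: sum.atLeast_Suc_atMost)
  qed
  ultimately have "e j * a j + q * ?h \<in> I" by simp
  moreover have "e j * a j \<in> ?N - {0}" using e(1) j ar(1)[of j] by (auto intro: polys_in_mult)
  moreover have "q \<in> polys_in (below ?u)"
    unfolding q_def
  proof (intro polys_in_sum polys_in_mult polys_in_power hV)
    fix i assume "i \<in> {Suc j..card M}"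
    then show "e i \<in> polys_in (below ?u)" "a i \<in> polys_in (below ?u)"
      using e(1) ar(1)[of i] polys_in_mono[OF NV] by auto
  qed
  ultimately show ?thesis by blast
qed

text \<open>If \<open>s + q * h\<close> lies in \<open>I\<close> for the initial \<open>h\<close> of
  \<open>f\<close>, then subtracting \<open>q * f\<close> from its multiple by \<open>u ^ d\<close>
  replaces the initial of \<open>f\<close> by \<open>s\<close>. Reduction of the rest by elements of
  the same form then makes the tail reduced.\<close>

lemma exists_monic_over:
  assumes "u \<in> leaders"
  shows "\<exists>s t. monic_over u s t"
  using wf_lt assms
proof (induction u rule: wf_induct_rule)
  case (less u)
  define f where "f = elt u"
  have f: "f \<in> A" "leader le f = u" "deg_in u f = ldeg u"
    using elt_in_A[OF less.prems] leader_elt[OF less.prems] by (simp_all add: f_def ldeg_def)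
  have IH: "\<exists>s t. monic_over w s t" if "w \<in> leaders" "lt w u" for w
    using less.IH[of w] that by simp
  let ?d = "ldeg u" and ?h = "init le f"
  obtain s q where sq: "s \<in> polys_in (nbelow u) - {0}" "q \<in> polys_in (below u)" "s + q * ?h \<in> I"
    using exists_inverse_of_init[OF f(1), unfolded f(2), OF IH] by blast
  define R where "R = f - ?h * var u ^ ?d"
  have sub: "below u \<subseteq> weakly_below u" "nbelow u \<subseteq> weakly_below u" "u \<in> weakly_below u"
    using less.prems by (auto simp: below_def weakly_below_def nbelow_def lt_def)
  have fV: "f \<in> polys_in (weakly_below u)"
    using A_in[OF f(1)] vars_le_leader[of _ f] unfolding polys_in_iff weakly_below_def f(2) by blast
  have RV: "R \<in> polys_in (weakly_below u)"
    unfolding R_def init_def using fV sub by (intro polys_in_closed polys_in_coeff_in polys_in_var)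
  have hu: "u \<notin> vars ?h" "u \<notin> vars q"
    using vars_init[of f] f sq(2) by (auto simp: polys_in_iff below_def)
  have degR: "deg_in u R < ?d"
  proof -
    have "univ u R = univ u f - Polynomial.monom ?h ?d"
      by (simp add: R_def univ_diff univ_mult univ_not_in_vars[OF hu(1)] univ_var_power smult_monom)
    then have *: "Polynomial.coeff (univ u R) i = coeff_in u i f - (if i = ?d then ?h else 0)" for i
      by (simp add: coeff_univ)
    have "Polynomial.coeff (univ u R) i = 0" if "i \<ge> ?d" for i
      using that f(2,3) coeff_in_above[of u f i] by (cases "i = ?d") (simp_all add: * init_def)
    then have "Polynomial.degree (univ u R) < ?d"
      using ldeg_pos[OF less.prems] by (metis leading_coeff_0_iff degree_0 not_le)
    then show ?thesis by (simp add: degree_univ)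
  qed
  define T where "T = - (q * R)"
  have TV: "T \<in> polys_in (weakly_below u)"
    unfolding T_def using RV sq(2) polys_in_mono[OF sub(1)] by (intro polys_in_uminus polys_in_mult) auto
  have degT: "deg_in u T < ?d"
    using deg_in_mult_le[of u q R] degR hu deg_in_eq_0_iff[of u q] by (simp add: T_def)
  \<comment> \<open>The product of \<open>q\<close> with the leading term of \<open>f\<close>
    cancels, leaving \<open>s\<close> as initial.\<close>
  have eq: "s * var u ^ ?d + T = var u ^ ?d * (s + q * ?h) - q * f"
    by (simp add: T_def R_def algebra_simps)
  have PI: "s * var u ^ ?d + T \<in> I"
    unfolding eq using sq(3) f(1) A_subset_I by (intro I_diff I_mult) auto
  \<comment> \<open>The tail \<open>T\<close> may still have large degrees in lower leaders.
    Including \<open>u\<close>, with the polynomial just found, keeps the degree in \<open>u\<close>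
    under control in the same reduction.\<close>
  define W where "W = {w \<in> leaders. le w u}"
  have "\<forall>w\<in>W. \<exists>s' t'. s' \<in> polys_in (nbelow w) - {0} \<and> t' \<in> polys_in (weakly_below w) \<and>
      deg_in w t' < ldeg w \<and> s' * var w ^ ldeg w + t' \<in> I"
  proof
    fix w assume w: "w \<in> W"
    show "\<exists>s' t'. s' \<in> polys_in (nbelow w) - {0} \<and> t' \<in> polys_in (weakly_below w) \<and>
      deg_in w t' < ldeg w \<and> s' * var w ^ ldeg w + t' \<in> I"
    proof (cases "w = u")
      case True
      then show ?thesis using sq(1) TV degT PI by blast
    next
      case False
      then have w': "w \<in> leaders" "lt w u" using w by (auto simp: W_def lt_def)
      then show ?thesis using IH[OF w'] unfolding monic_over_def reduced_def by blast
    qed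
  qed
  then obtain s' t' where st': "\<And>w. w \<in> W \<Longrightarrow> s' w \<in> polys_in (nbelow w) - {0} \<and>
      t' w \<in> polys_in (weakly_below w) \<and> deg_in w (t' w) < ldeg w \<and> s' w * var w ^ ldeg w + t' w \<in> I"
    by metis
  have "\<exists>a\<in>polys_in (nbelow u) - {0}. \<exists>r\<in>polys_in (weakly_below u). a * T - r \<in> I \<and> (\<forall>w\<in>W. deg_in w r < ldeg w)"
  proof (rule monic_reduction[OF _ _ sub(2) _ TV])
    fix w assume w: "w \<in> W"
    then have "le w u" by (simp add: W_def)
    then have "weakly_below w \<subseteq> weakly_below u" "nbelow w \<subseteq> nbelow u"
      unfolding weakly_below_def nbelow_def
      using le_trans[OF _ \<open>le w u\<close>] lt_le_trans[OF _ \<open>le w u\<close>] by blast+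
    then show "weakly_below w \<subseteq> weakly_below u \<and> s' w \<in> polys_in (nbelow w) - {0} \<and> nbelow w \<subseteq> nbelow u \<and>
      t' w \<in> polys_in (weakly_below w) \<and> deg_in w (t' w) < ldeg w \<and> s' w * var w ^ ldeg w + t' w \<in> I"
      using st'[OF w] by blast
  qed (auto simp: W_def weakly_below_def)
  then obtain a r where ar: "a \<in> polys_in (nbelow u) - {0}" "r \<in> polys_in (weakly_below u)" "a * T - r \<in> I"
    "\<And>w. w \<in> W \<Longrightarrow> deg_in w r < ldeg w" by blast
  have eq': "a * s * var u ^ ?d + r = a * (s * var u ^ ?d + T) - (a * T - r)"
    by (simp add: algebra_simps)
  have "a * s * var u ^ ?d + r \<in> I"
    unfolding eq' by (rule I_diff[OF I_mult[OF PI] ar(3)])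
  moreover have "reduced r"
    unfolding reduced_def
  proof (intro conjI ballI)
    show "r \<in> polys_in pr_vars"
      using ar(2) unfolding polys_in_iff weakly_below_def by blast
    fix w assume w: "w \<in> leaders"
    show "deg_in w r < ldeg w"
    proof (cases "le w u")
      case True
      then show ?thesis using ar(4) w by (simp add: W_def)
    next
      case False
      then have "w \<notin> vars r" using ar(2) by (auto simp: polys_in_iff weakly_below_def)
      then show ?thesis using ldeg_pos[OF w] deg_in_eq_0_iff[of w r] by simp
    qed
  qed
  moreover have "a * s \<in> polys_in (nbelow u) - {0}" using ar(1) sq(1) by (auto intro: polys_in_mult)
  ultimately show ?case using ar(2) unfolding monic_over_def by blast
qed

end

section \<open>Passage to the polynomial ring over the rational functions in the nonleaders\<close>

section \<open>Leading monomials\<close>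

context variable_order
begin

lemma lex_less_trans:
  assumes "lex_less le r s" "lex_less le s t" shows "lex_less le r t"
proof -
  obtain v w where v: "lookup r v < lookup s v" "\<And>x. le v x \<and> x \<noteq> v \<Longrightarrow> lookup r x = lookup s x"
    and w: "lookup s w < lookup t w" "\<And>x. le w x \<and> x \<noteq> w \<Longrightarrow> lookup s x = lookup t x"
    using assms by (auto simp: lex_less_def)
  consider "v = w" | "lt v w" | "lt w v" using le_total[of v w] by (auto simp: lt_def)
  then show ?thesis
  proof cases
    case 1
    then show ?thesis using v w by (auto simp: lex_less_def intro!: exI[of _ v])
  next
    case 2
    have "lookup r w < lookup t w" using v(2)[of w] w(1) 2 by (auto simp: lt_def)
    moreover have "lookup r x = lookup t x" if "le w x \<and> x \<noteq> w" for x
      using v(2)[of x] w(2)[OF that] that 2 lt_le_trans[of v w x] by (auto simp: lt_def)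
    ultimately show ?thesis by (auto simp: lex_less_def)
  next
    case 3
    have "lookup r v < lookup t v" using w(2)[of v] v(1) 3 by (auto simp: lt_def)
    moreover have "lookup r x = lookup t x" if "le v x \<and> x \<noteq> v" for x
      using w(2)[of x] v(2)[OF that] that 3 lt_le_trans[of w v x] by (auto simp: lt_def)
    ultimately show ?thesis by (auto simp: lex_less_def)
  qed
qed

lemma lex_less_irrefl: "\<not> lex_less le s s"
  by (simp add: lex_less_def)

lemma lex_less_total:
  assumes "s \<noteq> t" shows "lex_less le s t \<or> lex_less le t s"
proof -
  let ?D = "{v. lookup s v \<noteq> lookup t v}"
  have "?D \<subseteq> keys s \<union> keys t" by (auto simp: in_keys_iff)
  then have "finite ?D" by (rule finite_subset) simp
  moreover have "?D \<noteq> {}" using assms poly_mapping_eqI[of s t] by blast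
  ultimately obtain v where v: "lookup s v \<noteq> lookup t v" "\<And>w. lookup s w \<noteq> lookup t w \<Longrightarrow> le w v"
    using exists_greatest[of ?D] by auto
  have "lookup s w = lookup t w" if "le v w \<and> w \<noteq> v" for w
    using v(2)[of w] that le_antisym by blast
  then show ?thesis using v(1) unfolding lex_less_def by (metis linorder_neqE_nat)
qed

lemma exists_lex_greatest:
  assumes "finite X" "X \<noteq> {}"
  shows "\<exists>t\<in>X. \<forall>s\<in>X. s \<noteq> t \<longrightarrow> lex_less le s t"
  using assms
proof (induction rule: finite_ne_induct)
  case (insert x X)
  then obtain t where t: "t \<in> X" "\<forall>s\<in>X. s \<noteq> t \<longrightarrow> lex_less le s t" by auto
  show ?case
  proof (cases "lex_less le x t")
    case True
    then show ?thesis using t by blast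
  next
    case False
    then have "lex_less le t x" using lex_less_total[of t x] t(1) insert.hyps by auto
    then have "lex_less le s x" if "s \<in> X" for s
      using that t(2) lex_less_trans[of s t x] by (cases "s = t") auto
    then show ?thesis by blast
  qed
qed simp

lemma lead_monomial_eqI:
  assumes "t \<in> keys p" "\<And>s. s \<in> keys p \<Longrightarrow> s \<noteq> t \<Longrightarrow> lex_less le s t"
  shows "lead_monomial le p = t"
  unfolding lead_monomial_def
proof (rule the_equality)
  fix t' assume t': "t' \<in> keys p \<and> (\<forall>s\<in>keys p. s \<noteq> t' \<longrightarrow> lex_less le s t')"
  show "t' = t"
  proof (rule ccontr)
    assume "t' \<noteq> t"
    then have "lex_less le t t'" "lex_less le t' t" using assms t' by auto
    then show False using lex_less_trans lex_less_irrefl by blast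
  qed
qed (use assms in blast)

lemma lead_monomial:
  assumes "p \<noteq> 0"
  shows "lead_monomial le p \<in> keys p"
    "s \<in> keys p \<Longrightarrow> s \<noteq> lead_monomial le p \<Longrightarrow> lex_less le s (lead_monomial le p)"
proof -
  obtain t where t: "t \<in> keys p" "\<forall>s\<in>keys p. s \<noteq> t \<longrightarrow> lex_less le s t"
    using exists_lex_greatest[of "keys p"] assms by auto
  then have "lead_monomial le p = t" by (intro lead_monomial_eqI) auto
  then show "lead_monomial le p \<in> keys p"
    "s \<in> keys p \<Longrightarrow> s \<noteq> lead_monomial le p \<Longrightarrow> lex_less le s (lead_monomial le p)"
    using t by auto
qed

lemma lead_coefficient_neq_0: "p \<noteq> 0 \<Longrightarrow> lead_coefficient le p \<noteq> 0"
  using lead_monomial(1)[of p] by (simp add: lead_coefficient_def in_keys_iff)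

lemma lex_less_single_lookup: "lex_less le m (single u d) \<Longrightarrow> lookup m u < d"
  by (auto simp: lex_less_def lookup_single when_def split: if_splits)

end

section \<open>The embedding into polynomials over rational functions\<close>

lemma Fract_one_add: "Fract (a + b) 1 = Fract a 1 + Fract b 1"
  by simp

lemma Fract_one_mult: "Fract (a * b) 1 = Fract a 1 * Fract b 1"
  by simp

lemma Fract_zero [simp]: "Fract 0 b = 0"
  by (simp add: fract_collapse)

lemma Fract_one_eq_iff: "Fract a 1 = Fract b 1 \<longleftrightarrow> a = b"
  by (simp add: eq_fract)

lemma Fract_one_eq_0_iff: "Fract a 1 = 0 \<longleftrightarrow> a = 0"
  using Fract_one_eq_iff[of a 0] by simp

lemma embed_msum:
  "embed L = msum (\<lambda>m a. single (restrict_pp L m) (Fract (single (restrict_pp (- L) m) a) 1))"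
  by (simp add: fun_eq_iff embed_def msum_def)

lemma embed_single:
  "embed L (single m a) = single (restrict_pp L m) (Fract (single (restrict_pp (- L) m) a) 1)"
  by (simp add: embed_msum msum_single)

lemma embed_zero [simp]: "embed L 0 = 0"
  by (simp add: embed_msum)

lemma embed_add: "embed L (p + q) = embed L p + embed L q"
  unfolding embed_msum by (rule msum_add) (simp_all add: single_add Fract_one_add del: add_fract)

lemma embed_mult: "embed L (p * q) = embed L p * embed L q"
  unfolding embed_msum
proof (rule msum_mult)
  fix m n :: "'a power_product" and a b :: 'b
  have eq: "single (restrict_pp (- L) (m + n)) (a * b) =
      single (restrict_pp (- L) m) a * single (restrict_pp (- L) n) b"
    by (simp add: mult_single restrict_pp_add)
  show "single (restrict_pp L (m + n)) (Fract (single (restrict_pp (- L) (m + n)) (a * b)) 1) =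
      single (restrict_pp L m) (Fract (single (restrict_pp (- L) m) a) 1) *
      single (restrict_pp L n) (Fract (single (restrict_pp (- L) n) b) 1)"
    by (subst eq) (simp only: Fract_one_mult restrict_pp_add[of L] mult_single[of "restrict_pp L m"])
qed (simp_all add: single_add Fract_one_add del: add_fract)

lemma embed_one [simp]: "embed L 1 = 1"
proof -
  have "embed L (single 0 1) = single 0 1"
    unfolding embed_single by (simp add: restrict_pp_def One_fract_def)
  then show ?thesis by simp
qed

lemma embed_uminus: "embed L (- p) = - embed L p"
  using embed_add[of L p "- p"] by (simp add: add_eq_0_iff)

lemma embed_diff: "embed L (p - q) = embed L p - embed L q"
  using embed_add[of L p "- q"] by (simp add: embed_uminus)

lemma embed_power: "embed L (p ^ n) = embed L p ^ n"
  by (induction n) (simp_all add: embed_mult)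

lemma embed_sum: "embed L (sum f S) = (\<Sum>i\<in>S. embed L (f i))"
  by (induction S rule: infinite_finite_induct) (simp_all add: embed_add)

lemma lookup_embed: "lookup (embed L p) \<mu> = Fract (pp_coeff L \<mu> p) 1"
proof (induction p rule: mpoly_induct)
  case (single m a)
  then show ?case by (simp add: embed_single pp_coeff_single lookup_single when_def)
next
  case (add p q)
  then show ?case by (simp add: embed_add lookup_add pp_coeff_add)
qed

lemma lookup_pp_coeff: "lookup (pp_coeff X (restrict_pp X m) p) (restrict_pp (- X) m) = lookup p m"
proof (induction p rule: mpoly_induct)
  case (single n a)
  show ?case
  proof (cases "n = m")
    case False
    then have "restrict_pp X n \<noteq> restrict_pp X m \<or> restrict_pp (- X) n \<noteq> restrict_pp (- X) m"
      using restrict_pp_decomp[of X n] restrict_pp_decomp[of X m] by metis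
    then show ?thesis using False by (auto simp: pp_coeff_single lookup_single when_def)
  qed (simp add: pp_coeff_single)
next
  case (add p q)
  then show ?case by (simp add: pp_coeff_add lookup_add)
qed

lemma restrict_in_keys_embed: "m \<in> keys p \<Longrightarrow> restrict_pp L m \<in> keys (embed L p)"
  using lookup_pp_coeff[of L m p] by (auto simp: in_keys_iff lookup_embed Fract_one_eq_0_iff)

lemma keys_embedE:
  assumes "\<mu> \<in> keys (embed L p)"
  obtains m where "m \<in> keys p" "\<mu> = restrict_pp L m"
proof -
  have "Fract (pp_coeff L \<mu> p) 1 \<noteq> 0" using assms by (simp only: in_keys_iff lookup_embed not_False_eq_True)
  then have "pp_coeff L \<mu> p \<noteq> 0" by (simp only: Fract_one_eq_0_iff not_False_eq_True)
  then have "\<mu> \<in> restrict_pp L ` keys p" using pp_coeff_eq_0[of \<mu> L p] by argo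
  then show thesis using that by (elim imageE)
qed

lemma embed_eq_0_iff [simp]: "embed L p = 0 \<longleftrightarrow> p = 0"
proof
  assume "embed L p = 0"
  then have "m \<notin> keys p" for m using restrict_in_keys_embed[of m p L] by (metis keys_zero empty_iff)
  then have "keys p = {}" by blast
  then show "p = 0" by (simp only: keys_eq_empty)
qed simp

lemma embed_inject: "embed L p = embed L q \<longleftrightarrow> p = q"
  using embed_eq_0_iff[of L "p - q"] by (simp add: embed_diff)

lemma embed_nonleaders:
  assumes "vars p \<inter> L = {}" shows "embed L p = const (Fract p 1)"
proof -
  have 0: "restrict_pp L m = 0" if "m \<in> keys p" for m
  proof -
    have "keys m \<inter> L = {}" using that assms by (auto simp: vars_def)
    then show ?thesis using keys_restrict_pp[of L m] by (simp add: keys_eq_empty)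
  qed
  have m: "restrict_pp (- L) m = m" if "m \<in> keys p" for m
    using restrict_pp_decomp[of L m] 0[OF that] by simp
  have "embed L p = (\<Sum>m\<in>keys p. const (Fract (single m (lookup p m)) 1))"
    unfolding embed_def const_def using 0 m by (intro sum.cong) auto
  also have "\<dots> = const (Fract (\<Sum>m\<in>keys p. single m (lookup p m)) 1)"
  proof -
    have "(\<Sum>m\<in>S. const (Fract (f m) 1)) = const (Fract (sum f S) 1)" for S :: "'a power_product set" and f
      by (induction S rule: infinite_finite_induct) (simp_all add: const_add Fract_one_add del: add_fract)
    then show ?thesis .
  qed
  finally show ?thesis by (simp add: sum_single_lookup)
qed

lemma lookup_const_mult: "lookup (const c * p) m = c * lookup p m"
proof (induction p rule: mpoly_induct)
  case (single n a)
  then show ?case by (simp add: const_def mult_single lookup_single when_def)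
next
  case (add p q)
  then show ?case by (simp add: distrib_left lookup_add)
qed

lemma keys_const_mult: "keys (const c * p) \<subseteq> keys p"
  by (auto simp: in_keys_iff lookup_const_mult)

section \<open>Rational functions in the nonleaders\<close>

lemma rat_funs_Fract: "a \<in> polys_in N \<Longrightarrow> b \<in> polys_in N \<Longrightarrow> b \<noteq> 0 \<Longrightarrow> Fract a b \<in> rat_funs N"
  by (auto simp: rat_funs_def)

lemma rat_funsE:
  assumes "c \<in> rat_funs N"
  obtains a b where "c = Fract a b" "a \<in> polys_in N" "b \<in> polys_in N" "b \<noteq> 0"
  using assms by (auto simp: rat_funs_def)

lemma rat_funs_zero: "0 \<in> rat_funs N"
  using rat_funs_Fract[of 0 N 1] by simp

lemma rat_funs_one: "1 \<in> rat_funs N"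
  using rat_funs_Fract[of 1 N 1] by (simp add: One_fract_def)

lemma rat_funs_add: "c \<in> rat_funs N \<Longrightarrow> d \<in> rat_funs N \<Longrightarrow> c + d \<in> rat_funs N"
  by (elim rat_funsE) (auto intro!: rat_funs_Fract polys_in_closed)

lemma rat_funs_mult: "c \<in> rat_funs N \<Longrightarrow> d \<in> rat_funs N \<Longrightarrow> c * d \<in> rat_funs N"
  by (elim rat_funsE) (auto intro!: rat_funs_Fract polys_in_closed)

lemma porf_polys_in: "p \<in> polys_over_rat_funs N L \<Longrightarrow> p \<in> polys_in L"
  and porf_lookup: "p \<in> polys_over_rat_funs N L \<Longrightarrow> lookup p m \<in> rat_funs N"
  by (auto simp: polys_over_rat_funs_def)

lemma porf_keys: "p \<in> polys_over_rat_funs N L \<Longrightarrow> m \<in> keys p \<Longrightarrow> keys m \<subseteq> L"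
  using porf_polys_in[of p N L] by (auto simp: polys_in_iff vars_def)

lemma porf_zero: "0 \<in> polys_over_rat_funs N L"
  by (simp add: polys_over_rat_funs_def rat_funs_zero)

lemma porf_single: "keys m \<subseteq> L \<Longrightarrow> c \<in> rat_funs N \<Longrightarrow> single m c \<in> polys_over_rat_funs N L"
  by (auto simp: polys_over_rat_funs_def lookup_single when_def rat_funs_zero intro: polys_in_single)

lemma porf_const: "c \<in> rat_funs N \<Longrightarrow> const c \<in> polys_over_rat_funs N L"
  unfolding const_def by (rule porf_single) auto

lemma porf_add:
  "p \<in> polys_over_rat_funs N L \<Longrightarrow> q \<in> polys_over_rat_funs N L \<Longrightarrow> p + q \<in> polys_over_rat_funs N L"
  by (auto simp: polys_over_rat_funs_def lookup_add intro: polys_in_add rat_funs_add)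

lemma porf_sum: "(\<And>i. i \<in> S \<Longrightarrow> f i \<in> polys_over_rat_funs N L) \<Longrightarrow> sum f S \<in> polys_over_rat_funs N L"
  by (induction S rule: infinite_finite_induct) (auto intro: porf_zero porf_add)

lemma porf_mult:
  assumes "p \<in> polys_over_rat_funs N L" "q \<in> polys_over_rat_funs N L"
  shows "p * q \<in> polys_over_rat_funs N L"
proof -
  have "p * q = (\<Sum>m\<in>keys p. single m (lookup p m)) * (\<Sum>m\<in>keys q. single m (lookup q m))"
    by (simp add: sum_single_lookup)
  also have "\<dots> = (\<Sum>m\<in>keys p. \<Sum>n\<in>keys q. single (m + n) (lookup p m * lookup q n))"
    by (simp add: sum_product mult_single)
  also have "\<dots> \<in> polys_over_rat_funs N L"
  proof (intro porf_sum porf_single)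
    fix m n assume "m \<in> keys p" "n \<in> keys q"
    then show "keys (m + n) \<subseteq> L"
      using porf_keys[OF assms(1)] porf_keys[OF assms(2)] keys_add[of m n] by blast
    show "lookup p m * lookup q n \<in> rat_funs N"
      using assms by (intro rat_funs_mult porf_lookup)
  qed
  finally show ?thesis .
qed

lemma porf_embed:
  assumes "p \<in> polys_in (N \<union> L)" shows "embed L p \<in> polys_over_rat_funs N L"
  unfolding polys_over_rat_funs_def
proof (intro CollectI conjI allI)
  show "embed L p \<in> polys_in L"
    unfolding embed_def by (intro polys_in_sum polys_in_single) (simp add: keys_restrict_pp)
  fix m
  have "pp_coeff L m p \<in> polys_in N"
    using vars_pp_coeff[of L m p] assms by (auto simp: polys_in_iff)
  then show "lookup (embed L p) m \<in> rat_funs N"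
    unfolding lookup_embed by (intro rat_funs_Fract) auto
qed

lemma exists_embed_eq:
  fixes a :: "('v::linorder, ('v, 'k::field) mpoly fract) mpoly"
  assumes "N \<inter> L = {}" "a \<in> polys_in L" "\<And>m. m \<in> keys a \<Longrightarrow> \<exists>x\<in>polys_in N. lookup a m = Fract x 1"
  shows "\<exists>p\<in>polys_in (N \<union> L). embed L p = a"
proof -
  obtain x where x: "\<And>m. m \<in> keys a \<Longrightarrow> x m \<in> polys_in N \<and> lookup a m = Fract (x m) 1"
    using assms(3) by metis
  define p where "p = (\<Sum>m\<in>keys a. x m * single m 1)"
  have keys: "keys m \<subseteq> L" if "m \<in> keys a" for m
    using assms(2) that by (auto simp: polys_in_iff vars_def)
  have "p \<in> polys_in (N \<union> L)"
    unfolding p_def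
  proof (intro polys_in_sum polys_in_mult polys_in_single)
    fix m assume m: "m \<in> keys a"
    show "x m \<in> polys_in (N \<union> L)" using x[OF m] polys_in_mono[of N "N \<union> L" "x m"] by simp
    show "keys m \<subseteq> N \<union> L" using keys[OF m] by blast
  qed
  moreover have "embed L p = a"
  proof -
    have "embed L (x m * single m 1) = single m (lookup a m)" if m: "m \<in> keys a" for m
    proof -
      have "vars (x m) \<inter> L = {}" using x[OF m] assms(1) by (auto simp: polys_in_iff)
      then have 1: "embed L (x m) = const (lookup a m)" using x[OF m] embed_nonleaders by simp
      have "keys (restrict_pp (- L) m) = {}" using keys[OF m] by (auto simp: keys_restrict_pp)
      then have 0: "restrict_pp (- L) m = 0" by (simp add: keys_eq_empty)
      then have "restrict_pp L m = m" using restrict_pp_decomp[of L m] by simp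
      then have "embed L (single m 1 :: ('v, 'k) mpoly) = single m 1"
        using 0 by (simp add: embed_single One_fract_def)
      then show ?thesis using 1 by (simp add: embed_mult const_def mult_single)
    qed
    then have "embed L p = (\<Sum>m\<in>keys a. single m (lookup a m))"
      unfolding p_def embed_sum by (intro sum.cong) auto
    then show ?thesis by (simp add: sum_single_lookup)
  qed
  ultimately show ?thesis by blast
qed

lemma exists_common_denominator:
  assumes "finite X" "\<And>i. i \<in> X \<Longrightarrow> c i \<in> rat_funs N"
  shows "\<exists>t\<in>polys_in N - {0}. \<forall>i\<in>X. \<exists>x\<in>polys_in N. Fract t 1 * c i = Fract x 1"
  using assms
proof induction
  case empty
  show ?case by (intro bexI[of _ 1]) auto
next
  case (insert j X)
  then obtain t where t: "t \<in> polys_in N - {0}" "\<forall>i\<in>X. \<exists>x\<in>polys_in N. Fract t 1 * c i = Fract x 1"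
    by auto
  obtain a b where ab: "c j = Fract a b" "a \<in> polys_in N" "b \<in> polys_in N" "b \<noteq> 0"
    using rat_funsE insert.prems by blast
  show ?case
  proof (rule bexI[of _ "b * t"], rule ballI)
    show "b * t \<in> polys_in N - {0}" using ab t by (auto intro: polys_in_mult)
    fix i assume "i \<in> insert j X"
    then show "\<exists>x\<in>polys_in N. Fract (b * t) 1 * c i = Fract x 1"
    proof
      assume "i = j"
      have "Fract (b * t) 1 * Fract a b = Fract (t * a) 1"
        using ab by (simp add: eq_fract)
      then show ?thesis using ab t \<open>i = j\<close> by (intro bexI[of _ "t * a"]) (auto intro: polys_in_mult)
    next
      assume "i \<in> X"
      then obtain x where x: "x \<in> polys_in N" "Fract t 1 * c i = Fract x 1" using t by auto
      have "Fract (b * t) 1 * c i = Fract b 1 * (Fract t 1 * c i)"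
        by (simp only: Fract_one_mult mult.assoc)
      then have "Fract (b * t) 1 * c i = Fract (b * x) 1"
        by (simp only: x Fract_one_mult)
      then show ?thesis using x ab by (intro bexI[of _ "b * x"]) (auto intro: polys_in_mult)
    qed
  qed
qed

lemma porf_clear_denominators:
  assumes "N \<inter> L = {}" "a \<in> polys_over_rat_funs N L"
  shows "\<exists>t\<in>polys_in N - {0}. \<exists>p\<in>polys_in (N \<union> L). const (Fract t 1) * a = embed L p"
proof -
  obtain t where t: "t \<in> polys_in N - {0}" "\<forall>m\<in>keys a. \<exists>x\<in>polys_in N. Fract t 1 * lookup a m = Fract x 1"
    using exists_common_denominator[of "keys a" "lookup a" N] porf_lookup[OF assms(2)] by auto
  have "\<exists>p\<in>polys_in (N \<union> L). embed L p = const (Fract t 1) * a"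
  proof (rule exists_embed_eq[OF assms(1)])
    show "const (Fract t 1) * a \<in> polys_in L"
      using porf_polys_in[OF assms(2)] by (intro polys_in_mult) auto
    fix m assume "m \<in> keys (const (Fract t 1) * a)"
    then have "m \<in> keys a" using keys_const_mult by blast
    then show "\<exists>x\<in>polys_in N. lookup (const (Fract t 1) * a) m = Fract x 1"
      using t(2) by (simp only: lookup_const_mult)
  qed
  then show ?thesis using t(1) by metis
qed

section \<open>The reduced Groebner basis\<close>

lemma ideal_of_hull:
  assumes "ideal_of R R" "F \<subseteq> R" shows "ideal_of R (ideal_of R hull F)"
  unfolding hull_def using assms by (intro ideal_of_Inter) auto

lemma ideal_of_porf: "ideal_of (polys_over_rat_funs N L) (polys_over_rat_funs N L)"
  by (auto simp: ideal_of_def intro: porf_zero porf_add porf_mult)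

lemma single_mem_hull:
  fixes G :: "('v::linorder, ('v, 'k::field) mpoly fract) mpoly set"
  assumes "G \<subseteq> polys_over_rat_funs N L" "g \<in> G" "lead_coefficient le g = 1"
    "keys m \<subseteq> L" "m = n + lead_monomial le g"
  shows "single m 1 \<in> ideal_of (polys_over_rat_funs N L) hull (lead_term le ` G)"
proof -
  let ?R = "polys_over_rat_funs N L :: ('v, ('v, 'k) mpoly fract) mpoly set"
  have R: "lead_term le ` G \<subseteq> ?R"
  proof
    fix x assume "x \<in> lead_term le ` G"
    then obtain h where h: "h \<in> G" "x = lead_term le h" by blast
    \<comment> \<open>The leading monomial may be an unspecified value, as for \<open>h = 0\<close>.
      It is known to occur in \<open>h\<close> once its coefficient is nonzero; otherwise the
      leading term is \<open>0\<close>.\<close>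
    show "x \<in> ?R"
    proof (cases "lead_coefficient le h = 0")
      case True
      then show ?thesis using h by (simp add: lead_term_def porf_zero)
    next
      case False
      then have "lead_monomial le h \<in> keys h" by (simp add: lead_coefficient_def in_keys_iff)
      moreover have hR: "h \<in> ?R" using h(1) assms(1) by blast
      ultimately show ?thesis
        unfolding h(2) lead_term_def lead_coefficient_def
        by (intro porf_single porf_keys[OF hR] porf_lookup[OF hR])
    qed
  qed
  have "keys n \<subseteq> L"
  proof
    fix v assume "v \<in> keys n"
    then have "v \<in> keys m" using assms(5) by (simp add: in_keys_iff lookup_add)
    then show "v \<in> L" using assms(4) by blast
  qed
  then have "single n 1 \<in> ?R" by (intro porf_single rat_funs_one)
  moreover have "lead_term le g \<in> ideal_of ?R hull (lead_term le ` G)"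
    using assms(2) by (intro hull_inc imageI)
  ultimately have "single n 1 * lead_term le g \<in> ideal_of ?R hull (lead_term le ` G)"
    using ideal_of_mult[OF ideal_of_hull[OF ideal_of_porf R]] by blast
  then show ?thesis using assms(3,5) by (simp add: lead_term_def mult_single)
qed

text \<open>The polynomials all of whose monomials are multiples of leading monomials of
  \<open>G\<close> form an ideal \<open>Z\<close> that contains the generators. So membership of a
  monomial in a monomial ideal is divisibility by a generator.\<close>

lemma single_mem_hullD:
  fixes G :: "('v::linorder, ('v, 'k::field) mpoly fract) mpoly set"
  assumes "G \<subseteq> polys_over_rat_funs N L"
    and "single m 1 \<in> ideal_of (polys_over_rat_funs N L) hull (lead_term le ` G)"
  shows "\<exists>g\<in>G. \<exists>n. m = n + lead_monomial le g"
proof -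
  let ?R = "polys_over_rat_funs N L :: ('v, ('v, 'k) mpoly fract) mpoly set"
  define Z where "Z = {a \<in> ?R. \<forall>m\<in>keys a. \<exists>g\<in>G. \<exists>n. m = n + lead_monomial le g}"
  have "ideal_of ?R Z"
    unfolding ideal_of_def
  proof (intro conjI ballI)
    show "Z \<subseteq> ?R" "0 \<in> Z" by (auto simp: Z_def porf_zero)
    fix a assume a: "a \<in> Z"
    show "a + b \<in> Z" if "b \<in> Z" for b
      using a that keys_add[of a b] porf_add[of a N L b] unfolding Z_def by blast
    fix r assume r: "r \<in> ?R"
    have "\<exists>g\<in>G. \<exists>n. m = n + lead_monomial le g" if m: "m \<in> keys (r * a)" for m
    proof -
      obtain x y where xy: "m = x + y" "y \<in> keys a" using keys_mult[of r a] m by blast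
      then obtain g n where "g \<in> G" "y = n + lead_monomial le g" using a unfolding Z_def by blast
      then have "m = (x + n) + lead_monomial le g" using xy by (simp add: add.assoc)
      then show ?thesis using \<open>g \<in> G\<close> by blast
    qed
    then show "r * a \<in> Z" using r a porf_mult[of r N L a] unfolding Z_def by blast
  qed
  moreover have "lead_term le ` G \<subseteq> Z"
  proof
    fix x assume "x \<in> lead_term le ` G"
    then obtain h where h: "h \<in> G" "x = lead_term le h" by blast
    show "x \<in> Z"
    proof (cases "lead_coefficient le h = 0")
      case True
      then show ?thesis using h by (simp add: lead_term_def porf_zero Z_def)
    next
      case False
      then have "lead_monomial le h \<in> keys h" by (simp add: lead_coefficient_def in_keys_iff)
      moreover have hR: "h \<in> ?R" using h(1) assms(1) by blast
      ultimately have "x \<in> ?R"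
        unfolding h(2) lead_term_def lead_coefficient_def
        by (intro porf_single porf_keys[OF hR] porf_lookup[OF hR])
      moreover have "\<exists>g\<in>G. \<exists>n. m = n + lead_monomial le g" if "m \<in> keys x" for m
      proof -
        have "m = 0 + lead_monomial le h"
          using that unfolding h(2) lead_term_def by (simp split: if_splits)
        then show ?thesis using h(1) by blast
      qed
      ultimately show ?thesis unfolding Z_def by blast
    qed
  qed
  ultimately have "ideal_of ?R hull (lead_term le ` G) \<subseteq> Z" by (intro hull_minimal)
  then show ?thesis using assms(2) unfolding Z_def by auto
qed

context characterized_ideal
begin

abbreviation KL :: "(('n, 'l) dvar, ('n, 'l, 'k) dpoly fract) mpoly set" where
  "KL \<equiv> polys_over_rat_funs nonleaders leaders"

abbreviation emb :: "('n, 'l, 'k) dpoly \<Rightarrow> (('n, 'l) dvar, ('n, 'l, 'k) dpoly fract) mpoly" where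
  "emb \<equiv> embed leaders"

definition J :: "(('n, 'l) dvar, ('n, 'l, 'k) dpoly fract) mpoly set" where
  "J = saturation KL (ideal_of KL hull (emb ` A)) (emb (init_sep_prod le A))"

lemma init_sep_prod_neq_0: "init_sep_prod le A \<noteq> 0"
  using regularD[OF regular_init_sep_prod, of 1] one_notin_I I_zero by auto

lemma init_sep_prod_in: "init_sep_prod le A \<in> polys_in pr_vars"
proof -
  have "separant le f \<in> polys_in pr_vars" if "f \<in> A" for f
    using A_in[OF that] vars_partial_deriv[of "leader le f" f] unfolding separant_def polys_in_iff by blast
  then show ?thesis
    unfolding init_sep_prod_def init_def using A_in
    by (intro polys_in_prod polys_in_mult polys_in_coeff_in) auto
qed

lemma emb_in_KL: "p \<in> polys_in pr_vars \<Longrightarrow> emb p \<in> KL"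
  by (rule porf_embed)

lemma emb_nonleaders: "s \<in> polys_in nonleaders \<Longrightarrow> emb s = const (Fract s 1)"
  using nonleaders_disjoint by (intro embed_nonleaders) (auto simp: polys_in_iff)

lemma const_Fract_emb:
  assumes "s \<in> polys_in nonleaders - {0}"
  shows "const (Fract a s) * emb s = const (Fract a 1)"
proof -
  have "Fract a s * Fract s 1 = Fract a 1" using assms by (simp add: eq_fract)
  then show ?thesis using assms by (simp add: emb_nonleaders flip: const_mult del: mult_fract)
qed

lemma const_Fract_one [simp]: "const (Fract 1 1) = 1"
  by (simp flip: One_fract_def)

lemma nonleaders_in: "s \<in> polys_in nonleaders \<Longrightarrow> s \<in> polys_in pr_vars"
  by (rule polys_in_mono) auto

lemma hull_ideal: "ideal_of KL (ideal_of KL hull (emb ` A))"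
  using A_in emb_in_KL by (intro ideal_of_hull ideal_of_porf) auto

lemma clear_denominators:
  assumes "a \<in> KL"
  shows "\<exists>t\<in>polys_in nonleaders - {0}. \<exists>p\<in>polys_in pr_vars. emb t * a = emb p"
proof -
  obtain t p where "t \<in> polys_in nonleaders - {0}" "p \<in> polys_in pr_vars"
    "const (Fract t 1) * a = emb p"
    using porf_clear_denominators[OF nonleaders_disjoint assms] by blast
  then show ?thesis using emb_nonleaders[of t] by (intro bexI[of _ t] bexI[of _ p]) auto
qed

text \<open>The quotients of elements of \<open>I\<close> by nonzero elements of
  \<open>k[N]\<close>, written with the denominator on the other side to stay within the image of
  \<open>emb\<close>.\<close>

definition J' :: "(('n, 'l) dvar, ('n, 'l, 'k) dpoly fract) mpoly set" where
  "J' = {a \<in> KL. \<exists>s\<in>polys_in nonleaders - {0}. \<exists>P\<in>polys_in pr_vars \<inter> I. emb s * a = emb P}"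

lemma ideal_J': "ideal_of KL J'"
  unfolding ideal_of_def
proof (intro conjI ballI)
  show "J' \<subseteq> KL" by (auto simp: J'_def)
  have "emb 1 * 0 = emb 0" by simp
  moreover have "(1 :: ('n, 'l, 'k) dpoly) \<in> polys_in nonleaders - {0}"
    "(0 :: ('n, 'l, 'k) dpoly) \<in> polys_in pr_vars \<inter> I"
    using I_zero by auto
  ultimately show "0 \<in> J'" unfolding J'_def using porf_zero by blast
  fix a assume "a \<in> J'"
  then obtain s P where a: "a \<in> KL" "s \<in> polys_in nonleaders - {0}"
    "P \<in> polys_in pr_vars \<inter> I" "emb s * a = emb P"
    unfolding J'_def by blast
  {
    fix b assume "b \<in> J'"
    then obtain t Q where b: "b \<in> KL" "t \<in> polys_in nonleaders - {0}"
      "Q \<in> polys_in pr_vars \<inter> I" "emb t * b = emb Q"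
      unfolding J'_def by blast
    have "emb (s * t) * (a + b) = emb t * (emb s * a) + emb s * (emb t * b)"
      by (simp add: embed_mult algebra_simps)
    also have "\<dots> = emb (t * P + s * Q)" unfolding a b by (simp add: embed_mult embed_add)
    finally have eq: "emb (s * t) * (a + b) = emb (t * P + s * Q)" .
    have "s * t \<in> polys_in nonleaders - {0}" using a b by (auto intro: polys_in_mult)
    moreover have "t * P + s * Q \<in> polys_in pr_vars \<inter> I"
      using a b nonleaders_in by (auto intro!: polys_in_add polys_in_mult I_add I_mult)
    ultimately show "a + b \<in> J'" unfolding J'_def using eq porf_add[OF a(1) b(1)] by blast
  next
    fix r assume r: "r \<in> KL"
    obtain t Q where t: "t \<in> polys_in nonleaders - {0}" "Q \<in> polys_in pr_vars"
      "emb t * r = emb Q" using clear_denominators[OF r] by blast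
    have "emb (s * t) * (r * a) = (emb t * r) * (emb s * a)"
      by (simp add: embed_mult mult_ac)
    also have "\<dots> = emb (Q * P)" unfolding a t by (simp add: embed_mult)
    finally have eq: "emb (s * t) * (r * a) = emb (Q * P)" .
    have "s * t \<in> polys_in nonleaders - {0}" using a t by (auto intro: polys_in_mult)
    moreover have "Q * P \<in> polys_in pr_vars \<inter> I"
      using a t by (auto intro!: polys_in_mult I_mult)
    ultimately show "r * a \<in> J'" unfolding J'_def using eq porf_mult[OF r a(1)] by blast
  }
qed

lemma hull_subset_J': "ideal_of KL hull (emb ` A) \<subseteq> J'"
proof (rule hull_minimal)
  show "emb ` A \<subseteq> J'"
  proof
    fix x assume "x \<in> emb ` A"
    then obtain f where f: "f \<in> A" "x = emb f" by blast
    have "emb 1 * x = emb f" using f by simp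
    moreover have "(1 :: ('n, 'l, 'k) dpoly) \<in> polys_in nonleaders - {0}" by simp
    moreover have "f \<in> polys_in pr_vars \<inter> I" using f A_in A_subset_I by blast
    ultimately show "x \<in> J'" unfolding J'_def using f emb_in_KL[OF A_in[OF f(1)]] by blast
  qed
qed (rule ideal_J')

text \<open>For \<open>P\<close> without proper derivatives of leaders, purely algebraic reduction
  by \<open>A\<close> suffices: the remainder is reduced and lies in \<open>I\<close>, so it is
  \<open>0\<close>, and the multipliers divide a power of the product of initials and
  separants.\<close>

lemma emb_mem_J:
  assumes P: "P \<in> polys_in pr_vars" "P \<in> I"
  shows "\<exists>m. emb (init_sep_prod le A) ^ m * emb P \<in> ideal_of KL hull (emb ` A)"
proof -
  let ?W = "pr_vars" and ?H = "init_sep_prod le A"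
  \<comment> \<open>An ideal that remembers both membership in \<open>I\<close>, for the remainder
    to vanish, and membership of the image in the ideal generated by \<open>A\<close>.\<close>
  define T where "T = {Q \<in> polys_in ?W \<inter> I. emb Q \<in> ideal_of KL hull (emb ` A)}"
  define S where "S = {x. \<exists>m. x dvd ?H ^ m}"
  have SW: "S \<subseteq> polys_in ?W"
  proof
    fix x assume "x \<in> S"
    then obtain m where "x dvd ?H ^ m" by (auto simp: S_def)
    then show "x \<in> polys_in ?W"
      using init_sep_prod_neq_0 polys_in_power[OF init_sep_prod_in, of m]
      by (intro polys_in_dvd[of x "?H ^ m"]) auto
  qed
  have T: "ideal_of (polys_in ?W) T"
    unfolding ideal_of_def
  proof (intro conjI ballI)
    show "T \<subseteq> polys_in ?W" by (auto simp: T_def)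
    show "0 \<in> T" using I_zero ideal_of_zero[OF hull_ideal] by (simp add: T_def)
    fix a assume a: "a \<in> T"
    show "a + b \<in> T" if "b \<in> T" for b
      using a that ideal_of_add[OF hull_ideal] unfolding T_def
      by (auto simp: embed_add intro: I_add polys_in_add)
    show "r * a \<in> T" if "r \<in> polys_in ?W" for r
      using a that ideal_of_mult[OF hull_ideal emb_in_KL[OF that]] unfolding T_def
      by (auto simp: embed_mult intro: I_mult polys_in_mult)
  qed
  have AT: "A \<subseteq> T"
  proof
    fix f assume "f \<in> A"
    then show "f \<in> T" using A_in A_subset_I hull_inc[of "emb f" "emb ` A"] unfolding T_def by blast
  qed
  have S1: "1 \<in> S" by (simp add: S_def)
  have Smult: "a * b \<in> S" if ab: "a \<in> S" "b \<in> S" for a b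
  proof -
    obtain m n where "a dvd ?H ^ m" "b dvd ?H ^ n" using ab unfolding S_def by blast
    then have "a * b dvd ?H ^ (m + n)" unfolding power_add by (rule mult_dvd_mono)
    then show ?thesis unfolding S_def by blast
  qed
  have Sinit: "init le f \<in> S" if "f \<in> A" for f
  proof -
    have "init le f dvd ?H ^ 1" using dvd_init_sep_prod(1)[OF finite_A that] by simp
    then show ?thesis unfolding S_def by blast
  qed
  have "\<exists>s\<in>S. \<exists>r\<in>polys_in ?W. s * P - r \<in> T \<and>
    (\<forall>f\<in>A. deg_in (leader le f) r < deg_in (leader le f) f) \<and>
    (\<forall>w. (\<forall>f\<in>A. w \<notin> vars f) \<longrightarrow> deg_in w r \<le> deg_in w P)"
    by (rule pseudo_reduction[OF finite_A autoreduced_inj_on_leader[OF autoreduced_A] A_vars T AT SW S1 Smult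
        Sinit P(1)])
  then obtain s r where sr: "s \<in> S" "r \<in> polys_in ?W" "s * P - r \<in> T"
    "\<forall>f\<in>A. deg_in (leader le f) r < deg_in (leader le f) f" by (elim bexE conjE)
  have "s * P - r \<in> I" using sr(3) by (simp add: T_def)
  from I_diff[OF I_mult[OF P(2), of s] this] have "r \<in> I" by simp
  moreover have "reduced r" unfolding reduced_def using sr(2,4) ldeg_leader by auto
  ultimately have "r = 0" by (intro reduced_in_I)
  then have sP: "emb (s * P) \<in> ideal_of KL hull (emb ` A)" using sr(3) by (simp add: T_def)
  obtain m y where y: "?H ^ m = s * y" using sr(1) by (auto simp: S_def elim: dvdE)
  have "y \<in> polys_in ?W"
  proof (rule polys_in_dvd)
    show "y dvd ?H ^ m" unfolding y by simp
    show "?H ^ m \<noteq> 0" using init_sep_prod_neq_0 by simp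
  qed (rule polys_in_power[OF init_sep_prod_in])
  then have "emb y * emb (s * P) \<in> ideal_of KL hull (emb ` A)"
    using ideal_of_mult[OF hull_ideal emb_in_KL sP] by blast
  moreover have "emb y * emb (s * P) = emb ?H ^ m * emb P"
    unfolding embed_power[symmetric] embed_mult[symmetric] y by (simp add: mult_ac)
  ultimately show ?thesis by auto
qed

text \<open>Denominators and the saturating power multiply the numerator of an element of
  \<open>J\<close> into \<open>I\<close>; both are regular and can be removed. The converse is
  \<open>emb_mem_J\<close>, since elements of \<open>k[N]\<close> are invertible in
  \<open>KL\<close>.\<close>

lemma J_eq: "J = J'"
proof
  let ?H = "init_sep_prod le A"
  show "J \<subseteq> J'"
  proof
    fix a assume "a \<in> J"
    then obtain m where a: "a \<in> KL" "emb ?H ^ m * a \<in> J'"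
      unfolding J_def saturation_def using hull_subset_J' by blast
    obtain s P where s: "s \<in> polys_in nonleaders - {0}" "P \<in> polys_in pr_vars \<inter> I"
      "emb s * (emb ?H ^ m * a) = emb P"
      using a(2) unfolding J'_def by blast
    obtain t Q where t: "t \<in> polys_in nonleaders - {0}" "Q \<in> polys_in pr_vars"
      "emb t * a = emb Q" using clear_denominators[OF a(1)] by blast
    have "emb (s * (?H ^ m * Q)) = emb s * (emb ?H ^ m * (emb t * a))"
      unfolding t(3) by (simp add: embed_mult embed_power)
    also have "\<dots> = emb t * (emb s * (emb ?H ^ m * a))" by (simp add: mult_ac)
    also have "\<dots> = emb (t * P)" unfolding s(3) by (simp add: embed_mult)
    finally have "s * (?H ^ m * Q) = t * P" by (simp only: embed_inject)
    then have "s * (?H ^ m * Q) \<in> I" using s(2) I_mult by simp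
    then have "?H ^ m * Q \<in> I" using regularD[OF regular_nonleaders, of s] s(1) by blast
    then have "Q \<in> I" using regularD[OF regular_power[OF regular_init_sep_prod]] by blast
    then show "a \<in> J'" unfolding J'_def using a(1) t by blast
  qed
  show "J' \<subseteq> J"
  proof
    fix a assume "a \<in> J'"
    then obtain s P where a: "a \<in> KL" "s \<in> polys_in nonleaders - {0}"
      "P \<in> polys_in pr_vars \<inter> I" "emb s * a = emb P"
      unfolding J'_def by blast
    obtain m where m: "emb ?H ^ m * emb P \<in> ideal_of KL hull (emb ` A)"
      using emb_mem_J a(3) by blast
    have "const (Fract 1 s) \<in> KL" using a(2) by (intro porf_const rat_funs_Fract) auto
    then have "const (Fract 1 s) * (emb ?H ^ m * emb P) \<in> ideal_of KL hull (emb ` A)"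
      by (rule ideal_of_mult[OF hull_ideal _ m])
    moreover have "const (Fract 1 s) * (emb ?H ^ m * emb P) = const (Fract 1 s) * emb s * (emb ?H ^ m * a)"
      unfolding a(4)[symmetric] by (simp only: mult_ac)
    then have "const (Fract 1 s) * (emb ?H ^ m * emb P) = emb ?H ^ m * a"
      using const_Fract_emb[OF a(2), of 1] by simp
    ultimately show "a \<in> J" unfolding J_def saturation_def using a(1) by auto
  qed
qed

lemma J_diff:
  assumes "a \<in> J" "b \<in> J" shows "a - b \<in> J"
proof -
  have "(- 1 :: (('n, 'l) dvar, ('n, 'l, 'k) dpoly fract) mpoly) \<in> KL"
    using porf_embed[of "- 1" nonleaders leaders] by (simp add: embed_uminus polys_in_uminus)
  then have "a + (- 1) * b \<in> J'"
    using assms ideal_of_add[OF ideal_J'] ideal_of_mult[OF ideal_J'] unfolding J_eq by blast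
  then show ?thesis by (simp add: J_eq)
qed

lemma J_subset: "J \<subseteq> KL"
  by (auto simp: J_eq J'_def)

definition reduced_pp :: "('n, 'l) dvar power_product \<Rightarrow> bool" where
  "reduced_pp m \<longleftrightarrow> (\<forall>u\<in>leaders. lookup m u < ldeg u)"

text \<open>Multiplying by a denominator in \<open>k[N]\<close> does not change which power products
  of leaders occur, so the numerator is reduced and lies in \<open>I\<close>.\<close>

lemma reduced_in_J:
  assumes "a \<in> J" "\<And>m. m \<in> keys a \<Longrightarrow> reduced_pp m"
  shows "a = 0"
proof -
  obtain s P where s: "s \<in> polys_in nonleaders - {0}" "P \<in> polys_in pr_vars \<inter> I"
    "emb s * a = emb P" using assms(1) unfolding J_eq J'_def by blast
  have "deg_in u P < ldeg u" if u: "u \<in> leaders" for u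
    unfolding deg_in_less_iff[OF ldeg_pos[OF u]]
  proof
    fix m assume "m \<in> keys P"
    then have "restrict_pp leaders m \<in> keys (emb s * a)"
      unfolding s(3) by (rule restrict_in_keys_embed)
    then have "restrict_pp leaders m \<in> keys a"
      using s(1) keys_const_mult[of "Fract s 1" a] by (auto simp: emb_nonleaders)
    then have "lookup (restrict_pp leaders m) u < ldeg u"
      using assms(2) u by (auto simp: reduced_pp_def)
    then show "lookup m u < ldeg u" using u by (simp add: lookup_restrict_pp)
  qed
  then have "reduced P" using s(2) by (simp add: reduced_def)
  then have "P = 0" using s(2) by (intro reduced_in_I) auto
  then have "emb s = 0 \<or> a = 0" using s(3) by simp
  then show ?thesis using s(1) by simp
qed

text \<open>An arbitrary choice of denominator. The quotient \<open>gen u\<close> does not depend on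
  it, as the difference of two candidates is a reduced element of \<open>J\<close>.\<close>

definition den :: "('n, 'l) dvar \<Rightarrow> ('n, 'l, 'k) dpoly" where
  "den u = (SOME s. \<exists>t. monic_over u s t)"

definition tail :: "('n, 'l) dvar \<Rightarrow> ('n, 'l, 'k) dpoly" where
  "tail u = (SOME t. monic_over u (den u) t)"

definition poly_gen :: "('n, 'l) dvar \<Rightarrow> ('n, 'l, 'k) dpoly" where
  "poly_gen u = den u * var u ^ ldeg u + tail u"

definition gen :: "('n, 'l) dvar \<Rightarrow> (('n, 'l) dvar, ('n, 'l, 'k) dpoly fract) mpoly" where
  "gen u = single (single u (ldeg u)) 1 + const (Fract 1 (den u)) * emb (tail u)"

lemma monic_over_gen: "u \<in> leaders \<Longrightarrow> monic_over u (den u) (tail u)"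
  unfolding den_def tail_def by (rule someI_ex, rule someI_ex, rule exists_monic_over)

lemma den_in: "u \<in> leaders \<Longrightarrow> den u \<in> polys_in (nbelow u) - {0}"
  and tail_in: "u \<in> leaders \<Longrightarrow> tail u \<in> polys_in (weakly_below u)"
  and reduced_tail: "u \<in> leaders \<Longrightarrow> reduced (tail u)"
  and poly_gen_in_I: "u \<in> leaders \<Longrightarrow> poly_gen u \<in> I"
  using monic_over_gen[of u] unfolding monic_over_def poly_gen_def by blast+

lemma den_nonleaders: "u \<in> leaders \<Longrightarrow> den u \<in> polys_in nonleaders - {0}"
  using den_in[of u] polys_in_mono[of "nbelow u" nonleaders "den u"] by (auto simp: nbelow_def)

lemma emb_var_leader:
  assumes "u \<in> leaders" shows "emb (var u ^ d) = single (single u d) 1"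
proof -
  have "lookup (restrict_pp leaders (single u d)) v = lookup (single u d) v"
    "lookup (restrict_pp (- leaders) (single u d)) v = lookup 0 v" for v
    using assms by (cases "v = u"; simp add: lookup_restrict_pp lookup_single)+
  then have "restrict_pp leaders (single u d) = single u d" "restrict_pp (- leaders) (single u d) = 0"
    by (auto intro: poly_mapping_eqI)
  then show ?thesis by (simp add: var_power embed_single One_fract_def)
qed

lemma emb_poly_gen:
  assumes "u \<in> leaders" shows "emb (den u) * gen u = emb (poly_gen u)"
proof -
  have "emb (den u) * const (Fract 1 (den u)) = 1"
    using const_Fract_emb[OF den_nonleaders[OF assms], of 1] by (simp add: mult.commute)
  then have "emb (den u) * (const (Fract 1 (den u)) * emb (tail u)) = emb (tail u)"
    by (simp flip: mult.assoc)
  then show ?thesis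
    by (simp add: gen_def poly_gen_def embed_add embed_mult emb_var_leader[OF assms] distrib_left)
qed

lemma keys_tail:
  assumes "u \<in> leaders" "m \<in> keys (const (Fract 1 (den u)) * emb (tail u))"
  shows "reduced_pp m" "lex_less le m (single u (ldeg u))"
proof -
  have "m \<in> keys (emb (tail u))" using assms(2) keys_const_mult by blast
  then obtain n where n: "n \<in> keys (tail u)" "m = restrict_pp leaders n" by (rule keys_embedE)
  have deg: "lookup n w < ldeg w" if "w \<in> leaders" for w
    using reduced_tail[OF assms(1)] that lookup_le_deg_in[OF n(1), of w] unfolding reduced_def
    by (meson le_less_trans)
  then show "reduced_pp m" by (simp add: reduced_pp_def n(2) lookup_restrict_pp)
  have "lookup m w = 0" if "le u w \<and> w \<noteq> u" for w
  proof -
    have "w \<notin> vars (tail u)"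
      using tail_in[OF assms(1)] that le_antisym unfolding polys_in_iff weakly_below_def by blast
    then have "lookup n w = 0" using n(1) by (auto simp: in_vars_iff)
    then show ?thesis by (simp add: n(2) lookup_restrict_pp)
  qed
  then show "lex_less le m (single u (ldeg u))"
    unfolding lex_less_def using deg[OF assms(1)] assms(1)
    by (intro exI[of _ u]) (auto simp: n(2) lookup_restrict_pp lookup_single when_def)
qed

lemma not_reduced_single: "u \<in> leaders \<Longrightarrow> \<not> reduced_pp (single u (ldeg u))"
  unfolding reduced_pp_def by (metis less_irrefl lookup_single_eq)

lemma lookup_gen_lead:
  assumes "u \<in> leaders" shows "lookup (gen u) (single u (ldeg u)) = 1"
proof -
  have "single u (ldeg u) \<notin> keys (const (Fract 1 (den u)) * emb (tail u))"
    using keys_tail(1)[OF assms] not_reduced_single[OF assms] by blast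
  then show ?thesis by (simp add: gen_def lookup_add in_keys_iff)
qed

lemma keys_gen:
  assumes "u \<in> leaders" "m \<in> keys (gen u)" "m \<noteq> single u (ldeg u)"
  shows "reduced_pp m" "lex_less le m (single u (ldeg u))"
proof -
  have "m \<in> keys (const (Fract 1 (den u)) * emb (tail u))"
    using assms(2,3) keys_add[of "single (single u (ldeg u)) 1" "const (Fract 1 (den u)) * emb (tail u)"]
    unfolding gen_def by (auto split: if_splits)
  then show "reduced_pp m" "lex_less le m (single u (ldeg u))" using keys_tail[OF assms(1)] by blast+
qed

lemma lead_monomial_gen: "u \<in> leaders \<Longrightarrow> lead_monomial le (gen u) = single u (ldeg u)"
  using keys_gen(2) lookup_gen_lead[of u] by (intro lead_monomial_eqI) (auto simp: in_keys_iff)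

lemma poly_gen_in: "u \<in> leaders \<Longrightarrow> poly_gen u \<in> polys_in (weakly_below u)"
  using monic_over_shape(4)[of u "den u" "tail u"] den_in[of u] tail_in[of u] reduced_tail[of u]
  unfolding poly_gen_def reduced_def by blast

lemma weakly_below_subset: "weakly_below u \<subseteq> pr_vars"
  by (auto simp: weakly_below_def)

lemma gen_in_J:
  assumes "u \<in> leaders" shows "gen u \<in> J"
proof -
  have "tail u \<in> polys_in pr_vars"
    using reduced_tail[OF assms] by (simp add: reduced_def)
  then have "gen u \<in> KL"
    unfolding gen_def using assms den_nonleaders[OF assms]
    by (intro porf_add porf_mult porf_const porf_single rat_funs_one rat_funs_Fract emb_in_KL) auto
  moreover have "poly_gen u \<in> polys_in pr_vars"
    using polys_in_mono[OF weakly_below_subset poly_gen_in[OF assms]] .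
  ultimately show ?thesis
    unfolding J_eq J'_def using emb_poly_gen[OF assms] den_nonleaders[OF assms] poly_gen_in_I[OF assms]
    by blast
qed

text \<open>The leading monomial of \<open>gen u\<close> is a power of \<open>u\<close>, so some
  element \<open>h u\<close> of \<open>G\<close> has a power of \<open>u\<close> as leading
  monomial. These elements bound all exponents in the reduced basis \<open>G\<close>, up to leading
  monomials. A member of \<open>G\<close> has a monomial that is not reduced, hence has the leading
  monomial of some \<open>gen u\<close>, and differs from it by a reduced element of
  \<open>J\<close>.\<close>

lemma groebner_basis_eq:
  assumes "reduced_groebner_basis le KL J G"
  shows "G = gen ` leaders"
proof -
  have GJ: "G \<subseteq> J" and hull: "ideal_of KL hull (lead_term le ` G) = ideal_of KL hull (lead_term le ` (J - {0}))"
    and lc: "\<And>g. g \<in> G \<Longrightarrow> lead_coefficient le g = 1"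
    and red: "\<And>g m. g \<in> G \<Longrightarrow> m \<in> keys g \<Longrightarrow> single m 1 \<notin> ideal_of KL hull (lead_term le ` (G - {g}))"
    using assms unfolding reduced_groebner_basis_def by blast+
  have GKL: "G \<subseteq> KL" using GJ J_subset by blast
  have G0: "g \<noteq> 0" if "g \<in> G" for g using lc[OF that] by (auto simp: lead_coefficient_def)
  have lm: "lead_monomial le g \<in> keys g" if "g \<in> G" for g by (rule lead_monomial(1)[OF G0[OF that]])
  \<comment> \<open>A divisor of a power of \<open>u\<close> is again a power of \<open>u\<close>;
    that its exponent is exactly \<open>ldeg u\<close> follows only at the end.\<close>
  have "\<exists>h e. h \<in> G \<and> lead_monomial le h = single u e \<and> e \<le> ldeg u" if u: "u \<in> leaders" for u
  proof -
    have "gen u \<noteq> 0" using lookup_gen_lead[OF u] by auto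
    moreover have "lead_coefficient le (gen u) = 1"
      using u by (simp add: lead_coefficient_def lead_monomial_gen lookup_gen_lead)
    ultimately have "single (single u (ldeg u)) 1 \<in> ideal_of KL hull (lead_term le ` (J - {0}))"
      using u gen_in_J J_subset
      by (intro single_mem_hull[where n = 0 and g = "gen u"]) (auto simp: lead_monomial_gen)
    then obtain h n where h: "h \<in> G" "single u (ldeg u) = n + lead_monomial le h"
      using single_mem_hullD[OF GKL] unfolding hull[symmetric] by blast
    have l: "lookup n w + lookup (lead_monomial le h) w = (ldeg u when u = w)" for w
      using h(2) by (metis lookup_add lookup_single)
    have "lead_monomial le h = single u (lookup (lead_monomial le h) u)"
    proof (rule poly_mapping_eqI)
      fix w
      show "lookup (lead_monomial le h) w = lookup (single u (lookup (lead_monomial le h) u)) w"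
        using l[of w] by (cases "w = u") (auto simp: lookup_single)
    qed
    moreover have "lookup (lead_monomial le h) u \<le> ldeg u" using l[of u] by simp
    ultimately show ?thesis using h(1) by blast
  qed
  then obtain h e where h: "\<And>u. u \<in> leaders \<Longrightarrow> h u \<in> G"
    "\<And>u. u \<in> leaders \<Longrightarrow> lead_monomial le (h u) = single u (e u)" "\<And>u. u \<in> leaders \<Longrightarrow> e u \<le> ldeg u"
    by metis
  \<comment> \<open>If \<open>h w\<close> is another element than \<open>g\<close>, its leading
    monomial divides no monomial of \<open>g\<close>, as the basis is reduced. If it is
    \<open>g\<close> itself, the lower monomials have a smaller exponent of \<open>w\<close> by the
    lexicographic order.\<close>
  have step: "lookup m w < ldeg w \<or> h w = g \<and> e w = ldeg w \<and> m = lead_monomial le g"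
    if g: "g \<in> G" "m \<in> keys g" "w \<in> leaders" for g m w
  proof (cases "h w = g")
    case True
    show ?thesis
    proof (cases "m = lead_monomial le g")
      case True
      then show ?thesis using h(2,3)[OF g(3)] \<open>h w = g\<close> by auto
    next
      case False
      then have "lex_less le m (single w (e w))"
        using lead_monomial(2)[OF G0[OF g(1)] g(2)] h(2)[OF g(3)] \<open>h w = g\<close> by simp
      then have "lookup m w < e w" by (rule lex_less_single_lookup)
      then show ?thesis using h(3)[OF g(3)] by simp
    qed
  next
    case False
    have "\<not> e w \<le> lookup m w"
    proof
      assume "e w \<le> lookup m w"
      then have "m = (m - single w (e w)) + single w (e w)"
        by (intro poly_mapping_eqI) (auto simp: lookup_add lookup_minus lookup_single when_def)
      then have "m = (m - single w (e w)) + lead_monomial le (h w)" by (simp only: h(2)[OF g(3)])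
      moreover have "keys m \<subseteq> leaders" using porf_keys g GKL by blast
      ultimately have "single m 1 \<in> ideal_of KL hull (lead_term le ` (G - {g}))"
        using GKL h(1)[OF g(3)] False lc by (intro single_mem_hull[where g = "h w"]) auto
      then show False using red g by blast
    qed
    then show ?thesis using h(3)[OF g(3)] by simp
  qed
  have G_gen: "\<exists>u\<in>leaders. g = gen u" if g: "g \<in> G" for g
  proof -
    have "\<not> (\<forall>m\<in>keys g. reduced_pp m)" using reduced_in_J g GJ G0 by blast
    then obtain m u where u: "m \<in> keys g" "u \<in> leaders" "\<not> lookup m u < ldeg u"
      unfolding reduced_pp_def by blast
    then have hu: "h u = g" "e u = ldeg u" using step[OF g u(1,2)] by auto
    have lmg: "lead_monomial le g = single u (ldeg u)" using h(2)[OF u(2)] hu by simp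
    have "g - gen u = 0"
    proof (rule reduced_in_J)
      show "g - gen u \<in> J" using g GJ gen_in_J[OF u(2)] by (intro J_diff) auto
      fix m assume m: "m \<in> keys (g - gen u)"
      have "lookup g (single u (ldeg u)) = 1" using lc[OF g] by (simp add: lead_coefficient_def lmg)
      then have "m \<noteq> single u (ldeg u)"
        using m lookup_gen_lead[OF u(2)] by (auto simp: in_keys_iff lookup_minus)
      moreover have "m \<in> keys g \<union> keys (gen u)" using m keys_diff[of g "gen u"] by blast
      ultimately show "reduced_pp m"
        using step[OF g, of m] keys_gen(1)[OF u(2)] lmg unfolding reduced_pp_def by blast
    qed
    then show ?thesis using u(2) by auto
  qed
  moreover have "gen u \<in> G" if u: "u \<in> leaders" for u
  proof -
    obtain u' where u': "u' \<in> leaders" "h u = gen u'" using G_gen h(1)[OF u] by blast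
    then have eq: "single u (e u) = single u' (ldeg u')" using h(2)[OF u] lead_monomial_gen by simp
    \<comment> \<open>The exponent \<open>ldeg u'\<close> is positive, so the two powers can only
      agree if the variables do.\<close>
    have "u = u'"
    proof (rule ccontr)
      assume "u \<noteq> u'"
      then have "lookup (single u (e u)) u' = 0" by (simp add: lookup_single)
      then show False unfolding eq using ldeg_pos[OF u'(1)] by simp
    qed
    then show ?thesis using h(1)[OF u] u' by simp
  qed
  ultimately show ?thesis by blast
qed

end

section \<open>Clearing denominators and the canonical characteristic set\<close>

section \<open>Clearing denominators\<close>

lemma lookup_lead_init:
  assumes "m \<in> keys (coeff_in u d f)"
  shows "lookup f (m + single u d) = lookup (coeff_in u d f) m"
  using assms by (simp add: keys_coeff_in lookup_coeff_in)

context variable_order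
begin

lemma lex_less_add: "lex_less le s t \<Longrightarrow> lex_less le (s + r) (t + r)"
  by (auto simp: lex_less_def lookup_add)

text \<open>The lexicographic order compares the exponent of the leader first, so the leading
  monomial of \<open>f\<close> is that of its initial times the highest power of the leader.\<close>

lemma lead_coefficient_init:
  fixes f :: "('v, 'a::comm_semiring_1) mpoly"
  assumes "vars f \<noteq> {}"
  shows "lead_coefficient le (init le f) = lead_coefficient le f"
proof -
  let ?u = "leader le f" and ?h = "init le f"
  let ?d = "deg_in ?u f"
  have "f \<noteq> 0" using assms by auto
  then have h0: "?h \<noteq> 0" unfolding init_def by (rule coeff_in_deg_in_neq_0)
  let ?m = "lead_monomial le ?h"
  have m: "?m \<in> keys ?h" by (rule lead_monomial(1)[OF h0])
  have "lead_monomial le f = ?m + single ?u ?d"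
  proof (rule lead_monomial_eqI)
    show "?m + single ?u ?d \<in> keys f" using m unfolding init_def keys_coeff_in by blast
    fix n assume n: "n \<in> keys f" "n \<noteq> ?m + single ?u ?d"
    show "lex_less le n (?m + single ?u ?d)"
    proof (cases "lookup n ?u = ?d")
      case True
      define n' where "n' = n - single ?u ?d"
      have nn: "n = n' + single ?u ?d"
        using True by (intro poly_mapping_eqI) (auto simp: n'_def lookup_add lookup_minus lookup_single when_def)
      have "lookup n' ?u = 0" using True by (simp add: n'_def lookup_minus)
      moreover have "n' + single ?u ?d \<in> keys f" using n(1) nn by metis
      ultimately have "n' \<in> keys ?h" unfolding init_def keys_coeff_in by blast
      moreover have "n' \<noteq> ?m" using n(2) nn by metis
      ultimately have "lex_less le n' ?m" by (rule lead_monomial(2)[OF h0])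
      then show ?thesis unfolding nn by (rule lex_less_add)
    next
      case False
      then have "lookup n ?u < ?d" using lookup_le_deg_in[OF n(1), of ?u] by simp
      also have "?d \<le> lookup (?m + single ?u ?d) ?u" by (simp add: lookup_add)
      finally have lt: "lookup n ?u < lookup (?m + single ?u ?d) ?u" .
      have z: "lookup k w = 0" if "k \<in> keys f" "le ?u w \<and> w \<noteq> ?u" for k w
      proof -
        have "w \<notin> vars f" using vars_le_leader[of w f] that(2) le_antisym by blast
        then show ?thesis using that(1) by (auto simp: in_vars_iff)
      qed
      have "lookup n w = lookup (?m + single ?u ?d) w" if "le ?u w \<and> w \<noteq> ?u" for w
        using z[OF n(1) that] z[OF \<open>?m + single ?u ?d \<in> keys f\<close> that] by simp
      with lt show ?thesis unfolding lex_less_def by blast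
    qed
  qed
  then show ?thesis using lookup_lead_init[OF m[unfolded init_def]]
    by (simp add: lead_coefficient_def init_def)
qed

end

lemma lead_coefficient_const_mult:
  fixes p :: "('v, 'a::field) mpoly"
  assumes "c \<noteq> 0"
  shows "lead_coefficient le (const c * p) = c * lead_coefficient le p"
proof -
  have "keys (const c * p) = keys p"
    using assms by (auto simp: in_keys_iff lookup_const_mult)
  then have "lead_monomial le (const c * p) = lead_monomial le p"
    by (simp add: lead_monomial_def)
  then show ?thesis by (simp add: lead_coefficient_def lookup_const_mult)
qed

lemma is_denominator_iff:
  "is_denominator N c b \<longleftrightarrow> b \<in> polys_in N \<and> b \<noteq> 0 \<and> (\<exists>a\<in>polys_in N. rel_prime a b \<and> c = Fract a b)"
  by (simp add: is_denominator_def rel_prime_def)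

text \<open>From \<open>q * a = x * b\<close> with \<open>a\<close> and \<open>b\<close> coprime,
  \<open>b\<close> must divide \<open>q\<close>. So lowest terms give the least denominator with
  respect to divisibility.\<close>

lemma denominator_dvd:
  assumes "is_denominator N c b" "Fract q 1 * c = Fract x 1"
  shows "b dvd q"
proof -
  obtain a where a: "b \<noteq> 0" "rel_prime a b" "c = Fract a b"
    using assms(1) by (auto simp: is_denominator_iff)
  then have "q * a = x * b" using assms(2) by (simp add: eq_fract)
  then have "a * q = b * x" by (simp only: mult.commute)
  then have "b dvd a * q" by (rule dvdI)
  then show ?thesis by (rule rel_prime_dvd_mult[OF a(2,1)])
qed

lemma exists_denominator:
  assumes "c \<in> rat_funs N" "c \<noteq> 0"
  shows "\<exists>b. is_denominator N c b"
proof -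
  obtain x y where xy: "c = Fract x y" "x \<in> polys_in N" "y \<in> polys_in N" "y \<noteq> 0"
    using rat_funsE[OF assms(1)] by blast
  have x0: "x \<noteq> 0" using xy(1) assms(2) by auto
  obtain d a b where d: "x = d * a" "y = d * b" "rel_prime a b"
    using exists_rel_prime_quotients[OF xy(4)] by blast
  have "a \<in> polys_in N" "b \<in> polys_in N"
    using polys_in_dvd[OF _ x0 xy(2), of a] polys_in_dvd[OF _ xy(4,3), of b] d by auto
  moreover have "b \<noteq> 0" "d \<noteq> 0" using xy(4) d(2) by auto
  moreover from this have "c = Fract a b" unfolding xy(1) d(1,2) by (simp add: eq_fract)
  ultimately show ?thesis using d(3) unfolding is_denominator_iff by blast
qed

lemma denominator_associated:
  assumes "is_denominator N c b" "is_denominator N c b'"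
  shows "b dvd b'"
proof -
  obtain a where "b' \<noteq> 0" "c = Fract a b'" using assms(2) by (auto simp: is_denominator_iff)
  then have "Fract b' 1 * c = Fract a 1" by (simp add: eq_fract)
  then show ?thesis by (rule denominator_dvd[OF assms(1)])
qed

text \<open>The set of all denominators is closed under nonzero constant factors and may be
  infinite. One denominator per coefficient suffices, the others being associated to it.\<close>

lemma exists_lcm_denominators:
  assumes "\<And>m. m \<in> keys g \<Longrightarrow> lookup g m \<in> rat_funs N"
  shows "\<exists>q. is_lcm_in N (denominators N g) q"
proof -
  have "\<forall>m\<in>keys g. \<exists>b. is_denominator N (lookup g m) b"
    using exists_denominator[OF assms] by (simp add: in_keys_iff)
  from bchoice[OF this] obtain \<beta> where \<beta>: "\<And>m. m \<in> keys g \<Longrightarrow> is_denominator N (lookup g m) (\<beta> m)"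
    by blast
  have "\<beta> ` keys g \<subseteq> polys_in N - {0}"
  proof
    fix x assume "x \<in> \<beta> ` keys g"
    then obtain m where "m \<in> keys g" "x = \<beta> m" by blast
    then show "x \<in> polys_in N - {0}" using \<beta>[of m] by (simp add: is_denominator_def)
  qed
  then obtain q where q: "is_lcm_in N (\<beta> ` keys g) q"
    using exists_lcm_in[of "\<beta> ` keys g" N] finite_keys[of g] by blast
  have "is_lcm_in N (denominators N g) q"
    unfolding is_lcm_in_def
  proof (intro conjI ballI impI)
    show "q \<in> polys_in N" using q by (simp add: is_lcm_in_def)
    fix b assume "b \<in> denominators N g"
    then obtain m where m: "m \<in> keys g" "is_denominator N (lookup g m) b"
      by (auto simp: denominators_def)
    then have "b dvd \<beta> m" using denominator_associated[OF m(2) \<beta>[OF m(1)]] by blast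
    also have "\<beta> m dvd q" using q m(1) by (simp add: is_lcm_in_def)
    finally show "b dvd q" .
  next
    fix q' assume q': "q' \<in> polys_in N" "\<forall>b\<in>denominators N g. b dvd q'"
    have "\<beta> m dvd q'" if "m \<in> keys g" for m
      using q'(2) \<beta>[OF that] that by (auto simp: denominators_def)
    then show "q dvd q'" using q q'(1) by (simp add: is_lcm_in_def)
  qed
  then show ?thesis ..
qed

context characterized_ideal
begin

lemma gen_in_KL: "u \<in> leaders \<Longrightarrow> gen u \<in> KL"
  using gen_in_J J_subset by blast

text \<open>Shows that \<open>den u\<close> is a common denominator of the coefficients of
  \<open>gen u\<close>, and hence a multiple of their least common denominator.\<close>

lemma poly_gen_lookup:
  assumes "u \<in> leaders"
  shows "Fract (den u) 1 * lookup (gen u) m = Fract (pp_coeff leaders m (poly_gen u)) 1"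
proof -
  have "lookup (emb (den u) * gen u) m = lookup (emb (poly_gen u)) m"
    by (simp only: emb_poly_gen[OF assms])
  then show ?thesis
    using den_nonleaders[OF assms]
    by (simp add: emb_nonleaders lookup_const_mult lookup_embed)
qed

lemma denominators_dvd:
  assumes "b \<in> denominators nonleaders (gen u)" "\<And>m. \<exists>x. Fract q 1 * lookup (gen u) m = Fract x 1"
  shows "b dvd q"
  using assms denominator_dvd unfolding denominators_def by blast

lemma exists_cleared:
  assumes u: "u \<in> leaders" shows "\<exists>c. cleared le nonleaders leaders (gen u) c"
proof -
  obtain q where q: "is_lcm_in nonleaders (denominators nonleaders (gen u)) q"
    using exists_lcm_denominators[of "gen u" nonleaders] porf_lookup[OF gen_in_KL[OF u]] by blast
  have "\<exists>p\<in>polys_in pr_vars. emb p = const (Fract q 1) * gen u"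
  proof (rule exists_embed_eq[OF nonleaders_disjoint])
    show "const (Fract q 1) * gen u \<in> polys_in leaders"
      using porf_polys_in[OF gen_in_KL[OF u]] by (intro polys_in_mult) auto
    fix m assume "m \<in> keys (const (Fract q 1) * gen u)"
    then have m: "m \<in> keys (gen u)" using keys_const_mult by blast
    then have "lookup (gen u) m \<noteq> 0" by (simp add: in_keys_iff)
    then obtain b where b: "is_denominator nonleaders (lookup (gen u) m) b"
      using exists_denominator[OF porf_lookup[OF gen_in_KL[OF u]]] by blast
    then obtain a where a: "a \<in> polys_in nonleaders" "b \<noteq> 0" "lookup (gen u) m = Fract a b"
      by (auto simp: is_denominator_iff)
    have "b dvd q" using q b m unfolding is_lcm_in_def denominators_def by blast
    then obtain z where z: "q = b * z" ..
    have "lookup (const (Fract q 1) * gen u) m = Fract (z * a) 1"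
      using a z by (simp add: lookup_const_mult eq_fract)
    moreover have "z * a \<in> polys_in nonleaders"
    proof (cases "z = 0")
      case False
      then have "z \<in> polys_in nonleaders"
        using q z a(2) by (intro polys_in_dvd[of z q]) (auto simp: is_lcm_in_def)
      then show ?thesis using a(1) by (intro polys_in_mult)
    qed simp
    ultimately show "\<exists>x\<in>polys_in nonleaders. lookup (const (Fract q 1) * gen u) m = Fract x 1"
      by blast
  qed
  then show ?thesis using q unfolding cleared_def by blast
qed

text \<open>The decisive gain is that \<open>q\<close> divides \<open>den u\<close> and so contains
  only variables below \<open>u\<close>. The equation \<open>den u * p = q * poly_gen u\<close>
  carries properties of \<open>poly_gen u\<close> over to \<open>p\<close>.\<close>

lemma clearedE:
  assumes u: "u \<in> leaders" and c: "cleared le nonleaders leaders (gen u) c"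
  obtains q p where "is_lcm_in nonleaders (denominators nonleaders (gen u)) q" "q \<noteq> 0"
    "q \<in> polys_in (nbelow u)" "emb p = const (Fract q 1) * gen u" "p \<noteq> 0"
    "p \<in> polys_in pr_vars" "den u * p = q * poly_gen u"
    "c = const (inverse (lead_coefficient le p)) * p"
proof -
  obtain q p where q: "is_lcm_in nonleaders (denominators nonleaders (gen u)) q"
    and p: "p \<in> polys_in pr_vars" "emb p = const (Fract q 1) * gen u"
    and c: "c = const (inverse (lead_coefficient le p)) * p"
    using c unfolding cleared_def by blast
  have den: "den u \<in> polys_in nonleaders" "den u \<noteq> 0" using den_nonleaders[OF u] by auto
  have "b dvd den u" if "b \<in> denominators nonleaders (gen u)" for b
    using denominators_dvd[OF that] poly_gen_lookup[OF u] by blast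
  then have qd: "q dvd den u" using q den(1) unfolding is_lcm_in_def by blast
  then have q0: "q \<noteq> 0" using den(2) by auto
  have qb: "q \<in> polys_in (nbelow u)" using den_in[OF u] by (intro polys_in_dvd[OF qd]) auto
  have qN: "q \<in> polys_in nonleaders" using q by (simp add: is_lcm_in_def)
  have "emb (den u * p) = const (Fract q 1) * (emb (den u) * gen u)"
    unfolding embed_mult p(2) by (simp only: mult_ac)
  also have "\<dots> = emb (q * poly_gen u)"
    unfolding emb_poly_gen[OF u] embed_mult emb_nonleaders[OF qN] ..
  finally have eq: "den u * p = q * poly_gen u" by (simp only: embed_inject)
  have "gen u \<noteq> 0" using lookup_gen_lead[OF u] by auto
  then have "emb p \<noteq> 0" unfolding p(2) using q0 by (simp add: Fract_one_eq_0_iff)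
  then have "p \<noteq> 0" by simp
  then show thesis using that q q0 qb p eq c by blast
qed

text \<open>In \<open>den u * p = q * poly_gen u\<close> the factor \<open>den u\<close> is regular,
  so \<open>p\<close> lies in \<open>I\<close>. Variables and degrees of \<open>p\<close> and its
  tail are bounded by those of the right-hand side, as factors have at most the degree of their
  product.\<close>

lemma cleared_monic:
  assumes u: "u \<in> leaders" and c: "cleared le nonleaders leaders (gen u) c"
  shows "\<exists>s t. monic_over u s t \<and> c = s * var u ^ ldeg u + t"
proof -
  obtain q p where q: "q \<noteq> 0" "q \<in> polys_in (nbelow u)" and p: "p \<noteq> 0"
    "den u * p = q * poly_gen u" and c: "c = const (inverse (lead_coefficient le p)) * p"
    using clearedE[OF u c] by metis
  define \<kappa> where "\<kappa> = inverse (lead_coefficient le p)"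
  have \<kappa>: "\<kappa> \<noteq> 0" using lead_coefficient_neq_0[OF p(1)] by (simp add: \<kappa>_def)
  have den: "den u \<noteq> 0" "den u \<in> polys_in nonleaders" using den_nonleaders[OF u] by auto
  have nu: "nbelow u \<subseteq> weakly_below u" "u \<in> weakly_below u" using u by (auto simp: nbelow_def weakly_below_def lt_def)
  have qu: "q \<in> polys_in (weakly_below u)" using polys_in_mono[OF nu(1) q(2)] .
  have "den u * p \<noteq> 0" using den(1) p(1) mult_eq_0_iff[of "den u" p] by blast
  moreover have "den u * p \<in> polys_in (weakly_below u)"
    unfolding p(2) using qu poly_gen_in[OF u] by (rule polys_in_mult)
  ultimately have pu: "p \<in> polys_in (weakly_below u)" by (intro polys_in_dvd[of p "den u * p"]) auto
  define t where "t = p - q * var u ^ ldeg u"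
  have tu: "t \<in> polys_in (weakly_below u)"
    unfolding t_def using pu qu nu by (intro polys_in_closed polys_in_var)
  have "den u * t = den u * p - den u * (q * var u ^ ldeg u)" by (simp add: t_def right_diff_distrib)
  also have "\<dots> = q * tail u" unfolding p(2) poly_gen_def by (simp add: algebra_simps)
  finally have dt: "den u * t = q * tail u" .
  have degt: "deg_in w t < ldeg w" if w: "w \<in> leaders" for w
  proof (cases "t = 0")
    case True
    then show ?thesis using ldeg_pos[OF w] deg_in_eq_0_iff[of w t] by simp
  next
    case False
    have "w \<notin> vars q" using q(2) w nonleaders_disjoint unfolding polys_in_iff nbelow_def by blast
    then have "deg_in w q = 0" by (simp add: deg_in_eq_0_iff)
    have "deg_in w t \<le> deg_in w (den u * t)" using False den by (simp add: deg_in_mult)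
    also have "\<dots> \<le> deg_in w q + deg_in w (tail u)" unfolding dt by (rule deg_in_mult_le)
    also have "\<dots> = deg_in w (tail u)" using \<open>deg_in w q = 0\<close> by simp
    also have "\<dots> < ldeg w" using reduced_tail[OF u] w unfolding reduced_def by blast
    finally show ?thesis .
  qed
  have "den u * p \<in> I" unfolding p(2) by (rule I_mult[OF poly_gen_in_I[OF u]])
  then have pI: "p \<in> I" using regularD[OF regular_nonleaders[OF den(2,1)]] by blast
  have eq: "c = const \<kappa> * q * var u ^ ldeg u + const \<kappa> * t"
    unfolding c \<kappa>_def[symmetric] t_def by (simp add: algebra_simps)
  have degk: "deg_in w (const \<kappa> * t) < ldeg w" if "w \<in> leaders" for w
  proof -
    have "deg_in w (const \<kappa> :: ('n, 'l, 'k) dpoly) = 0" by (simp add: deg_in_eq_0_iff)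
    then show ?thesis using deg_in_mult_le[of w "const \<kappa>" t] degt[OF that] by simp
  qed
  have "monic_over u (const \<kappa> * q) (const \<kappa> * t)"
    unfolding monic_over_def reduced_def
  proof (intro conjI ballI)
    show "const \<kappa> * q \<in> polys_in (nbelow u) - {0}" using q \<kappa> by (auto intro: polys_in_mult)
    show kt: "const \<kappa> * t \<in> polys_in (weakly_below u)" using tu by (intro polys_in_mult) auto
    show "const \<kappa> * t \<in> polys_in pr_vars" by (rule polys_in_mono[OF weakly_below_subset kt])
    have "c \<in> I" unfolding c by (rule I_mult[OF pI])
    then show "const \<kappa> * q * var u ^ ldeg u + const \<kappa> * t \<in> I" unfolding eq .
  qed (rule degk)
  then show ?thesis using eq by blast
qed

text \<open>Two least common multiples differ by a unit, that is, by a nonzero constant, which the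
  division by the leading coefficient removes.\<close>

lemma cleared_unique:
  assumes u: "u \<in> leaders" and c: "cleared le nonleaders leaders (gen u) c"
    and c': "cleared le nonleaders leaders (gen u) c'"
  shows "c = c'"
proof -
  obtain q p where q: "is_lcm_in nonleaders (denominators nonleaders (gen u)) q" "q \<noteq> 0"
    and p: "emb p = const (Fract q 1) * gen u" and c: "c = const (inverse (lead_coefficient le p)) * p"
    using clearedE[OF u c] by metis
  obtain q' p' where q': "is_lcm_in nonleaders (denominators nonleaders (gen u)) q'" "q' \<noteq> 0"
    and p': "emb p' = const (Fract q' 1) * gen u" and c': "c' = const (inverse (lead_coefficient le p')) * p'"
    using clearedE[OF u c'] by metis
  have "q dvd q'" "q' dvd q" using q q' unfolding is_lcm_in_def by blast+
  then obtain e e' where e: "q' = q * e" "q = q' * e'" unfolding dvd_def by blast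
  have "q * (e * e') = q * 1" using e by (metis mult.assoc mult_1_right)
  then have "e * e' = 1" using q(2) by (simp only: mult_left_cancel[OF q(2)])
  then have "e dvd 1" by (metis dvd_triv_left)
  then obtain \<epsilon> where \<epsilon>: "e = const \<epsilon>" "e \<noteq> 0" unfolding mpoly_unit_iff vars_empty_iff by blast
  have "emb p' = emb (const \<epsilon>) * emb p"
    unfolding p p' e(1) \<epsilon>(1) emb_nonleaders[OF polys_in_const]
    by (simp only: Fract_one_mult const_mult mult_ac)
  then have p': "p' = const \<epsilon> * p" by (simp only: embed_mult[symmetric] embed_inject)
  have "\<epsilon> \<noteq> 0" using \<epsilon> by auto
  then have "c' = const (inverse (lead_coefficient le p) * inverse \<epsilon> * \<epsilon>) * p"
    unfolding c' p' lead_coefficient_const_mult[OF \<open>\<epsilon> \<noteq> 0\<close>] inverse_mult_distrib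
    by (simp only: const_mult mult_ac)
  then show ?thesis using \<open>\<epsilon> \<noteq> 0\<close> unfolding c by (simp add: mult.assoc)
qed

lemma cleared_lead_coefficient:
  assumes u: "u \<in> leaders" and c: "cleared le nonleaders leaders (gen u) c"
  shows "lead_coefficient le c = 1"
proof -
  obtain q p where p: "p \<noteq> 0" "c = const (inverse (lead_coefficient le p)) * p"
    using clearedE[OF u c] by metis
  then show ?thesis using lead_coefficient_neq_0[OF p(1)] by (simp add: lead_coefficient_const_mult)
qed

text \<open>A factor \<open>e\<close> of the cleared polynomial divides its leading coefficient \<open>q\<close>, and \<open>q / e\<close>
  is a common multiple of the denominators as well.\<close>

lemma cleared_primitive:
  assumes u: "u \<in> leaders" and c: "cleared le nonleaders leaders (gen u) c"
    and e: "e \<in> polys_in nonleaders" "e dvd c"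
  shows "vars e = {}"
proof -
  obtain q p where q: "is_lcm_in nonleaders (denominators nonleaders (gen u)) q" "q \<noteq> 0"
    and p: "emb p = const (Fract q 1) * gen u" "p \<noteq> 0" and c: "c = const (inverse (lead_coefficient le p)) * p"
    using clearedE[OF u c] by metis
  have "p = const (lead_coefficient le p) * c"
    unfolding c using lead_coefficient_neq_0[OF p(2)] by (simp flip: mult.assoc const_mult)
  then have "e dvd p" using e(2) by (metis dvd_mult)
  then obtain p' where p': "p = e * p'" ..
  have e0: "e \<noteq> 0" using p(2) p' by auto
  define x where "x m = pp_coeff leaders m p'" for m
  have qx: "Fract q 1 * lookup (gen u) m = Fract e 1 * Fract (x m) 1" for m
  proof -
    have "lookup (const (Fract q 1) * gen u) m = lookup (const (Fract e 1) * emb p') m"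
      unfolding p(1)[symmetric] p' embed_mult emb_nonleaders[OF e(1)] ..
    then show ?thesis by (simp only: lookup_const_mult lookup_embed x_def)
  qed
  \<comment> \<open>The coefficient of the cofactor at the leading monomial of \<open>gen u\<close>,
    where \<open>gen u\<close> has coefficient \<open>1\<close>; hence
    \<open>q = e * q'\<close>.\<close>
  define q' where "q' = x (single u (ldeg u))"
  have "Fract q 1 = Fract (e * q') 1"
    using qx[of "single u (ldeg u)"] by (simp only: lookup_gen_lead[OF u] mult_1_right Fract_one_mult q'_def)
  then have qe: "q = e * q'" by (simp only: Fract_one_eq_iff)
  have "Fract q' 1 * lookup (gen u) m = Fract (x m) 1" for m
  proof -
    have "Fract e 1 * (Fract q' 1 * lookup (gen u) m) = Fract e 1 * Fract (x m) 1"
      using qx[of m] unfolding qe Fract_one_mult by (simp only: mult.assoc)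
    moreover have "Fract e 1 \<noteq> 0" using e0 by (simp add: Fract_one_eq_0_iff)
    ultimately show ?thesis using mult_left_cancel by blast
  qed
  then have "b dvd q'" if "b \<in> denominators nonleaders (gen u)" for b
    using denominators_dvd[OF that] by blast
  moreover have "q' \<in> polys_in nonleaders"
    using q qe by (intro polys_in_dvd[of q' q]) (auto simp: is_lcm_in_def)
  ultimately have "q dvd q'" using q(1) unfolding is_lcm_in_def by blast
  then obtain z where "q' = q * z" ..
  then have "q * 1 = q * (e * z)" using qe by (metis mult.assoc mult.commute mult_1_right)
  then have "1 = e * z" by (simp only: mult_left_cancel[OF q(2)])
  then have "e dvd 1" ..
  then show ?thesis by (simp add: mpoly_unit_iff)
qed

section \<open>The canonical characteristic set\<close>

definition canon :: "('n, 'l) dvar \<Rightarrow> ('n, 'l, 'k) dpoly" where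
  "canon u = (SOME c. cleared le nonleaders leaders (gen u) c)"

lemma cleared_canon: "u \<in> leaders \<Longrightarrow> cleared le nonleaders leaders (gen u) (canon u)"
  unfolding canon_def by (rule someI_ex[OF exists_cleared])

lemma canon_set:
  "{c. \<exists>g\<in>gen ` leaders. cleared le nonleaders leaders g c} = canon ` leaders"
proof (intro subset_antisym subsetI)
  fix c assume "c \<in> {c. \<exists>g\<in>gen ` leaders. cleared le nonleaders leaders g c}"
  then obtain g where "g \<in> gen ` leaders" "cleared le nonleaders leaders g c" by blast
  then obtain u where u: "u \<in> leaders" "cleared le nonleaders leaders (gen u) c" by blast
  have "c = canon u" by (rule cleared_unique[OF u cleared_canon[OF u(1)]])
  then show "c \<in> canon ` leaders" using u(1) by (rule image_eqI)
next
  fix c assume "c \<in> canon ` leaders"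
  then obtain u where u: "u \<in> leaders" "c = canon u" by (rule imageE)
  show "c \<in> {c. \<exists>g\<in>gen ` leaders. cleared le nonleaders leaders g c}"
    unfolding u(2) using cleared_canon[OF u(1)] u(1) by blast
qed

lemma canon_shape:
  assumes u: "u \<in> leaders"
  shows "leader le (canon u) = u" "deg_in u (canon u) = ldeg u" "canon u \<in> polys_in (weakly_below u)"
    "init le (canon u) \<in> polys_in (nbelow u) - {0}" "canon u \<in> I"
    "\<And>w. w \<in> leaders \<Longrightarrow> w \<noteq> u \<Longrightarrow> deg_in w (canon u) < ldeg w"
proof -
  obtain s t where st: "monic_over u s t" "canon u = s * var u ^ ldeg u + t"
    using cleared_monic[OF u cleared_canon[OF u]] by (elim exE conjE)
  from st(1) have s: "s \<in> polys_in (nbelow u) - {0}" and t: "t \<in> polys_in (weakly_below u)" "reduced t"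
    unfolding monic_over_def by blast+
  have degt: "deg_in w t < ldeg w" if "w \<in> leaders" for w using t(2) that unfolding reduced_def by blast
  note shape = monic_over_shape[OF u s t(1) degt[OF u]]
  show "leader le (canon u) = u" "deg_in u (canon u) = ldeg u" "canon u \<in> polys_in (weakly_below u)"
    unfolding st(2) by (fact shape(1), fact shape(2), fact shape(4))
  show "init le (canon u) \<in> polys_in (nbelow u) - {0}" unfolding st(2) shape(3) by (fact s)
  show "canon u \<in> I" unfolding st(2) using st(1) unfolding monic_over_def by blast
  fix w assume w: "w \<in> leaders" "w \<noteq> u"
  have "w \<notin> nbelow u" using w(1) nonleaders_disjoint unfolding nbelow_def by blast
  moreover have "s \<in> polys_in (nbelow u)" using s by (rule DiffD1)
  ultimately have "s \<in> polys_in (- {w})" by (intro polys_in_mono[of "nbelow u" "- {w}" s]) auto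
  moreover have "(var u ^ ldeg u :: ('n, 'l, 'k) dpoly) \<in> polys_in (- {w})"
    using w(2) by (intro polys_in_power polys_in_var) simp
  ultimately have "s * var u ^ ldeg u \<in> polys_in (- {w})" by (rule polys_in_mult)
  then have "w \<notin> vars (s * var u ^ ldeg u)" unfolding polys_in_iff by blast
  then have "deg_in w (s * var u ^ ldeg u) = 0" unfolding deg_in_eq_0_iff .
  then show "deg_in w (canon u) < ldeg w"
    unfolding st(2) using deg_in_add_le[of w "s * var u ^ ldeg u" t] degt[OF w(1)] by simp
qed

lemma reduced_wrt_canon_iff: "u \<in> leaders \<Longrightarrow> reduced_wrt le p (canon u) \<longleftrightarrow> reduced_wrt le p (elt u)"
  unfolding reduced_wrt_def by (simp only: canon_shape(1,2) leader_elt ldeg_def)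

lemma leader_canon_image: "leader le ` canon ` leaders = leaders"
proof -
  have "(\<lambda>u. leader le (canon u)) ` leaders = (\<lambda>u. u) ` leaders"
    by (rule image_cong) (simp_all only: canon_shape(1))
  then show ?thesis unfolding image_image[of "leader le" canon leaders] image_ident .
qed

lemma vars_canon:
  assumes u: "u \<in> leaders" shows "vars (canon u) \<noteq> {}"
proof -
  have "0 < deg_in u (canon u)" unfolding canon_shape(2)[OF u] by (rule ldeg_pos[OF u])
  then have "u \<in> vars (canon u)" using deg_in_eq_0_iff[of u "canon u"] by simp
  then show ?thesis by (metis empty_iff)
qed

lemma autoreduced_canon: "autoreduced le (canon ` leaders)"
  unfolding autoreduced_def
proof (intro conjI ballI impI)
  show "vars f \<noteq> {}" if f: "f \<in> canon ` leaders" for f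
  proof -
    obtain u where "u \<in> leaders" "f = canon u" using f by (rule imageE)
    then show ?thesis using vars_canon by simp
  qed
  fix f g assume fg: "f \<in> canon ` leaders" "g \<in> canon ` leaders" "f \<noteq> g"
  obtain u where u: "u \<in> leaders" "f = canon u" using fg(1) by (rule imageE)
  obtain w where w: "w \<in> leaders" "g = canon w" using fg(2) by (rule imageE)
  have "w \<noteq> u" using fg(3) u(2) w(2) by auto
  note uw = u(1) w(1) u(2) w(2) this
  have "canon u \<in> polys_in (- proper_derivatives leaders)"
    using polys_in_mono[OF weakly_below_subset canon_shape(3)[OF uw(1)]] unfolding nonleaders_leaders .
  then have "apply_op \<theta> w \<notin> vars (canon u)" if "\<theta> \<noteq> 0" for \<theta>
    using that uw(2) unfolding polys_in_iff proper_derivatives_def by blast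
  then show "reduced_wrt le f g"
    unfolding reduced_wrt_def uw(3,4) canon_shape(1,2)[OF uw(2)]
    using canon_shape(6)[OF uw(1,2,5)] by blast
qed

lemma rank_canon: "u \<in> leaders \<Longrightarrow> rank le (canon u) = rank le (elt u)"
  unfolding rank_def by (simp only: canon_shape(1,2) leader_elt ldeg_def)

text \<open>Lowest rank depends on the ranks only, and these agree with the ranks of
  \<open>A\<close>.\<close>

lemma characteristic_set_canon: "characteristic_set le I (canon ` leaders)"
  unfolding characteristic_set_def
proof (intro conjI allI impI)
  show "canon ` leaders \<subseteq> I" using canon_shape(5) by blast
  show "autoreduced le (canon ` leaders)" by (rule autoreduced_canon)
  fix B assume B: "B \<subseteq> I \<and> autoreduced le B"
  show "\<not> lower_rank le B (canon ` leaders)"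
  proof
    assume "lower_rank le B (canon ` leaders)"
    then obtain fs gs where fs: "set fs = B" "set gs = canon ` leaders" "ranked_list le fs" "ranked_list le gs"
      and lower: "(\<exists>j. j < length fs \<and> j < length gs \<and>
            (\<forall>i<j. rank le (fs ! i) = rank le (gs ! i)) \<and>
            rank_less le (rank le (fs ! j)) (rank le (gs ! j))) \<or>
         (length gs < length fs \<and> (\<forall>i<length gs. rank le (fs ! i) = rank le (gs ! i)))"
      unfolding lower_rank_def by blast
    \<comment> \<open>Exchanges each element for the one of \<open>A\<close> with the same leader,
      turning the ranked list of the canonical set into one of \<open>A\<close>.\<close>
    define h where "h c = elt (leader le c)" for c :: "('n, 'l, 'k) dpoly"
    have rank: "rank le (h c) = rank le c" if c: "c \<in> canon ` leaders" for c
    proof -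
      obtain u where "u \<in> leaders" "c = canon u" using c by blast
      then show ?thesis by (simp add: h_def rank_canon canon_shape)
    qed
    have nth: "rank le (map h gs ! i) = rank le (gs ! i)" if "i < length gs" for i
      using that rank[of "gs ! i"] nth_mem[OF that] fs(2) by simp
    have "set (map h gs) = h ` canon ` leaders" using fs(2) by simp
    also have "\<dots> = elt ` leaders" unfolding h_def image_comp[symmetric] image_image
      using canon_shape(1) by (intro image_cong) auto
    also have "\<dots> = A" using elt_leader by force
    finally have "set (map h gs) = A" .
    moreover have "ranked_list le (map h gs)"
      using fs(4) rank fs(2) unfolding ranked_list_def sorted_wrt_map
      by (elim sorted_wrt_mono_rel[rotated]) auto
    moreover have "(\<exists>j. j < length fs \<and> j < length (map h gs) \<and>
            (\<forall>i<j. rank le (fs ! i) = rank le (map h gs ! i)) \<and>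
            rank_less le (rank le (fs ! j)) (rank le (map h gs ! j))) \<or>
         (length (map h gs) < length fs \<and> (\<forall>i<length (map h gs). rank le (fs ! i) = rank le (map h gs ! i)))"
      using lower
    proof (elim disjE exE conjE)
      fix j assume j: "j < length fs" "j < length gs" "\<forall>i<j. rank le (fs ! i) = rank le (gs ! i)"
        "rank_less le (rank le (fs ! j)) (rank le (gs ! j))"
      then have "\<forall>i<j. rank le (fs ! i) = rank le (map h gs ! i)" using nth by simp
      then show ?thesis using j nth[OF j(2)] by (intro disjI1 exI[of _ j]) simp
    next
      assume "length gs < length fs" "\<forall>i<length gs. rank le (fs ! i) = rank le (gs ! i)"
      then show ?thesis using nth by (intro disjI2) simp
    qed
    ultimately have "lower_rank le B A" unfolding lower_rank_def using fs(1,3) by blast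
    then show False using characteristic_set_A B unfolding characteristic_set_def by blast
  qed
qed

text \<open>Some multiple \<open>s f\<close> of the element \<open>f\<close> of \<open>A\<close> with the same leader \<open>u\<close> is a combination
  of elements of the canonical set, all others of which are free of \<open>u\<close>. Differentiation by \<open>u\<close>
  shows that \<open>s S\<^sub>f\<close> is a multiple of the separant modulo \<open>I\<close>.\<close>

lemma regular_separant_canon:
  assumes u: "u \<in> leaders" shows "regular (separant le (canon u))"
proof -
  let ?S = "separant le (canon u)" and ?f = "elt u" and ?V = "weakly_below u"
  \<comment> \<open>By the product rule this is an ideal, because its elements lie in
    \<open>I\<close>. Reducing modulo \<open>T\<close> instead of \<open>I\<close> keeps track of
    the derivative by \<open>u\<close>.\<close>
  define T where "T = {P \<in> polys_in ?V \<inter> I. \<exists>a. partial_deriv u P - a * ?S \<in> I}"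
  define W where "W = {w \<in> leaders. le w u}"
  have sub: "weakly_below w \<subseteq> weakly_below u \<and> nbelow w \<subseteq> nbelow u" if "w \<in> W" for w
    using that le_trans[of _ w u] lt_le_trans[of _ w u] unfolding W_def weakly_below_def nbelow_def by blast
  have SV: "nbelow u \<subseteq> weakly_below u" by (auto simp: nbelow_def weakly_below_def lt_def)
  have T: "ideal_of (polys_in ?V) T"
    unfolding ideal_of_def
  proof (intro conjI ballI)
    show "T \<subseteq> polys_in ?V" by (auto simp: T_def)
    have "partial_deriv u 0 - 0 * ?S \<in> I" using I_zero by (simp add: partial_deriv_eq_0)
    then have "\<exists>a. partial_deriv u 0 - a * ?S \<in> I" by (rule exI)
    then show "0 \<in> T" unfolding T_def using I_zero polys_in_zero by blast
    fix P assume "P \<in> T"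
    then obtain a where P: "P \<in> polys_in ?V" "P \<in> I" "partial_deriv u P - a * ?S \<in> I"
      unfolding T_def by blast
    {
      fix Q assume "Q \<in> T"
      then obtain b where Q: "Q \<in> polys_in ?V" "Q \<in> I" "partial_deriv u Q - b * ?S \<in> I"
        unfolding T_def by blast
      have "partial_deriv u (P + Q) - (a + b) * ?S =
          (partial_deriv u P - a * ?S) + (partial_deriv u Q - b * ?S)"
        by (simp add: partial_deriv_add algebra_simps)
      then have "partial_deriv u (P + Q) - (a + b) * ?S \<in> I" using I_add[OF P(3) Q(3)] by simp
      then show "P + Q \<in> T" unfolding T_def using polys_in_add[OF P(1) Q(1)] I_add[OF P(2) Q(2)] by blast
    next
      fix r :: "('n, 'l, 'k) dpoly" assume r: "r \<in> polys_in ?V"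
      have "partial_deriv u (r * P) - (r * a) * ?S =
          partial_deriv u r * P + r * (partial_deriv u P - a * ?S)"
        by (simp add: partial_deriv_mult algebra_simps)
      then have "partial_deriv u (r * P) - (r * a) * ?S \<in> I"
        using I_add[OF I_mult[OF P(2)] I_mult[OF P(3)]] by simp
      then show "r * P \<in> T" unfolding T_def using polys_in_mult[OF r P(1)] I_mult[OF P(2)] by blast
    }
  qed
  have CT: "canon ` W \<subseteq> T"
  proof
    fix x assume "x \<in> canon ` W"
    then obtain w where w: "w \<in> W" "x = canon w" by blast
    have wl: "w \<in> leaders" "le w u" using w(1) by (auto simp: W_def)
    have "\<exists>a. partial_deriv u (canon w) - a * ?S \<in> I"
    proof (cases "w = u")
      case True
      then have "partial_deriv u (canon w) - 1 * ?S = 0"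
        by (simp add: separant_def canon_shape(1)[OF u])
      then show ?thesis using I_zero by metis
    next
      case False
      then have "u \<notin> vars (canon w)"
        using canon_shape(3)[OF wl(1)] wl(2) le_antisym unfolding polys_in_iff weakly_below_def by blast
      then have "partial_deriv u (canon w) - 0 * ?S = 0" by (simp add: partial_deriv_eq_0)
      then show ?thesis using I_zero by metis
    qed
    then show "x \<in> T"
      unfolding T_def w(2) using polys_in_mono[OF _ canon_shape(3)[OF wl(1)]] sub[OF w(1)] canon_shape(5)[OF wl(1)]
      by blast
  qed
  have Wl: "W \<subseteq> leaders" by (auto simp: W_def)
  let ?R = "polys_in (nbelow u) - {0 :: ('n, 'l, 'k) dpoly}"
  have fV: "?f \<in> polys_in ?V"
    using A_in[OF elt_in_A[OF u]] vars_le_leader[of _ ?f] unfolding leader_elt[OF u] polys_in_iff weakly_below_def by blast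
  have "\<exists>s\<in>?R. \<exists>r\<in>polys_in ?V. s * ?f - r \<in> T \<and>
      (\<forall>g\<in>canon ` W. deg_in (leader le g) r < deg_in (leader le g) g) \<and>
      (\<forall>w. (\<forall>g\<in>canon ` W. w \<notin> vars g) \<longrightarrow> deg_in w r \<le> deg_in w ?f)"
  proof (rule pseudo_reduction[OF _ _ _ T CT _ _ _ _ fV])
    show "finite (canon ` W)" using finite_A Wl by (meson finite_imageI finite_subset)
    show "inj_on (leader le) (canon ` W)"
      using autoreduced_inj_on_leader[OF autoreduced_canon] Wl by (meson image_mono inj_on_subset)
    show "vars g \<noteq> {}" if "g \<in> canon ` W" for g using that vars_canon Wl by blast
    show "?R \<subseteq> polys_in ?V" using polys_in_mono[OF SV] by blast
    show "1 \<in> ?R" by simp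
    show "a * b \<in> ?R" if "a \<in> ?R" "b \<in> ?R" for a b using that by (auto intro: polys_in_mult)
    fix g assume "g \<in> canon ` W"
    then obtain w where w: "w \<in> W" "g = canon w" by blast
    then show "init le g \<in> ?R"
      using canon_shape(4)[of w] Wl sub[OF w(1)] polys_in_mono[of "nbelow w" "nbelow u"] by blast
  qed
  then obtain s r where sr: "s \<in> ?R" "r \<in> polys_in ?V" "s * ?f - r \<in> T"
    "\<forall>g\<in>canon ` W. deg_in (leader le g) r < deg_in (leader le g) g" by (elim bexE conjE)
  have "s * ?f - r \<in> I" using sr(3) by (simp add: T_def)
  moreover have "s * ?f \<in> I" using elt_in_A[OF u] A_subset_I by (intro I_mult) blast
  ultimately have "r \<in> I" using I_diff[of "s * ?f" "s * ?f - r"] by simp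
  moreover have "reduced r"
    unfolding reduced_def
  proof (intro conjI ballI)
    show "r \<in> polys_in pr_vars" by (rule polys_in_mono[OF weakly_below_subset sr(2)])
    fix w assume w: "w \<in> leaders"
    show "deg_in w r < ldeg w"
    proof (cases "le w u")
      case True
      then have "canon w \<in> canon ` W" using w by (simp add: W_def)
      then show ?thesis using bspec[OF sr(4)] canon_shape(1,2)[OF w] by fastforce
    next
      case False
      then have "w \<notin> vars r" using sr(2) unfolding polys_in_iff weakly_below_def by blast
      then show ?thesis using ldeg_pos[OF w] deg_in_eq_0_iff[of w r] by simp
    qed
  qed
  ultimately have "r = 0" by (intro reduced_in_I)
  then obtain a where a: "partial_deriv u (s * ?f) - a * ?S \<in> I" using sr(3) unfolding T_def by auto
  have "u \<notin> nbelow u" by (simp add: nbelow_def)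
  then have "u \<notin> vars s" using sr(1) by (auto simp only: polys_in_iff)
  then have "partial_deriv u (s * ?f) = s * separant le ?f"
    by (simp add: partial_deriv_mult partial_deriv_eq_0 separant_def leader_elt[OF u])
  then have a: "s * separant le ?f - a * ?S \<in> I" using a by simp
  have "s \<in> polys_in nonleaders" "s \<noteq> 0"
    using sr(1) polys_in_mono[of "nbelow u" nonleaders s] by (auto simp: nbelow_def)
  then have reg: "regular (s * separant le ?f)"
    using regular_nonleaders regular_separant[OF elt_in_A[OF u]] regular_mult by blast
  show ?thesis
    unfolding regular_def
  proof (intro allI impI)
    fix x assume x: "?S * x \<in> I"
    have "s * separant le ?f * x = x * (s * separant le ?f - a * ?S) + a * (?S * x)"
      by (simp add: algebra_simps)
    also have "\<dots> \<in> I" by (rule I_add[OF I_mult[OF a] I_mult[OF x]])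
    finally show "x \<in> I" by (rule regularD[OF reg])
  qed
qed

lemma regular_init_sep_prod_canon: "regular (init_sep_prod le (canon ` leaders))"
  unfolding init_sep_prod_def
proof (intro regular_prod regular_mult)
  fix c assume "c \<in> canon ` leaders"
  then obtain u where u: "u \<in> leaders" "c = canon u" by blast
  have "init le c \<in> polys_in nonleaders - {0}"
    using canon_shape(4)[OF u(1)] polys_in_mono[of "nbelow u" nonleaders "init le c"] u(2)
    by (auto simp: nbelow_def)
  then show "regular (init le c)" using regular_nonleaders by blast
  show "regular (separant le c)" unfolding u(2) by (rule regular_separant_canon[OF u(1)])
qed

text \<open>Being reduced with respect to the canonical set and with respect to \<open>A\<close> is
  the same, since leaders and degrees agree. So an element of \<open>I\<close> reduces to
  \<open>0\<close> by the canonical set, which puts it into the saturation; the other inclusion is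
  regularity of the product of initials and separants.\<close>

lemma I_eq_canon: "I = saturation UNIV (diff_ideal \<delta> hull (canon ` leaders)) (init_sep_prod le (canon ` leaders))"
proof
  let ?C = "canon ` leaders"
  let ?T = "diff_ideal \<delta> hull ?C" and ?H = "init_sep_prod le ?C"
  have CI: "?C \<subseteq> I" using canon_shape(5) by blast
  have TI: "?T \<subseteq> I" using CI diff_ideal_I by (intro hull_minimal)
  show "saturation UNIV ?T ?H \<subseteq> I"
  proof
    fix x assume "x \<in> saturation UNIV ?T ?H"
    then obtain m where "?H ^ m * x \<in> ?T" unfolding saturation_def by blast
    then have "?H ^ m * x \<in> I" using TI by blast
    then show "x \<in> I" by (rule regularD[OF regular_power[OF regular_init_sep_prod_canon]])
  qed
  show "I \<subseteq> saturation UNIV ?T ?H"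
  proof
    fix p assume p: "p \<in> I"
    define S where "S = {x. \<exists>m. x dvd ?H ^ m}"
    have T: "diff_ideal \<delta> ?T" by (rule diff_ideal_hull)
    have CT: "?C \<subseteq> ?T" by (rule hull_subset)
    have fin: "finite ?C" using finite_A by simp
    have 1: "1 \<in> S" by (simp add: S_def)
    have mult: "a * b \<in> S" if ab: "a \<in> S" "b \<in> S" for a b
    proof -
      obtain m n where "a dvd ?H ^ m" "b dvd ?H ^ n" using ab unfolding S_def by blast
      then have "a * b dvd ?H ^ (m + n)" unfolding power_add by (rule mult_dvd_mono)
      then show ?thesis unfolding S_def by blast
    qed
    have "init le f dvd ?H ^ 1" "separant le f dvd ?H ^ 1" if "f \<in> ?C" for f
      using dvd_init_sep_prod[OF fin that] by simp_all
    then have SI: "separant le f \<in> S" "init le f \<in> S" if "f \<in> ?C" for f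
      using that unfolding S_def by blast+
    obtain s r where sr: "s \<in> S" "s * p - r \<in> ?T" "\<forall>f\<in>?C. reduced_wrt le r f"
      using differential_reduction[OF T CT autoreduced_canon 1 mult SI] by blast
    have "s * p - r \<in> I" using sr(2) TI by blast
    then have "r \<in> I" using I_diff[OF I_mult[OF p, of s]] by fastforce
    moreover have "reduced_wrt le r f" if "f \<in> A" for f
    proof -
      have l: "leader le f \<in> leaders" using that by blast
      then have "reduced_wrt le r (canon (leader le f))" using sr(3) by blast
      then show ?thesis unfolding reduced_wrt_canon_iff[OF l] elt_leader[OF that] .
    qed
    ultimately have "r = 0" by (intro reduced_eq_zero)
    then have sp: "s * p \<in> ?T" using sr(2) by simp
    obtain m y where y: "?H ^ m = s * y" using sr(1) unfolding S_def by (auto elim: dvdE)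
    have "?H ^ m * p = y * (s * p)" unfolding y by (simp only: mult_ac)
    also have "\<dots> \<in> ?T"
    proof (rule ideal_of_mult[OF _ UNIV_I sp])
      show "ideal_of UNIV ?T" using T unfolding diff_ideal_def by blast
    qed
    finally show "p \<in> saturation UNIV ?T ?H" unfolding saturation_def by blast
  qed
qed

lemma characterizes_canon: "characterizes \<delta> le (canon ` leaders) I"
  unfolding characterizes_def using diff_ideal_I characteristic_set_canon I_eq_canon by blast

lemma canonical_characteristic_set_canon: "canonical_characteristic_set \<delta> le I (canon ` leaders)"
  unfolding canonical_characteristic_set_def Let_def leader_canon_image
proof (intro conjI ballI impI)
  show "characterizable \<delta> le I" unfolding characterizable_def using characterizes by blast
  show "characteristic_set le I (canon ` leaders)" by (rule characteristic_set_canon)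
  fix f assume "f \<in> canon ` leaders"
  then obtain u where u: "u \<in> leaders" "f = canon u" by blast
  show "init le f \<in> polys_in nonleaders"
    using canon_shape(4)[OF u(1)] polys_in_mono[of "nbelow u" nonleaders "init le f"] u(2)
    by (auto simp: nbelow_def)
  show "vars q = {}" if "q \<in> polys_in nonleaders" "q dvd f" for q
    using cleared_primitive[OF u(1) cleared_canon[OF u(1)]] that unfolding u(2) by blast
  show "lead_coefficient le (init le f) = 1"
    unfolding u(2) lead_coefficient_init[OF vars_canon[OF u(1)]]
    by (rule cleared_lead_coefficient[OF u(1) cleared_canon[OF u(1)]])
qed

end

theorem proposition2:
  fixes \<delta> :: "'n::{finite, linorder} \<Rightarrow> 'k::field_char_0 \<Rightarrow> 'k"
    and le :: "('n, 'l::{finite, linorder}) dvar \<Rightarrow> ('n, 'l) dvar \<Rightarrow> bool"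
    and A I C :: "('n, 'l, 'k) dpoly set"
    and L N :: "('n, 'l) dvar set"
    and GB :: "(('n, 'l) dvar, ('n, 'l, 'k) dpoly fract) mpoly set"
  assumes "differential_field \<delta>"
    and "ranking le"
    and "characterizes \<delta> le A I"
    and "L = leader le ` A"
    and "N = - derivatives L"
    and "reduced_groebner_basis le (polys_over_rat_funs N L)
           (saturation (polys_over_rat_funs N L)
              (ideal_of (polys_over_rat_funs N L) hull (embed L ` A))
              (embed L (init_sep_prod le A)))
           GB"
    and "C = {c. \<exists>g\<in>GB. cleared le N L g c}"
  shows "canonical_characteristic_set \<delta> le I C \<and> characterizes \<delta> le C I"
proof -
  interpret characterized_ideal le \<delta> A I
    using assms(1-3) by unfold_locales
  have "GB = gen ` leaders"
    using assms(6) unfolding assms(5) assms(4) J_def[symmetric] by (rule groebner_basis_eq)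
  then have "C = canon ` leaders"
    using assms(7) canon_set unfolding assms(5) assms(4) by simp
  then show ?thesis using canonical_characteristic_set_canon characterizes_canon by simp
qed

end
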